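(* Let $H$ be a braided vector space, $V$ a vector space, and $U\subset H'$ a non-degenerate subspace such that $\Psi_{UU}$ is bijective (hence a braiding on $U$). (1) Let $V$ be a right $H$-braided vector space via $\Psi_{VH}:V\otimes H\to H\otimes V$. Define $\Psi_{UV}:U\otimes V\to(V'\otimes H)'$ by $\Psi_{UV}(f\otimes v)(e\otimes a):=\langle\langle e\otimes f,\Psi_{VH}(v\otimes a)\rangle\rangle$. If $\Psi_{UV}$ is a bijection $U\otimes V\to V\otimes U\subset(V'\otimes H)'$, then it turns $V$ into a left $U$-braided vector space. Moreover: (a) if $H$ is a braided coalgebra, $\Psi_{VH}$ is compatible with the comultiplication of $H$, and $U$ is a (unital) subalgebra of $(H',\underline{*})$, then $\Psi_{UV}$ is compatible with the multiplication $\underline{*}$ of $U$; (b) if $H$ is a braided unital algebra, $\Psi_{VH}$ is compatible with the multiplication of $H$, and $U$ is a subcoalgebra of $H^{\underline\circ}$, then $\Psi_{UV}$ is compatible with the comultiplication $\underline\Delta$ of $U$; (c) if $V$ is an algebra and $\Psi_{VH}$ is compatible with the multiplication of $V$, then $\Psi_{UV}$ is compatible with the multiplication of $V$; (d) if $V$ is a coalgebra and $\Psi_{VH}$ is compatible with the comultiplication of $V$, then $\Psi_{UV}$ is compatible with the comultiplication of $V$. (2) Let $V$ be a left $H$-braided vector space via $\Psi_{HV}:H\otimes V\to V\otimes H$. Define $\Psi_{VU}:V\otimes U\to(H\otimes V')'$ by $\Psi_{VU}(v\otimes f)(a\otimes e):=\langle\langle f\otimes e,\Psi_{HV}(a\otimes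 v)\rangle\rangle$. If $\Psi_{VU}$ is a bijection $V\otimes U\to U\otimes V\subset(H\otimes V')'$, then it turns $V$ into a right $U$-braided vector space, and (a)–(d) hold with $\Psi_{VH}$, $\Psi_{UV}$ replaced by $\Psi_{HV}$, $\Psi_{VU}$. (3) Let $V$ be a right $H$-braided vector space via $\Psi_{VH}$. Define $\Psi_{VU}^\circ:V\otimes U\to(H\otimes V')'$ by $\Psi_{VU}^\circ(v\otimes f)(a\otimes e):=\langle\langle f\otimes e,\Psi_{VH}^{-1}(a\otimes v)\rangle\rangle$. If it is a bijection $V\otimes U\to U\otimes V$, then it turns $V$ into a right $U$-braided vector space, and (a)–(d) hold with $\Psi_{UV}$ replaced by $\Psi_{VU}^\circ$. (4) Let $V$ be a left $H$-braided vector space via $\Psi_{HV}$. Define $\Psi_{UV}^\circ:U\otimes V\to(V'\otimes H)'$ by $\Psi_{UV}^\circ(f\otimes v)(e\otimes a):=\langle\langle e\otimes f,\Psi_{HV}^{-1}(v\otimes a)\rangle\rangle$. If it is a bijection $U\otimes V\to V\otimes U$, then it turns $V$ into a left $U$-braided vector space, and (a)–(d) hold with $\Psi_{VH}$, $\Psi_{UV}$ replaced by $\Psi_{HV}$, $\Psi_{UV}^\circ$.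
   Context: All vector spaces are over a fixed field $\mathbb K$, $\otimes$ is the algebraic tensor product, $X'$ is the full linear dual of $X$, and composition of maps is written by juxtaposition. A braiding on $V$ is a bijective linear map $\Psi_{VV}:V\otimes V\to V\otimes V$ with $(\Psi_{VV}\otimes\mathrm{id})(\mathrm{id}\otimes\Psi_{VV})(\Psi_{VV}\otimes\mathrm{id})=(\mathrm{id}\otimes\Psi_{VV})(\Psi_{VV}\otimes\mathrm{id})(\mathrm{id}\otimes\Psi_{VV})$; $V$ is then a braided vector space. Let $\Psi_{VW}:V\otimes W\to W\otimes V$ be bijective and linear. If $V$ is braided, $W$ is a left $V$-braided vector space if $(\Psi_{VW}\otimes\mathrm{id})(\mathrm{id}\otimes\Psi_{VW})(\Psi_{VV}\otimes\mathrm{id})=(\mathrm{id}\otimes\Psi_{VV})(\Psi_{VW}\otimes\mathrm{id})(\mathrm{id}\otimes\Psi_{VW})$. If $W$ is braided, $V$ is a right $W$-braided vector space if $(\mathrm{id}\otimes\Psi_{VW})(\Psi_{VW}\otimes\mathrm{id})(\mathrm{id}\otimes\Psi_{WW})=(\Psi_{WW}\otimes\mathrm{id})(\mathrm{id}\otimes\Psi_{VW})(\Psi_{VW}\otimes\mathrm{id})$. Compatibility of $\Psi=\Psi_{VW}$: with the multiplication of an algebra $V$: $\Psi(m_V\otimes\mathrm{id})=(\mathrm{id}\otimes m_V)(\Psi\otimes\mathrm{id})(\mathrm{id}\otimes\Psi)$ and $\Psi(1\otimes w)=w\otimes1$ if $1\in V$; with the multiplication of an algebra $W$: $\Psi(\mathrm{id}\otimes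 m_W)=(m_W\otimes\mathrm{id})(\mathrm{id}\otimes\Psi)(\Psi\otimes\mathrm{id})$ and $\Psi(v\otimes1)=1\otimes v$ if $1\in W$; with the comultiplication of a coalgebra $V$: $(\mathrm{id}\otimes\Delta)\Psi=(\Psi\otimes\mathrm{id})(\mathrm{id}\otimes\Psi)(\Delta\otimes\mathrm{id})$ and $(\mathrm{id}\otimes\varepsilon)\Psi=\varepsilon\otimes\mathrm{id}$; with the comultiplication of a coalgebra $W$: $(\Delta\otimes\mathrm{id})\Psi=(\mathrm{id}\otimes\Psi)(\Psi\otimes\mathrm{id})(\mathrm{id}\otimes\Delta)$ and $(\varepsilon\otimes\mathrm{id})\Psi=\mathrm{id}\otimes\varepsilon$. A braided (co)algebra is a (co)algebra with a braiding satisfying both compatibility conditions with its (co)multiplication. Duality notation: $\langle f,a\rangle=\langle a,f\rangle=f(a)$. $U\subset H'$ is non-degenerate if it separates the points of $H$. $\langle\langle\xi\otimes\eta,x\otimes y\rangle\rangle:=\langle\xi,y\rangle\langle\eta,x\rangle$. Tensor products are embedded into duals by $(\xi\otimes\eta)(x\otimes y)=\langle\xi,x\rangle\langle\eta,y\rangle$, e.g. $V\otimes U\subset(V'\otimes H)'$, $U\otimes V\subset(H\otimes V')'$. $\Psi_{UU}(f\otimes g)(b\otimes a):=\langle\langle f\otimes g,\Psi_{HH}(a\otimes b)\rangle\rangle$ for $f,g\in U$, $a,b\in H$, with values a priori in $(H\otimes H)'\supset U\otimes U$; it is called bijective if it is a bijection $U\otimes U\to U\otimes U$. In the formulas of the claim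 $a\in H$, $v\in V$, $f\in U$, $e\in V'$. For a braided coalgebra $H$: $(f\,\underline{*}\,g)(a):=\langle\langle f\otimes g,\Psi_{HH}(\Delta(a))\rangle\rangle$ is an associative product on $H'$ with unit $\varepsilon$. For a braided unital algebra $H$: $\underline\Delta(f)$, $f\in H'$, is determined by $\langle\langle\underline\Delta(f),a\otimes b\rangle\rangle=f(m\Psi_{HH}(a\otimes b))$, and $H^{\underline\circ}$ is the largest coalgebra in $H'$ with coproduct $\underline\Delta$ and counit $f\mapsto f(1)$; thus a subcoalgebra $U$ satisfies $\underline\Delta(U)\subset U\otimes U$. *)

theory Defs
  imports Complex_Main "HOL-Library.Function_Algebras"
begin

section \<open>Vector spaces\<close>

text \<open>
  A vector space is a subspace of an ambient type that is a vector space in the sense of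
  HOL.Vector_Spaces. Functions into the field carry pointwise operations. All maps are
  functions whose values matter only on the carrier of their domain.
\<close>

record ('k, 'a) vecsp =
  carr :: "'a set"
  scl :: "'k \<Rightarrow> 'a \<Rightarrow> 'a"

definition vs :: "('k::field, 'a::ab_group_add) vecsp \<Rightarrow> bool" where
  "vs X \<longleftrightarrow> vector_space (scl X) \<and> module.subspace (scl X) (carr X)"

definition subsp :: "('k::field, 'a::ab_group_add) vecsp \<Rightarrow> ('k, 'a) vecsp \<Rightarrow> bool" where
  "subsp U X \<longleftrightarrow> scl U = scl X \<and> carr U \<subseteq> carr X \<and> module.subspace (scl X) (carr U)"

definition lin :: "('k::field, 'a::ab_group_add) vecsp \<Rightarrow> ('k, 'b::ab_group_add) vecsp \<Rightarrow> ('a \<Rightarrow> 'b) \<Rightarrow> bool" where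
  "lin X Y f \<longleftrightarrow>
     (\<forall>x\<in>carr X. f x \<in> carr Y) \<and>
     (\<forall>x\<in>carr X. \<forall>y\<in>carr X. f (x + y) = f x + f y) \<and>
     (\<forall>c. \<forall>x\<in>carr X. f (scl X c x) = scl Y c (f x))"

definition lin_bij :: "('k::field, 'a::ab_group_add) vecsp \<Rightarrow> ('k, 'b::ab_group_add) vecsp \<Rightarrow> ('a \<Rightarrow> 'b) \<Rightarrow> bool" where
  "lin_bij X Y f \<longleftrightarrow> lin X Y f \<and> bij_betw f (carr X) (carr Y)"

definition bilin :: "('k::field, 'a::ab_group_add) vecsp \<Rightarrow> ('k, 'b::ab_group_add) vecsp \<Rightarrow>
    ('k, 'c::ab_group_add) vecsp \<Rightarrow> ('a \<Rightarrow> 'b \<Rightarrow> 'c) \<Rightarrow> bool" where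
  "bilin X Y Z b \<longleftrightarrow> (\<forall>x\<in>carr X. lin Y Z (b x)) \<and> (\<forall>y\<in>carr Y. lin X Z (\<lambda>x. b x y))"

definition Kvec :: "('k::field, 'k) vecsp" where
  "Kvec = \<lparr>carr = UNIV, scl = (*)\<rparr>"

definition pw :: "'k::field \<Rightarrow> ('i \<Rightarrow> 'k) \<Rightarrow> ('i \<Rightarrow> 'k)" where
  "pw c f = (\<lambda>x. c * f x)"

text \<open>
  Linear functionals are made unique as functions by requiring the value 0 outside the carrier.
\<close>

definition dual :: "('k::field, 'a::ab_group_add) vecsp \<Rightarrow> ('k, 'a \<Rightarrow> 'k) vecsp" where
  "dual X = \<lparr>carr = {f. lin X Kvec f \<and> (\<forall>x. x \<notin> carr X \<longrightarrow> f x = 0)}, scl = pw\<rparr>"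


section \<open>The algebraic tensor product\<close>

text \<open>
  The elementary tensor of x and y is evaluation of bilinear forms at (x, y), and the tensor
  product is the span of the elementary tensors inside the functions on bilinear forms.
  The universal property is proved below; tlift is the induced linear map.
\<close>

type_synonym ('a, 'b, 'k) tens = "('a \<Rightarrow> 'b \<Rightarrow> 'k) \<Rightarrow> 'k"

definition tens :: "('k::field, 'a::ab_group_add) vecsp \<Rightarrow> ('k, 'b::ab_group_add) vecsp \<Rightarrow>
    'a \<Rightarrow> 'b \<Rightarrow> ('a, 'b, 'k) tens" where
  "tens X Y x y = (\<lambda>\<beta>. if bilin X Y Kvec \<beta> then \<beta> x y else 0)"

definition tensor :: "('k::field, 'a::ab_group_add) vecsp \<Rightarrow> ('k, 'b::ab_group_add) vecsp \<Rightarrow>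
    ('k, ('a, 'b, 'k) tens) vecsp" (infixr "\<otimes>" 70) where
  "X \<otimes> Y = \<lparr>carr = module.span pw {tens X Y x y | x y. x \<in> carr X \<and> y \<in> carr Y}, scl = pw\<rparr>"

definition tlift :: "('k::field, 'a::ab_group_add) vecsp \<Rightarrow> ('k, 'b::ab_group_add) vecsp \<Rightarrow>
    ('k, 'c::ab_group_add) vecsp \<Rightarrow> ('a \<Rightarrow> 'b \<Rightarrow> 'c) \<Rightarrow> ('a, 'b, 'k) tens \<Rightarrow> 'c" where
  "tlift X Y Z b = (THE F. lin (X \<otimes> Y) Z F \<and>
     (\<forall>x\<in>carr X. \<forall>y\<in>carr Y. F (tens X Y x y) = b x y) \<and> (\<forall>t. t \<notin> carr (X \<otimes> Y) \<longrightarrow> F t = 0))"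

lemma vector_space_pw: "vector_space (pw :: 'k::field \<Rightarrow> ('i \<Rightarrow> 'k) \<Rightarrow> _)"
  by unfold_locales (auto simp: pw_def fun_eq_iff algebra_simps)

lemma vector_space_times: "vector_space ((*) :: 'k::field \<Rightarrow> 'k \<Rightarrow> 'k)"
  by unfold_locales (auto simp: algebra_simps)

lemma module_pw: "module (pw :: 'k::field \<Rightarrow> ('i \<Rightarrow> 'k) \<Rightarrow> _)"
  using vector_space_pw unfolding vector_space_def module_def by blast

lemma functionals_separate:
  fixes s :: "'k::field \<Rightarrow> 'a::ab_group_add \<Rightarrow> 'a"
  assumes "vector_space s" "x \<noteq> 0"
  shows "\<exists>\<phi>. Vector_Spaces.linear s (*) \<phi> \<and> \<phi> x \<noteq> 0"
proof -
  interpret vector_space_pair s "(*) :: 'k \<Rightarrow> 'k \<Rightarrow> 'k"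
    using assms(1) vector_space_times by (simp add: vector_space_pair_def)
  have "vs1.independent {x}" using assms(2) by simp
  from linear_independent_extend[OF this, of "\<lambda>_. 1"] show ?thesis by force
qed

lemma vs_dual:
  assumes "vs X"
  shows "vs (dual X)"
proof -
  from assms interpret module "scl X"
    unfolding vs_def vector_space_def module_def by blast
  from assms have "subspace (carr X)" by (simp add: vs_def)
  then show ?thesis
    unfolding vs_def dual_def module.subspace_def[OF module_pw]
    by (auto simp: vector_space_pw module.subspace_def[OF module_pw] lin_def Kvec_def pw_def
        algebra_simps subspace_add subspace_scale)
qed

lemma vs_tensor: "vs (X \<otimes> Y)"
  by (simp add: vs_def tensor_def vector_space_pw module.subspace_span[OF module_pw])

lemma tensor_universal:
  fixes X :: "('k::field, 'a::ab_group_add) vecsp" and Y :: "('k, 'b::ab_group_add) vecsp"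
    and Z :: "('k, 'c::ab_group_add) vecsp"
  assumes Z: "vs Z" and b: "bilin X Y Z b"
  shows "\<exists>!F. lin (X \<otimes> Y) Z F \<and>
     (\<forall>x\<in>carr X. \<forall>y\<in>carr Y. F (tens X Y x y) = b x y) \<and> (\<forall>t. t \<notin> carr (X \<otimes> Y) \<longrightarrow> F t = 0)"
proof -
  interpret P: module "pw :: 'k \<Rightarrow> (('a, 'b, 'k) tens) \<Rightarrow> _" by (rule module_pw)
  interpret Z: vector_space "scl Z" using Z by (simp add: vs_def)
  have sub: "Z.subspace (carr Z)" using Z by (simp add: vs_def)
  define B where "B = {tens X Y x y | x y. x \<in> carr X \<and> y \<in> carr Y}"
  have carr: "carr (X \<otimes> Y) = P.span B" and scl: "scl (X \<otimes> Y) = pw"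
    by (simp_all add: tensor_def B_def)
  define L where "L = {\<phi>. Vector_Spaces.linear (scl Z) (*) \<phi>}"
  have L: "\<phi> (u + v) = \<phi> u + \<phi> v" "\<phi> (scl Z c u) = c * \<phi> u" if "\<phi> \<in> L" for \<phi> u v c
    using that unfolding L_def Vector_Spaces.linear_def module_hom_def module_hom_axioms_def by auto
  have L0: "\<phi> 0 = 0" if "\<phi> \<in> L" for \<phi> using L(2)[OF that, of 0 0] by simp
  have form: "bilin X Y Kvec (\<lambda>x y. \<phi> (b x y))" if "\<phi> \<in> L" for \<phi>
    using b L[OF that] by (auto simp: bilin_def lin_def Kvec_def)
  have inj: "u = v" if "\<And>\<phi>. \<phi> \<in> L \<Longrightarrow> \<phi> u = \<phi> v" for u v
  proof (rule ccontr)
    assume "u \<noteq> v"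
    then obtain \<phi> where p: "\<phi> \<in> L" "\<phi> (u - v) \<noteq> 0"
      using functionals_separate[of "scl Z" "u - v"] Z by (auto simp: vs_def L_def)
    with L(1)[OF p(1), of "u - v" v] that[OF p(1)] show False by simp
  qed
  define R where "R t z \<longleftrightarrow> z \<in> carr Z \<and> (\<forall>\<phi>\<in>L. \<phi> z = t (\<lambda>x y. \<phi> (b x y)))" for t z
  have R_unique: "u = v" if "R t u" "R t v" for t u v
    using that unfolding R_def by (intro inj) metis
  have R_add: "R (s + t) (u + v)" if "R s u" "R t v" for s t u v
    using that sub L by (auto simp: R_def Z.subspace_add)
  have R_scale: "R (pw c t) (scl Z c u)" if "R t u" for t c u
    using that sub L by (auto simp: R_def Z.subspace_scale pw_def)
  have R_tens: "R (tens X Y x y) (b x y)" if "x \<in> carr X" "y \<in> carr Y" for x y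
    using that form b by (auto simp: R_def tens_def bilin_def lin_def)
  have R_ex: "\<exists>z. R t z" if "t \<in> P.span B" for t
  proof (rule P.span_induct[OF that, of "\<lambda>t. \<exists>z. R t z"])
    show "P.subspace {t. \<exists>z. R t z}"
      unfolding P.subspace_def
    proof (intro conjI ballI allI)
      have "R 0 0" using L0 sub by (auto simp: R_def Z.subspace_0)
      then show "0 \<in> {t. \<exists>z. R t z}" by blast
    qed (use R_add R_scale in blast)+
  qed (use R_tens B_def in auto)
  define F where "F t = (if t \<in> P.span B then THE z. R t z else 0)" for t
  have F: "R t (F t)" if "t \<in> P.span B" for t
    using that R_ex[OF that] R_unique by (auto simp: F_def intro: theI2)
  show ?thesis
  proof (rule ex1I[of _ F], intro conjI ballI allI impI)
    show "lin (X \<otimes> Y) Z F"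
      unfolding lin_def carr scl
    proof (intro conjI ballI allI)
      fix s assume s: "s \<in> P.span B"
      show "F s \<in> carr Z" using F[OF s] by (simp add: R_def)
      show "F (s + t) = F s + F t" if t: "t \<in> P.span B" for t
        by (rule R_unique[OF F R_add[OF F[OF s] F[OF t]]]) (rule P.span_add[OF s t])
      show "F (pw c s) = scl Z c (F s)" for c
        by (rule R_unique[OF F R_scale[OF F[OF s]]]) (rule P.span_scale[OF s])
    qed
    show "F (tens X Y x y) = b x y" if "x \<in> carr X" "y \<in> carr Y" for x y
      by (rule R_unique[OF F R_tens[OF that]]) (use that in \<open>auto intro!: P.span_base simp: B_def\<close>)
    show "F t = 0" if "t \<notin> carr (X \<otimes> Y)" for t
      using that by (simp add: F_def carr)
  next
    fix G
    assume G: "lin (X \<otimes> Y) Z G \<and>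
     (\<forall>x\<in>carr X. \<forall>y\<in>carr Y. G (tens X Y x y) = b x y) \<and> (\<forall>t. t \<notin> carr (X \<otimes> Y) \<longrightarrow> G t = 0)"
    have "t \<in> P.span B \<and> R t (G t)" if "t \<in> P.span B" for t
    proof (rule P.span_induct[OF that, of "\<lambda>t. t \<in> P.span B \<and> R t (G t)"])
      have a: "G (s + t) = G s + G t" "G (pw c s) = scl Z c (G s)"
        if "s \<in> P.span B" "t \<in> P.span B" for s t c
        using G that by (auto simp: lin_def carr scl)
      have "G 0 = 0" using a(2)[of 0 0 0] P.span_zero by (simp add: pw_def zero_fun_def)
      then have "R 0 (G 0)" using L0 sub by (auto simp: R_def Z.subspace_0)
      then show "P.subspace {t. t \<in> P.span B \<and> R t (G t)}"
        unfolding P.subspace_def using a R_add R_scale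
        by (auto simp: P.span_zero P.span_add P.span_scale)
    next
      fix t assume "t \<in> B"
      then show "t \<in> P.span B \<and> R t (G t)"
        using G R_tens by (auto simp: B_def intro!: P.span_base)
    qed
    then have "G t = F t" for t
      using G F[of t] R_unique[of t "G t" "F t"] by (cases "t \<in> P.span B") (auto simp: carr F_def)
    then show "G = F" by blast
  qed
qed

lemma tlift_props:
  assumes "vs Z" "bilin X Y Z b"
  shows "lin (X \<otimes> Y) Z (tlift X Y Z b)"
    and "\<And>x y. x \<in> carr X \<Longrightarrow> y \<in> carr Y \<Longrightarrow> tlift X Y Z b (tens X Y x y) = b x y"
  using theI'[OF tensor_universal[OF assms]] unfolding tlift_def by blast+

text \<open>The tensor product of linear maps f from X to X' and g from Y to Y'.\<close>

definition tmap :: "('k::field, 'a::ab_group_add) vecsp \<Rightarrow> ('k, 'b::ab_group_add) vecsp \<Rightarrow>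
    ('k, 'c::ab_group_add) vecsp \<Rightarrow> ('k, 'd::ab_group_add) vecsp \<Rightarrow>
    ('a \<Rightarrow> 'c) \<Rightarrow> ('b \<Rightarrow> 'd) \<Rightarrow> ('a, 'b, 'k) tens \<Rightarrow> ('c, 'd, 'k) tens" where
  "tmap X Y X' Y' f g = tlift X Y (X' \<otimes> Y') (\<lambda>x y. tens X' Y' (f x) (g y))"

definition assocR :: "('k::field, 'a::ab_group_add) vecsp \<Rightarrow> ('k, 'b::ab_group_add) vecsp \<Rightarrow>
    ('k, 'c::ab_group_add) vecsp \<Rightarrow> (('a, 'b, 'k) tens, 'c, 'k) tens \<Rightarrow> ('a, ('b, 'c, 'k) tens, 'k) tens" where
  "assocR X Y Z = tlift (X \<otimes> Y) Z (X \<otimes> (Y \<otimes> Z))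
     (\<lambda>t z. tlift X Y (X \<otimes> (Y \<otimes> Z)) (\<lambda>x y. tens X (Y \<otimes> Z) x (tens Y Z y z)) t)"

definition assocL :: "('k::field, 'a::ab_group_add) vecsp \<Rightarrow> ('k, 'b::ab_group_add) vecsp \<Rightarrow>
    ('k, 'c::ab_group_add) vecsp \<Rightarrow> ('a, ('b, 'c, 'k) tens, 'k) tens \<Rightarrow> (('a, 'b, 'k) tens, 'c, 'k) tens" where
  "assocL X Y Z = tlift X (Y \<otimes> Z) ((X \<otimes> Y) \<otimes> Z)
     (\<lambda>x t. tlift Y Z ((X \<otimes> Y) \<otimes> Z) (\<lambda>y z. tens (X \<otimes> Y) Z (tens X Y x y) z) t)"

text \<open>
  Threefold tensor products are bracketed to the right. For a map \<open>\<Psi>\<close> from \<open>X \<otimes> Y\<close> to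
  \<open>Y \<otimes> X\<close>, the map \<open>\<Psi>\<close> tensor id on \<open>X \<otimes> Y \<otimes> Z\<close> is \<open>fstT X Y Z \<Psi>\<close>, and id tensor \<open>\<Psi>\<close>
  on \<open>Z \<otimes> X \<otimes> Y\<close> is \<open>sndT Z X Y \<Psi>\<close>.
\<close>

definition fstT :: "('k::field, 'a::ab_group_add) vecsp \<Rightarrow> ('k, 'b::ab_group_add) vecsp \<Rightarrow>
    ('k, 'c::ab_group_add) vecsp \<Rightarrow> (('a, 'b, 'k) tens \<Rightarrow> ('b, 'a, 'k) tens) \<Rightarrow>
    ('a, ('b, 'c, 'k) tens, 'k) tens \<Rightarrow> ('b, ('a, 'c, 'k) tens, 'k) tens" where
  "fstT X Y Z \<Psi> t = assocR Y X Z (tmap (X \<otimes> Y) Z (Y \<otimes> X) Z \<Psi> id (assocL X Y Z t))"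

definition sndT :: "('k::field, 'c::ab_group_add) vecsp \<Rightarrow> ('k, 'a::ab_group_add) vecsp \<Rightarrow>
    ('k, 'b::ab_group_add) vecsp \<Rightarrow> (('a, 'b, 'k) tens \<Rightarrow> ('b, 'a, 'k) tens) \<Rightarrow>
    ('c, ('a, 'b, 'k) tens, 'k) tens \<Rightarrow> ('c, ('b, 'a, 'k) tens, 'k) tens" where
  "sndT Z X Y \<Psi> t = tmap Z (X \<otimes> Y) Z (Y \<otimes> X) id \<Psi> t"


section \<open>Braidings\<close>

definition braided :: "('k::field, 'v::ab_group_add) vecsp \<Rightarrow> (('v, 'v, 'k) tens \<Rightarrow> ('v, 'v, 'k) tens) \<Rightarrow> bool" where
  "braided V \<Psi> \<longleftrightarrow> vs V \<and> lin_bij (V \<otimes> V) (V \<otimes> V) \<Psi> \<and>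
     (\<forall>t\<in>carr (V \<otimes> V \<otimes> V).
        fstT V V V \<Psi> (sndT V V V \<Psi> (fstT V V V \<Psi> t)) = sndT V V V \<Psi> (fstT V V V \<Psi> (sndT V V V \<Psi> t)))"

text \<open>\<open>W\<close> is a left \<open>V\<close>-braided vector space via \<open>\<Psi>\<^sub>V\<^sub>W\<close>.\<close>

definition left_braided :: "('k::field, 'v::ab_group_add) vecsp \<Rightarrow> (('v, 'v, 'k) tens \<Rightarrow> ('v, 'v, 'k) tens) \<Rightarrow>
    ('k, 'w::ab_group_add) vecsp \<Rightarrow> (('v, 'w, 'k) tens \<Rightarrow> ('w, 'v, 'k) tens) \<Rightarrow> bool" where
  "left_braided V \<Psi>VV W \<Psi>VW \<longleftrightarrow> braided V \<Psi>VV \<and> vs W \<and> lin_bij (V \<otimes> W) (W \<otimes> V) \<Psi>VW \<and>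
     (\<forall>t\<in>carr (V \<otimes> V \<otimes> W).
        fstT V W V \<Psi>VW (sndT V V W \<Psi>VW (fstT V V W \<Psi>VV t)) =
        sndT W V V \<Psi>VV (fstT V W V \<Psi>VW (sndT V V W \<Psi>VW t)))"

text \<open>\<open>V\<close> is a right \<open>W\<close>-braided vector space via \<open>\<Psi>\<^sub>V\<^sub>W\<close>.\<close>

definition right_braided :: "('k::field, 'w::ab_group_add) vecsp \<Rightarrow> (('w, 'w, 'k) tens \<Rightarrow> ('w, 'w, 'k) tens) \<Rightarrow>
    ('k, 'v::ab_group_add) vecsp \<Rightarrow> (('v, 'w, 'k) tens \<Rightarrow> ('w, 'v, 'k) tens) \<Rightarrow> bool" where
  "right_braided W \<Psi>WW V \<Psi>VW \<longleftrightarrow> braided W \<Psi>WW \<and> vs V \<and> lin_bij (V \<otimes> W) (W \<otimes> V) \<Psi>VW \<and>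
     (\<forall>t\<in>carr (V \<otimes> W \<otimes> W).
        sndT W V W \<Psi>VW (fstT V W W \<Psi>VW (sndT V W W \<Psi>WW t)) =
        fstT W W V \<Psi>WW (sndT W V W \<Psi>VW (fstT V W W \<Psi>VW t)))"


section \<open>Algebras, coalgebras and compatibility\<close>

text \<open>Algebras need not be unital. A unit, if there is one, is determined by the multiplication.\<close>

definition algebra :: "('k::field, 'a::ab_group_add) vecsp \<Rightarrow> (('a, 'a, 'k) tens \<Rightarrow> 'a) \<Rightarrow> bool" where
  "algebra A m \<longleftrightarrow> vs A \<and> lin (A \<otimes> A) A m \<and>
     (\<forall>x\<in>carr A. \<forall>y\<in>carr A. \<forall>z\<in>carr A.
        m (tens A A (m (tens A A x y)) z) = m (tens A A x (m (tens A A y z))))"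

definition is_unit_of :: "('k::field, 'a::ab_group_add) vecsp \<Rightarrow> (('a, 'a, 'k) tens \<Rightarrow> 'a) \<Rightarrow> 'a \<Rightarrow> bool" where
  "is_unit_of A m u \<longleftrightarrow> u \<in> carr A \<and> (\<forall>x\<in>carr A. m (tens A A u x) = x \<and> m (tens A A x u) = x)"

definition coalgebra :: "('k::field, 'c::ab_group_add) vecsp \<Rightarrow> ('c \<Rightarrow> ('c, 'c, 'k) tens) \<Rightarrow> ('c \<Rightarrow> 'k) \<Rightarrow> bool" where
  "coalgebra C \<Delta> \<epsilon> \<longleftrightarrow> vs C \<and> lin C (C \<otimes> C) \<Delta> \<and> lin C Kvec \<epsilon> \<and>
     (\<forall>x\<in>carr C. assocR C C C (tmap C C (C \<otimes> C) C \<Delta> id (\<Delta> x)) = tmap C C C (C \<otimes> C) id \<Delta> (\<Delta> x)) \<and>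
     (\<forall>x\<in>carr C. tlift C C C (\<lambda>y z. scl C (\<epsilon> y) z) (\<Delta> x) = x) \<and>
     (\<forall>x\<in>carr C. tlift C C C (\<lambda>y z. scl C (\<epsilon> z) y) (\<Delta> x) = x)"

text \<open>
  Compatibility of \<open>\<Psi>\<close>, a map from \<open>V \<otimes> W\<close> to \<open>W \<otimes> V\<close>, with a structure on the left
  factor \<open>V\<close> (suffix L) or on the right factor \<open>W\<close> (suffix R).
\<close>

definition mult_compatL :: "('k::field, 'v::ab_group_add) vecsp \<Rightarrow> ('k, 'w::ab_group_add) vecsp \<Rightarrow>
    (('v, 'v, 'k) tens \<Rightarrow> 'v) \<Rightarrow> (('v, 'w, 'k) tens \<Rightarrow> ('w, 'v, 'k) tens) \<Rightarrow> bool" where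
  "mult_compatL V W m \<Psi> \<longleftrightarrow>
     (\<forall>t\<in>carr (V \<otimes> V \<otimes> W).
        \<Psi> (tmap (V \<otimes> V) W V W m id (assocL V V W t)) =
        tmap W (V \<otimes> V) W V id m (fstT V W V \<Psi> (sndT V V W \<Psi> t))) \<and>
     (\<forall>u. is_unit_of V m u \<longrightarrow> (\<forall>w\<in>carr W. \<Psi> (tens V W u w) = tens W V w u))"

definition mult_compatR :: "('k::field, 'v::ab_group_add) vecsp \<Rightarrow> ('k, 'w::ab_group_add) vecsp \<Rightarrow>
    (('w, 'w, 'k) tens \<Rightarrow> 'w) \<Rightarrow> (('v, 'w, 'k) tens \<Rightarrow> ('w, 'v, 'k) tens) \<Rightarrow> bool" where
  "mult_compatR V W m \<Psi> \<longleftrightarrow>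
     (\<forall>t\<in>carr (V \<otimes> W \<otimes> W).
        \<Psi> (tmap V (W \<otimes> W) V W id m t) =
        tmap (W \<otimes> W) V W V m id (assocL W W V (sndT W V W \<Psi> (fstT V W W \<Psi> t)))) \<and>
     (\<forall>u. is_unit_of W m u \<longrightarrow> (\<forall>v\<in>carr V. \<Psi> (tens V W v u) = tens W V u v))"

definition comult_compatL :: "('k::field, 'v::ab_group_add) vecsp \<Rightarrow> ('k, 'w::ab_group_add) vecsp \<Rightarrow>
    ('v \<Rightarrow> ('v, 'v, 'k) tens) \<Rightarrow> ('v \<Rightarrow> 'k) \<Rightarrow> (('v, 'w, 'k) tens \<Rightarrow> ('w, 'v, 'k) tens) \<Rightarrow> bool" where
  "comult_compatL V W \<Delta> \<epsilon> \<Psi> \<longleftrightarrow>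
     (\<forall>t\<in>carr (V \<otimes> W).
        tmap W V W (V \<otimes> V) id \<Delta> (\<Psi> t) =
        fstT V W V \<Psi> (sndT V V W \<Psi> (assocR V V W (tmap V W (V \<otimes> V) W \<Delta> id t)))) \<and>
     (\<forall>t\<in>carr (V \<otimes> W).
        tlift W V W (\<lambda>w v. scl W (\<epsilon> v) w) (\<Psi> t) = tlift V W W (\<lambda>v w. scl W (\<epsilon> v) w) t)"

definition comult_compatR :: "('k::field, 'v::ab_group_add) vecsp \<Rightarrow> ('k, 'w::ab_group_add) vecsp \<Rightarrow>
    ('w \<Rightarrow> ('w, 'w, 'k) tens) \<Rightarrow> ('w \<Rightarrow> 'k) \<Rightarrow> (('v, 'w, 'k) tens \<Rightarrow> ('w, 'v, 'k) tens) \<Rightarrow> bool" where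
  "comult_compatR V W \<Delta> \<epsilon> \<Psi> \<longleftrightarrow>
     (\<forall>t\<in>carr (V \<otimes> W).
        assocR W W V (tmap W V (W \<otimes> W) V \<Delta> id (\<Psi> t)) =
        sndT W V W \<Psi> (fstT V W W \<Psi> (tmap V W V (W \<otimes> W) id \<Delta> t))) \<and>
     (\<forall>t\<in>carr (V \<otimes> W).
        tlift W V V (\<lambda>w v. scl V (\<epsilon> w) v) (\<Psi> t) = tlift V W V (\<lambda>v w. scl V (\<epsilon> w) v) t)"

definition braided_coalgebra :: "('k::field, 'h::ab_group_add) vecsp \<Rightarrow> (('h, 'h, 'k) tens \<Rightarrow> ('h, 'h, 'k) tens) \<Rightarrow>
    ('h \<Rightarrow> ('h, 'h, 'k) tens) \<Rightarrow> ('h \<Rightarrow> 'k) \<Rightarrow> bool" where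
  "braided_coalgebra H \<Psi> \<Delta> \<epsilon> \<longleftrightarrow> coalgebra H \<Delta> \<epsilon> \<and> braided H \<Psi> \<and>
     comult_compatL H H \<Delta> \<epsilon> \<Psi> \<and> comult_compatR H H \<Delta> \<epsilon> \<Psi>"

definition braided_unital_algebra :: "('k::field, 'h::ab_group_add) vecsp \<Rightarrow> (('h, 'h, 'k) tens \<Rightarrow> ('h, 'h, 'k) tens) \<Rightarrow>
    (('h, 'h, 'k) tens \<Rightarrow> 'h) \<Rightarrow> 'h \<Rightarrow> bool" where
  "braided_unital_algebra H \<Psi> m u \<longleftrightarrow> algebra H m \<and> is_unit_of H m u \<and> braided H \<Psi> \<and>
     mult_compatL H H m \<Psi> \<and> mult_compatR H H m \<Psi>"


section \<open>Duality\<close>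

text \<open>The functional on \<open>X \<otimes> Y\<close> that sends the tensor of x and y to \<open>\<xi> y * \<eta> x\<close>.\<close>

definition dpair :: "('k::field, 'a::ab_group_add) vecsp \<Rightarrow> ('k, 'b::ab_group_add) vecsp \<Rightarrow>
    ('b \<Rightarrow> 'k) \<Rightarrow> ('a \<Rightarrow> 'k) \<Rightarrow> ('a, 'b, 'k) tens \<Rightarrow> 'k" where
  "dpair X Y \<xi> \<eta> = tlift X Y Kvec (\<lambda>x y. \<xi> y * \<eta> x)"

text \<open>
  The map from \<open>A \<otimes> B\<close> to the dual of \<open>X \<otimes> Y\<close> induced by pairings p of A with X and q of B
  with Y. The next three definitions are its instances for the inclusions of \<open>U \<otimes> U\<close>,
  \<open>V \<otimes> U\<close> and \<open>U \<otimes> V\<close> into duals.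
\<close>

definition emb :: "('k::field, 'a::ab_group_add) vecsp \<Rightarrow> ('k, 'b::ab_group_add) vecsp \<Rightarrow>
    ('k, 'x::ab_group_add) vecsp \<Rightarrow> ('k, 'y::ab_group_add) vecsp \<Rightarrow>
    ('a \<Rightarrow> 'x \<Rightarrow> 'k) \<Rightarrow> ('b \<Rightarrow> 'y \<Rightarrow> 'k) \<Rightarrow> ('a, 'b, 'k) tens \<Rightarrow> ('x, 'y, 'k) tens \<Rightarrow> 'k" where
  "emb A B X Y p q = tlift A B (dual (X \<otimes> Y)) (\<lambda>a b. tlift X Y Kvec (\<lambda>x y. p a x * q b y))"

definition embUU :: "('k::field, 'h::ab_group_add) vecsp \<Rightarrow> ('k, 'h \<Rightarrow> 'k) vecsp \<Rightarrow>
    ('h \<Rightarrow> 'k, 'h \<Rightarrow> 'k, 'k) tens \<Rightarrow> ('h, 'h, 'k) tens \<Rightarrow> 'k" where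
  "embUU H U = emb U U H H (\<lambda>f a. f a) (\<lambda>f a. f a)"

definition embVU :: "('k::field, 'h::ab_group_add) vecsp \<Rightarrow> ('k, 'h \<Rightarrow> 'k) vecsp \<Rightarrow> ('k, 'v::ab_group_add) vecsp \<Rightarrow>
    ('v, 'h \<Rightarrow> 'k, 'k) tens \<Rightarrow> ('v \<Rightarrow> 'k, 'h, 'k) tens \<Rightarrow> 'k" where
  "embVU H U V = emb V U (dual V) H (\<lambda>v e. e v) (\<lambda>f a. f a)"

definition embUV :: "('k::field, 'h::ab_group_add) vecsp \<Rightarrow> ('k, 'h \<Rightarrow> 'k) vecsp \<Rightarrow> ('k, 'v::ab_group_add) vecsp \<Rightarrow>
    ('h \<Rightarrow> 'k, 'v, 'k) tens \<Rightarrow> ('h, 'v \<Rightarrow> 'k, 'k) tens \<Rightarrow> 'k" where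
  "embUV H U V = emb U V H (dual V) (\<lambda>f a. f a) (\<lambda>v e. e v)"

definition separates_points :: "('k::field, 'h \<Rightarrow> 'k) vecsp \<Rightarrow> ('k, 'h::ab_group_add) vecsp \<Rightarrow> bool" where
  "separates_points U H \<longleftrightarrow> (\<forall>a\<in>carr H. \<forall>b\<in>carr H. a \<noteq> b \<longrightarrow> (\<exists>f\<in>carr U. f a \<noteq> f b))"

text \<open>
  For each dual braiding: the map with values in a dual space (suffix dual), the assertion that
  it is a bijection onto the embedded tensor product (suffix bij), and the map into the tensor
  product itself obtained by inverting the embedding.
\<close>

definition PsiUU_dual :: "('k::field, 'h::ab_group_add) vecsp \<Rightarrow> ('k, 'h \<Rightarrow> 'k) vecsp \<Rightarrow>
    (('h, 'h, 'k) tens \<Rightarrow> ('h, 'h, 'k) tens) \<Rightarrow>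
    ('h \<Rightarrow> 'k, 'h \<Rightarrow> 'k, 'k) tens \<Rightarrow> ('h, 'h, 'k) tens \<Rightarrow> 'k" where
  "PsiUU_dual H U \<Psi> = tlift U U (dual (H \<otimes> H))
     (\<lambda>f g. tlift H H Kvec (\<lambda>b a. dpair H H f g (\<Psi> (tens H H a b))))"

definition PsiUU_bij :: "('k::field, 'h::ab_group_add) vecsp \<Rightarrow> ('k, 'h \<Rightarrow> 'k) vecsp \<Rightarrow>
    (('h, 'h, 'k) tens \<Rightarrow> ('h, 'h, 'k) tens) \<Rightarrow> bool" where
  "PsiUU_bij H U \<Psi> \<longleftrightarrow> bij_betw (PsiUU_dual H U \<Psi>) (carr (U \<otimes> U)) (embUU H U ` carr (U \<otimes> U))"

definition PsiUU :: "('k::field, 'h::ab_group_add) vecsp \<Rightarrow> ('k, 'h \<Rightarrow> 'k) vecsp \<Rightarrow>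
    (('h, 'h, 'k) tens \<Rightarrow> ('h, 'h, 'k) tens) \<Rightarrow>
    ('h \<Rightarrow> 'k, 'h \<Rightarrow> 'k, 'k) tens \<Rightarrow> ('h \<Rightarrow> 'k, 'h \<Rightarrow> 'k, 'k) tens" where
  "PsiUU H U \<Psi> t = inv_into (carr (U \<otimes> U)) (embUU H U) (PsiUU_dual H U \<Psi> t)"

text \<open>
  Here \<open>\<Psi>\<close> maps \<open>V \<otimes> H\<close> to \<open>H \<otimes> V\<close>; it is \<open>\<Psi>\<^sub>V\<^sub>H\<close>, or the inverse of \<open>\<Psi>\<^sub>H\<^sub>V\<close> for the variant
  marked by a circle.
\<close>

definition PsiUV_dual :: "('k::field, 'h::ab_group_add) vecsp \<Rightarrow> ('k, 'h \<Rightarrow> 'k) vecsp \<Rightarrow> ('k, 'v::ab_group_add) vecsp \<Rightarrow>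
    (('v, 'h, 'k) tens \<Rightarrow> ('h, 'v, 'k) tens) \<Rightarrow>
    ('h \<Rightarrow> 'k, 'v, 'k) tens \<Rightarrow> ('v \<Rightarrow> 'k, 'h, 'k) tens \<Rightarrow> 'k" where
  "PsiUV_dual H U V \<Psi> = tlift U V (dual (dual V \<otimes> H))
     (\<lambda>f v. tlift (dual V) H Kvec (\<lambda>e a. dpair H V e f (\<Psi> (tens V H v a))))"

definition PsiUV_bij :: "('k::field, 'h::ab_group_add) vecsp \<Rightarrow> ('k, 'h \<Rightarrow> 'k) vecsp \<Rightarrow> ('k, 'v::ab_group_add) vecsp \<Rightarrow>
    (('v, 'h, 'k) tens \<Rightarrow> ('h, 'v, 'k) tens) \<Rightarrow> bool" where
  "PsiUV_bij H U V \<Psi> \<longleftrightarrow> bij_betw (PsiUV_dual H U V \<Psi>) (carr (U \<otimes> V)) (embVU H U V ` carr (V \<otimes> U))"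

definition PsiUV :: "('k::field, 'h::ab_group_add) vecsp \<Rightarrow> ('k, 'h \<Rightarrow> 'k) vecsp \<Rightarrow> ('k, 'v::ab_group_add) vecsp \<Rightarrow>
    (('v, 'h, 'k) tens \<Rightarrow> ('h, 'v, 'k) tens) \<Rightarrow>
    ('h \<Rightarrow> 'k, 'v, 'k) tens \<Rightarrow> ('v, 'h \<Rightarrow> 'k, 'k) tens" where
  "PsiUV H U V \<Psi> t = inv_into (carr (V \<otimes> U)) (embVU H U V) (PsiUV_dual H U V \<Psi> t)"

text \<open>
  Here \<open>\<Psi>\<close> maps \<open>H \<otimes> V\<close> to \<open>V \<otimes> H\<close>; it is \<open>\<Psi>\<^sub>H\<^sub>V\<close>, or the inverse of \<open>\<Psi>\<^sub>V\<^sub>H\<close> for the variant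
  marked by a circle.
\<close>

definition PsiVU_dual :: "('k::field, 'h::ab_group_add) vecsp \<Rightarrow> ('k, 'h \<Rightarrow> 'k) vecsp \<Rightarrow> ('k, 'v::ab_group_add) vecsp \<Rightarrow>
    (('h, 'v, 'k) tens \<Rightarrow> ('v, 'h, 'k) tens) \<Rightarrow>
    ('v, 'h \<Rightarrow> 'k, 'k) tens \<Rightarrow> ('h, 'v \<Rightarrow> 'k, 'k) tens \<Rightarrow> 'k" where
  "PsiVU_dual H U V \<Psi> = tlift V U (dual (H \<otimes> dual V))
     (\<lambda>v f. tlift H (dual V) Kvec (\<lambda>a e. dpair V H f e (\<Psi> (tens H V a v))))"

definition PsiVU_bij :: "('k::field, 'h::ab_group_add) vecsp \<Rightarrow> ('k, 'h \<Rightarrow> 'k) vecsp \<Rightarrow> ('k, 'v::ab_group_add) vecsp \<Rightarrow>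
    (('h, 'v, 'k) tens \<Rightarrow> ('v, 'h, 'k) tens) \<Rightarrow> bool" where
  "PsiVU_bij H U V \<Psi> \<longleftrightarrow> bij_betw (PsiVU_dual H U V \<Psi>) (carr (V \<otimes> U)) (embUV H U V ` carr (U \<otimes> V))"

definition PsiVU :: "('k::field, 'h::ab_group_add) vecsp \<Rightarrow> ('k, 'h \<Rightarrow> 'k) vecsp \<Rightarrow> ('k, 'v::ab_group_add) vecsp \<Rightarrow>
    (('h, 'v, 'k) tens \<Rightarrow> ('v, 'h, 'k) tens) \<Rightarrow>
    ('v, 'h \<Rightarrow> 'k, 'k) tens \<Rightarrow> ('h \<Rightarrow> 'k, 'v, 'k) tens" where
  "PsiVU H U V \<Psi> t = inv_into (carr (U \<otimes> V)) (embUV H U V) (PsiVU_dual H U V \<Psi> t)"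

definition inv_on :: "('k, 'a) vecsp \<Rightarrow> ('a \<Rightarrow> 'b) \<Rightarrow> 'b \<Rightarrow> 'a" where
  "inv_on X f = inv_into (carr X) f"


section \<open>Induced product and coproduct on the dual\<close>

definition conv :: "('k::field, 'h::ab_group_add) vecsp \<Rightarrow> (('h, 'h, 'k) tens \<Rightarrow> ('h, 'h, 'k) tens) \<Rightarrow>
    ('h \<Rightarrow> ('h, 'h, 'k) tens) \<Rightarrow> ('h \<Rightarrow> 'k) \<Rightarrow> ('h \<Rightarrow> 'k) \<Rightarrow> 'h \<Rightarrow> 'k" where
  "conv H \<Psi> \<Delta> f g = (\<lambda>a. if a \<in> carr H then dpair H H f g (\<Psi> (\<Delta> a)) else 0)"

definition conv_subalgebra :: "('k::field, 'h::ab_group_add) vecsp \<Rightarrow> (('h, 'h, 'k) tens \<Rightarrow> ('h, 'h, 'k) tens) \<Rightarrow>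
    ('h \<Rightarrow> ('h, 'h, 'k) tens) \<Rightarrow> ('k, 'h \<Rightarrow> 'k) vecsp \<Rightarrow> bool" where
  "conv_subalgebra H \<Psi> \<Delta> U \<longleftrightarrow> subsp U (dual H) \<and> (\<forall>f\<in>carr U. \<forall>g\<in>carr U. conv H \<Psi> \<Delta> f g \<in> carr U)"

definition conv_mult :: "('k::field, 'h::ab_group_add) vecsp \<Rightarrow> (('h, 'h, 'k) tens \<Rightarrow> ('h, 'h, 'k) tens) \<Rightarrow>
    ('h \<Rightarrow> ('h, 'h, 'k) tens) \<Rightarrow> ('k, 'h \<Rightarrow> 'k) vecsp \<Rightarrow> ('h \<Rightarrow> 'k, 'h \<Rightarrow> 'k, 'k) tens \<Rightarrow> 'h \<Rightarrow> 'k" where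
  "conv_mult H \<Psi> \<Delta> U = tlift U U U (conv H \<Psi> \<Delta>)"

text \<open>
  The coproduct of f as an element of the dual of \<open>H \<otimes> H\<close>. The double-bracket pairing of an
  element F of this dual with the tensor of a and b is the value of F at the tensor of b and a.
\<close>

definition dcop :: "('k::field, 'h::ab_group_add) vecsp \<Rightarrow> (('h, 'h, 'k) tens \<Rightarrow> ('h, 'h, 'k) tens) \<Rightarrow>
    (('h, 'h, 'k) tens \<Rightarrow> 'h) \<Rightarrow> ('h \<Rightarrow> 'k) \<Rightarrow> ('h, 'h, 'k) tens \<Rightarrow> 'k" where
  "dcop H \<Psi> m f = tlift H H Kvec (\<lambda>b a. f (m (\<Psi> (tens H H a b))))"

definition dcop_closed :: "('k::field, 'h::ab_group_add) vecsp \<Rightarrow> (('h, 'h, 'k) tens \<Rightarrow> ('h, 'h, 'k) tens) \<Rightarrow>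
    (('h, 'h, 'k) tens \<Rightarrow> 'h) \<Rightarrow> ('k, 'h \<Rightarrow> 'k) vecsp \<Rightarrow> bool" where
  "dcop_closed H \<Psi> m C \<longleftrightarrow> (\<forall>f\<in>carr C. dcop H \<Psi> m f \<in> embUU H C ` carr (C \<otimes> C))"

definition dcomult :: "('k::field, 'h::ab_group_add) vecsp \<Rightarrow> (('h, 'h, 'k) tens \<Rightarrow> ('h, 'h, 'k) tens) \<Rightarrow>
    (('h, 'h, 'k) tens \<Rightarrow> 'h) \<Rightarrow> ('k, 'h \<Rightarrow> 'k) vecsp \<Rightarrow> ('h \<Rightarrow> 'k) \<Rightarrow> ('h \<Rightarrow> 'k, 'h \<Rightarrow> 'k, 'k) tens" where
  "dcomult H \<Psi> m C f = inv_into (carr (C \<otimes> C)) (embUU H C) (dcop H \<Psi> m f)"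

definition dcounit :: "'h \<Rightarrow> ('h \<Rightarrow> 'k) \<Rightarrow> 'k" where
  "dcounit u f = f u"

definition coalgebra_in_dual :: "('k::field, 'h::ab_group_add) vecsp \<Rightarrow> (('h, 'h, 'k) tens \<Rightarrow> ('h, 'h, 'k) tens) \<Rightarrow>
    (('h, 'h, 'k) tens \<Rightarrow> 'h) \<Rightarrow> 'h \<Rightarrow> ('k, 'h \<Rightarrow> 'k) vecsp \<Rightarrow> bool" where
  "coalgebra_in_dual H \<Psi> m u C \<longleftrightarrow> subsp C (dual H) \<and> dcop_closed H \<Psi> m C \<and>
     coalgebra C (dcomult H \<Psi> m C) (dcounit u)"

text \<open>The sum of all coalgebras in the dual is again one, hence the largest.\<close>

definition Hcirc :: "('k::field, 'h::ab_group_add) vecsp \<Rightarrow> (('h, 'h, 'k) tens \<Rightarrow> ('h, 'h, 'k) tens) \<Rightarrow>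
    (('h, 'h, 'k) tens \<Rightarrow> 'h) \<Rightarrow> 'h \<Rightarrow> ('k, 'h \<Rightarrow> 'k) vecsp" where
  "Hcirc H \<Psi> m u =
     \<lparr>carr = module.span pw (\<Union>{carr C | C. coalgebra_in_dual H \<Psi> m u C}), scl = pw\<rparr>"

definition subcoalgebra_Hcirc :: "('k::field, 'h::ab_group_add) vecsp \<Rightarrow> (('h, 'h, 'k) tens \<Rightarrow> ('h, 'h, 'k) tens) \<Rightarrow>
    (('h, 'h, 'k) tens \<Rightarrow> 'h) \<Rightarrow> 'h \<Rightarrow> ('k, 'h \<Rightarrow> 'k) vecsp \<Rightarrow> bool" where
  "subcoalgebra_Hcirc H \<Psi> m u U \<longleftrightarrow> subsp U (Hcirc H \<Psi> m u) \<and> dcop_closed H \<Psi> m U"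

end

theory Submission
  imports Defs
begin

text \<open>
  Contract the dual braidings only in the factor \<open>U\<close>. The defining formula of \<open>\<Psi>\<^sub>U\<^sub>V\<close> then becomes an
  identity between vectors of \<open>V\<close>: evaluating the factor \<open>U\<close> of \<open>\<Psi>\<^sub>U\<^sub>V(f \<otimes> v)\<close> at \<open>a\<close> gives the same
  as evaluating \<open>f\<close> on the factor \<open>H\<close> of \<open>\<Psi>\<^sub>V\<^sub>H(v \<otimes> a)\<close>. This relation between a map \<open>\<psi>\<close> from
  \<open>U \<otimes> V\<close> to \<open>V \<otimes> U\<close> and a map \<open>\<Psi>\<close> from \<open>V \<otimes> H\<close> to \<open>H \<otimes> V\<close> makes sense for every pairing of
  two spaces \<open>U\<close> and \<open>H\<close>; it is called \<open>transposed\<close> below, and it determines \<open>\<psi>\<close> when \<open>H\<close>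
  separates the points of \<open>U\<close>. It has two formal properties.

  First, it is stable under squares. Moving \<open>U \<otimes> U\<close> past \<open>V\<close> in two steps is transposed to moving
  \<open>V\<close> past \<open>H \<otimes> H\<close> in two steps, for the nested (double-bracket) pairing of \<open>U \<otimes> U\<close> with
  \<open>H \<otimes> H\<close> (\<open>dual_maps_square\<close>); likewise, moving \<open>U\<close> past \<open>V \<otimes> V\<close> is transposed to moving
  \<open>V \<otimes> V\<close> past \<open>H\<close> (\<open>dual_maps_undualized_square\<close>). Second, it turns naturality squares into
  naturality squares, both for a map \<open>\<alpha>\<close> between the spaces \<open>U\<close> that is the transpose of a map
  between the spaces \<open>H\<close> (\<open>dual_maps_natural\<close>) and for a map between the spaces \<open>V\<close>
  (\<open>dual_maps_natural_undualized\<close>).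

  Apart from units and counits, every assertion about \<open>\<Psi>\<^sub>U\<^sub>V\<close> is such a naturality square. The hexagon is the one for
  \<open>\<alpha> = \<Psi>\<^sub>U\<^sub>U\<close>, the transpose of \<open>\<Psi>\<^sub>H\<^sub>H\<close>; the product of \<open>U\<close> is the transpose of \<open>\<Psi>\<^sub>H\<^sub>H \<Delta>\<close>, and its
  coproduct the transpose of \<open>m \<Psi>\<^sub>H\<^sub>H\<close>, so that (a) and (b) follow from the compatibility of \<open>\<Psi>\<^sub>V\<^sub>H\<close>
  with \<open>\<Delta>\<close> or \<open>m\<close> combined with its hexagon; (c) and (d) are naturality in \<open>V\<close>. Units and counits
  are checked directly; the point with content is that a unit of \<open>U\<close> must be the counit of \<open>H\<close>,
  because \<open>U\<close> separates the points of \<open>H\<close> (\<open>mult_compatL_dual\<close>). The braid equation of \<open>\<Psi>\<^sub>U\<^sub>U\<close> itself is the transpose of that of \<open>\<Psi>\<^sub>H\<^sub>H\<close> on threefold tensor products (\<open>hexL_transpose\<close>).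

  The other three parts are formal consequences. Conjugation with the flips turns left into right
  variants and reduces the second part to the first (\<open>mirror_braidings\<close>). The inverse of \<open>\<Psi>\<^sub>V\<^sub>H\<close>
  makes \<open>V\<close> a left \<open>H\<close>-braided space with the same compatibilities, and vice versa
  (\<open>inverse_braidings\<close>), which reduces the third part to the second and the fourth to the first.
\<close>

section \<open>Linear maps and induction over tensor products\<close>

text \<open>Tensors are functions on bilinear forms; a sum of tensors must not be unfolded into a pointwise
  sum, as additivity would no longer apply to it.\<close>

declare plus_fun_apply [simp del] zero_fun_apply [simp del]

lemma lin_carr: "lin X Y f \<Longrightarrow> x \<in> carr X \<Longrightarrow> f x \<in> carr Y"
  and lin_add: "lin X Y f \<Longrightarrow> x \<in> carr X \<Longrightarrow> y \<in> carr X \<Longrightarrow> f (x + y) = f x + f y"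
  and lin_scl: "lin X Y f \<Longrightarrow> x \<in> carr X \<Longrightarrow> f (scl X c x) = scl Y c (f x)"
  by (auto simp: lin_def)

lemma linI:
  assumes "\<And>x. x \<in> carr X \<Longrightarrow> f x \<in> carr Y"
    and "\<And>x y. x \<in> carr X \<Longrightarrow> y \<in> carr X \<Longrightarrow> f (x + y) = f x + f y"
    and "\<And>c x. x \<in> carr X \<Longrightarrow> f (scl X c x) = scl Y c (f x)"
  shows "lin X Y f"
  using assms by (auto simp: lin_def)

lemma lin_id [simp]: "lin X X id" "lin X X (\<lambda>x. x)"
  by (auto simp: lin_def)

lemma lin_comp: "lin X Y f \<Longrightarrow> lin Y Z g \<Longrightarrow> lin X Z (\<lambda>x. g (f x))"
  by (auto simp: lin_def)

lemma Kvec_simps [simp]: "carr Kvec = UNIV" "scl Kvec c x = c * x"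
  by (auto simp: Kvec_def)

lemma vs_Kvec [simp]: "vs (Kvec :: ('a::field, 'a) vecsp)"
proof -
  interpret vector_space "(*) :: 'a \<Rightarrow> 'a \<Rightarrow> 'a" by (rule vector_space_times)
  show ?thesis by (simp add: vs_def Kvec_def vector_space_times)
qed

context
  fixes X :: "('k::field, 'a::ab_group_add) vecsp"
  assumes X: "vs X"
begin

interpretation vector_space "scl X"
  using X by (simp add: vs_def)

lemma vs_carr: "0 \<in> carr X" "x \<in> carr X \<Longrightarrow> y \<in> carr X \<Longrightarrow> x + y \<in> carr X"
  "x \<in> carr X \<Longrightarrow> scl X c x \<in> carr X"
  using X by (auto simp: vs_def subspace_def)

lemma vs_scl: "scl X c (x + y) = scl X c x + scl X c y" "scl X (c + d) x = scl X c x + scl X d x"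
  "scl X c (scl X d x) = scl X (c * d) x" "scl X 1 x = x" "scl X c 0 = 0" "scl X 0 x = 0"
  by (auto simp: algebra_simps)

lemma vs_diff: "x \<in> carr X \<Longrightarrow> y \<in> carr X \<Longrightarrow> x - y \<in> carr X"
  using X by (auto simp: vs_def subspace_diff)

end

lemma lin_zero: "vs X \<Longrightarrow> vs Y \<Longrightarrow> lin X Y f \<Longrightarrow> f 0 = 0"
  using lin_scl[of X Y f 0 0] by (simp add: vs_carr vs_scl)

lemma lin_diff:
  assumes "vs X" "lin X Y f" "x \<in> carr X" "y \<in> carr X"
  shows "f (x - y) = f x - f y"
  using lin_add[OF assms(2), of "x - y" y] assms by (simp add: vs_diff)

lemma bilinI:
  assumes "\<And>x. x \<in> carr X \<Longrightarrow> lin Y Z (b x)" "\<And>y. y \<in> carr Y \<Longrightarrow> lin X Z (\<lambda>x. b x y)"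
  shows "bilin X Y Z b"
  using assms by (auto simp: bilin_def)

lemma bilinD:
  "bilin X Y Z b \<Longrightarrow> x \<in> carr X \<Longrightarrow> lin Y Z (b x)"
  "bilin X Y Z b \<Longrightarrow> y \<in> carr Y \<Longrightarrow> lin X Z (\<lambda>x. b x y)"
  by (auto simp: bilin_def)

lemma bilin_add_left: "bilin X Y Z b \<Longrightarrow> x \<in> carr X \<Longrightarrow> x' \<in> carr X \<Longrightarrow> y \<in> carr Y \<Longrightarrow> b (x + x') y = b x y + b x' y"
  and bilin_add_right: "bilin X Y Z b \<Longrightarrow> x \<in> carr X \<Longrightarrow> y \<in> carr Y \<Longrightarrow> y' \<in> carr Y \<Longrightarrow> b x (y + y') = b x y + b x y'"
  and bilin_scl_left: "bilin X Y Z b \<Longrightarrow> x \<in> carr X \<Longrightarrow> y \<in> carr Y \<Longrightarrow> b (scl X c x) y = scl Z c (b x y)"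
  and bilin_scl_right: "bilin X Y Z b \<Longrightarrow> x \<in> carr X \<Longrightarrow> y \<in> carr Y \<Longrightarrow> b x (scl Y c y) = scl Z c (b x y)"
  and bilin_carr: "bilin X Y Z b \<Longrightarrow> x \<in> carr X \<Longrightarrow> y \<in> carr Y \<Longrightarrow> b x y \<in> carr Z"
  by (auto simp: bilin_def lin_def)

declare vs_tensor [simp]

lemma scl_tensor [simp]: "scl (X \<otimes> Y) = pw"
  by (simp add: tensor_def)

lemma tens_carr [simp]: "x \<in> carr X \<Longrightarrow> y \<in> carr Y \<Longrightarrow> tens X Y x y \<in> carr (X \<otimes> Y)"
  by (auto simp: tensor_def intro!: module.span_base[OF module_pw])

lemma tensor_carr_add [simp]: "s \<in> carr (X \<otimes> Y) \<Longrightarrow> t \<in> carr (X \<otimes> Y) \<Longrightarrow> s + t \<in> carr (X \<otimes> Y)"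
  by (rule vs_carr) simp_all

lemma tensor_carr_pw [simp]: "t \<in> carr (X \<otimes> Y) \<Longrightarrow> pw c t \<in> carr (X \<otimes> Y)"
  using vs_carr(3)[of "X \<otimes> Y" t c] by simp

lemma bilin_tens [simp]: "bilin X Y (X \<otimes> Y) (tens X Y)"
  by (intro bilinI linI tens_carr)
    (simp_all add: fun_eq_iff tens_def pw_def plus_fun_apply bilin_def lin_def)

lemmas tens_add_left [simp] = bilin_add_left[OF bilin_tens]
  and tens_add_right [simp] = bilin_add_right[OF bilin_tens]
  and tens_scl_left = bilin_scl_left[OF bilin_tens, unfolded scl_tensor]
  and tens_scl_right = bilin_scl_right[OF bilin_tens, unfolded scl_tensor]

lemmas tens_pw_left [simp] = tens_scl_left[where X = "X \<otimes> Y" for X Y, unfolded scl_tensor]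
  and tens_pw_right [simp] = tens_scl_right[where Y = "X \<otimes> Y" for X Y, unfolded scl_tensor]

text \<open>Scalar multiples of elementary tensors and the tensor 0 are elementary, so that closure under
  sums is the only closure property to be checked.\<close>

lemma tensor_induct [consumes 3, case_names tens add]:
  fixes X :: "('k::field, 'a::ab_group_add) vecsp" and Y :: "('k, 'b::ab_group_add) vecsp"
  assumes "t \<in> carr (X \<otimes> Y)" "vs X" "vs Y"
    and tens: "\<And>x y. x \<in> carr X \<Longrightarrow> y \<in> carr Y \<Longrightarrow> P (tens X Y x y)"
    and add: "\<And>s t. s \<in> carr (X \<otimes> Y) \<Longrightarrow> t \<in> carr (X \<otimes> Y) \<Longrightarrow> P s \<Longrightarrow> P t \<Longrightarrow> P (s + t)"
  shows "P t"
proof -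
  interpret P: module "pw :: 'k \<Rightarrow> (('a, 'b, 'k) tens) \<Rightarrow> _" by (rule module_pw)
  define B where "B = {tens X Y x y | x y. x \<in> carr X \<and> y \<in> carr Y}"
  have carr: "carr (X \<otimes> Y) = P.span B" by (simp add: tensor_def B_def)
  have "t \<in> P.span B" using assms(1) carr by simp
  then have "t \<in> P.span B \<and> P t"
  proof (induction rule: P.span_induct_alt)
    case base
    have "tens X Y 0 0 = pw 0 (tens X Y 0 0)"
      using tens_scl_left[of 0 X 0 Y 0] assms(2,3) by (simp add: vs_carr vs_scl)
    then have "tens X Y 0 0 = 0" by (simp add: pw_def zero_fun_def)
    then show ?case using tens[of 0 0] assms(2,3) by (simp add: vs_carr P.span_zero)
  next
    case (step c x y)
    then obtain u v where x: "x = tens X Y u v" "u \<in> carr X" "v \<in> carr Y" by (auto simp: B_def)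
    then have c: "pw c x = tens X Y (scl X c u) v" "scl X c u \<in> carr X"
      using assms(2) by (auto simp: tens_scl_left vs_carr)
    then have "pw c x \<in> carr (X \<otimes> Y)" "P (pw c x)" using x tens by auto
    with step show ?case using add carr by (auto intro!: P.span_add)
  qed
  then show ?thesis by simp
qed

lemma lin_tlift: "vs Z \<Longrightarrow> bilin X Y Z b \<Longrightarrow> lin (X \<otimes> Y) Z (tlift X Y Z b)"
  by (rule tlift_props)

lemma tlift_tens: "vs Z \<Longrightarrow> bilin X Y Z b \<Longrightarrow> x \<in> carr X \<Longrightarrow> y \<in> carr Y \<Longrightarrow> tlift X Y Z b (tens X Y x y) = b x y"
  by (rule tlift_props)

lemmas tlift_carr = lin_carr[OF lin_tlift]
  and tlift_add = lin_add[OF lin_tlift]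

text \<open>Lifting two arguments of a trilinear map keeps it linear in the third one. The associators
  and the pairings of tensor products are iterated lifts of this kind.\<close>

lemma bilin_tlift:
  assumes "vs X" "vs Y" "vs W"
    and b: "\<And>z. z \<in> carr Z \<Longrightarrow> bilin X Y W (b z)"
    and z: "\<And>x y. x \<in> carr X \<Longrightarrow> y \<in> carr Y \<Longrightarrow> lin Z W (\<lambda>z. b z x y)"
    and "vs Z"
  shows "bilin (X \<otimes> Y) Z W (\<lambda>t z. tlift X Y W (b z) t)"
    and "bilin Z (X \<otimes> Y) W (\<lambda>z. tlift X Y W (b z))"
proof -
  have 1: "lin Z W (\<lambda>z. tlift X Y W (b z) t)" if "t \<in> carr (X \<otimes> Y)" for t
  proof (intro linI)
    fix z z' c assume zz: "z \<in> carr Z" 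
    then show "tlift X Y W (b z) t \<in> carr W" using assms that by (simp add: tlift_carr)
    have c: "scl Z c z \<in> carr Z" using zz assms by (simp add: vs_carr)
    show "tlift X Y W (b (scl Z c z)) t = scl W c (tlift X Y W (b z) t)"
      using that assms(1,2)
    proof (induction rule: tensor_induct)
      case (tens x y)
      then show ?case using zz c assms lin_scl[OF z[of x y]] by (simp add: tlift_tens)
    qed (use zz c assms in \<open>simp_all add: tlift_add vs_scl\<close>)
    assume z': "z' \<in> carr Z"
    then have c: "z + z' \<in> carr Z" using zz assms by (simp add: vs_carr)
    show "tlift X Y W (b (z + z')) t = tlift X Y W (b z) t + tlift X Y W (b z') t"
      using that assms(1,2)
    proof (induction rule: tensor_induct)
      case (tens x y)
      then show ?case using zz z' c assms lin_add[OF z[of x y]] by (simp add: tlift_tens)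
    qed (use zz z' c assms in \<open>simp_all add: tlift_add algebra_simps\<close>)
  qed
  show "bilin (X \<otimes> Y) Z W (\<lambda>t z. tlift X Y W (b z) t)"
    "bilin Z (X \<otimes> Y) W (\<lambda>z. tlift X Y W (b z))"
    by (rule bilinI; use 1 assms in \<open>simp add: lin_tlift\<close>)+
qed

lemma bilin_comp:
  assumes "bilin X' Y' Z b" "lin X X' f" "lin Y Y' g"
  shows "bilin X Y Z (\<lambda>x y. b (f x) (g y))"
  using assms by (auto simp: bilin_def lin_def)

lemma bilin_post: "bilin X Y Z b \<Longrightarrow> lin Z Z' f \<Longrightarrow> bilin X Y Z' (\<lambda>x y. f (b x y))"
  by (auto simp: bilin_def lin_def)

lemma lin_tmap [simp]:
  assumes "lin X X' f" "lin Y Y' g"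
  shows "lin (X \<otimes> Y) (X' \<otimes> Y') (tmap X Y X' Y' f g)"
  unfolding tmap_def by (intro lin_tlift bilin_comp[OF bilin_tens assms]) simp

lemma tmap_tens [simp]:
  assumes "lin X X' f" "lin Y Y' g" "x \<in> carr X" "y \<in> carr Y"
  shows "tmap X Y X' Y' f g (tens X Y x y) = tens X' Y' (f x) (g y)"
  unfolding tmap_def using assms by (subst tlift_tens) (auto intro!: bilin_comp[OF bilin_tens])

lemmas tmap_carr [simp] = lin_carr[OF lin_tmap] and tmap_add [simp] = lin_add[OF lin_tmap]
  and tmap_scl [simp] = lin_scl[OF lin_tmap, unfolded scl_tensor]

lemma tmap_tmap:
  assumes "vs X" "vs Y" "t \<in> carr (X \<otimes> Y)" "lin X X' f" "lin Y Y' g" "lin X' X'' f'" "lin Y' Y'' g'"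
  shows "tmap X' Y' X'' Y'' f' g' (tmap X Y X' Y' f g t) = tmap X Y X'' Y'' (\<lambda>x. f' (f x)) (\<lambda>y. g' (g y)) t"
proof -
  note [simp] = lin_comp[OF assms(4,6)] lin_comp[OF assms(5,7)] lin_carr[OF assms(4)] lin_carr[OF assms(5)]
  show ?thesis using assms(3,1,2)
    by (induction rule: tensor_induct) (use assms in simp_all)
qed

lemma tmap_ident:
  assumes "vs X" "vs Y" "t \<in> carr (X \<otimes> Y)" "\<And>x. x \<in> carr X \<Longrightarrow> f x = x" "\<And>y. y \<in> carr Y \<Longrightarrow> g y = y"
  shows "tmap X Y X Y f g t = t"
proof -
  have [simp]: "lin X X f" "lin Y Y g" using assms by (auto intro!: linI simp: vs_carr)
  show ?thesis using assms(3,1,2)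
    by (induction rule: tensor_induct) (use assms in simp_all)
qed

lemma tensor3_induct [consumes 4, case_names tens add]:
  assumes "t \<in> carr (X \<otimes> (Y \<otimes> Z))" and vs: "vs X" "vs Y" "vs Z"
    and tens: "\<And>x y z. x \<in> carr X \<Longrightarrow> y \<in> carr Y \<Longrightarrow> z \<in> carr Z \<Longrightarrow> P (tens X (Y \<otimes> Z) x (tens Y Z y z))"
    and add: "\<And>s t. s \<in> carr (X \<otimes> (Y \<otimes> Z)) \<Longrightarrow> t \<in> carr (X \<otimes> (Y \<otimes> Z)) \<Longrightarrow> P s \<Longrightarrow> P t \<Longrightarrow> P (s + t)"
  shows "P t"
  using assms(1) vs(1) vs_tensor[of Y Z]
proof (induction rule: tensor_induct)
  case (tens x t)
  show ?case using tens(2) vs(2,3)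
    by (induction rule: tensor_induct) (use tens(1) assms(5,6) in simp_all)
qed (rule add)

lemma tensor3_inductL [consumes 4, case_names tens add]:
  assumes "t \<in> carr ((X \<otimes> Y) \<otimes> Z)" and vs: "vs X" "vs Y" "vs Z"
    and tens: "\<And>x y z. x \<in> carr X \<Longrightarrow> y \<in> carr Y \<Longrightarrow> z \<in> carr Z \<Longrightarrow> P (tens (X \<otimes> Y) Z (tens X Y x y) z)"
    and add: "\<And>s t. s \<in> carr ((X \<otimes> Y) \<otimes> Z) \<Longrightarrow> t \<in> carr ((X \<otimes> Y) \<otimes> Z) \<Longrightarrow> P s \<Longrightarrow> P t \<Longrightarrow> P (s + t)"
  shows "P t"
  using assms(1) vs_tensor[of X Y] vs(3)
proof (induction rule: tensor_induct)
  case (tens t z)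
  show ?case using tens(1) vs(1,2)
    by (induction rule: tensor_induct) (use tens(2) assms(5,6) in simp_all)
qed (rule add)

context
  fixes X :: "('k::field, 'a::ab_group_add) vecsp" and Y :: "('k, 'b::ab_group_add) vecsp"
    and Z :: "('k, 'c::ab_group_add) vecsp"
  assumes vs [simp]: "vs X" "vs Y" "vs Z"
begin

lemma bilin_assocR:
  "z \<in> carr Z \<Longrightarrow> bilin X Y (X \<otimes> (Y \<otimes> Z)) (\<lambda>x y. tens X (Y \<otimes> Z) x (tens Y Z y z))"
  "bilin (X \<otimes> Y) Z (X \<otimes> (Y \<otimes> Z))
     (\<lambda>t z. tlift X Y (X \<otimes> (Y \<otimes> Z)) (\<lambda>x y. tens X (Y \<otimes> Z) x (tens Y Z y z)) t)"
proof -
  show 1: "bilin X Y (X \<otimes> (Y \<otimes> Z)) (\<lambda>x y. tens X (Y \<otimes> Z) x (tens Y Z y z))"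
    if "z \<in> carr Z" for z
    using that by (intro bilinI linI) (simp_all add: tens_scl_left tens_scl_right vs_carr)
  show "bilin (X \<otimes> Y) Z (X \<otimes> (Y \<otimes> Z))
     (\<lambda>t z. tlift X Y (X \<otimes> (Y \<otimes> Z)) (\<lambda>x y. tens X (Y \<otimes> Z) x (tens Y Z y z)) t)"
    by (intro bilin_tlift linI 1)
      (simp_all add: tens_scl_left tens_scl_right vs_carr)
qed

lemma lin_assocR [simp]: "lin ((X \<otimes> Y) \<otimes> Z) (X \<otimes> (Y \<otimes> Z)) (assocR X Y Z)"
  unfolding assocR_def by (intro lin_tlift bilin_assocR) simp

lemma assocR_tens [simp]:
  "x \<in> carr X \<Longrightarrow> y \<in> carr Y \<Longrightarrow> z \<in> carr Z \<Longrightarrow>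
   assocR X Y Z (tens (X \<otimes> Y) Z (tens X Y x y) z) = tens X (Y \<otimes> Z) x (tens Y Z y z)"
  unfolding assocR_def by (simp add: tlift_tens bilin_assocR)

lemma bilin_assocL:
  "x \<in> carr X \<Longrightarrow> bilin Y Z ((X \<otimes> Y) \<otimes> Z) (\<lambda>y z. tens (X \<otimes> Y) Z (tens X Y x y) z)"
  "bilin X (Y \<otimes> Z) ((X \<otimes> Y) \<otimes> Z)
     (\<lambda>x. tlift Y Z ((X \<otimes> Y) \<otimes> Z) (\<lambda>y z. tens (X \<otimes> Y) Z (tens X Y x y) z))"
proof -
  show 1: "bilin Y Z ((X \<otimes> Y) \<otimes> Z) (\<lambda>y z. tens (X \<otimes> Y) Z (tens X Y x y) z)"
    if "x \<in> carr X" for x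
    using that by (intro bilinI linI) (simp_all add: tens_scl_left tens_scl_right vs_carr)
  show "bilin X (Y \<otimes> Z) ((X \<otimes> Y) \<otimes> Z)
     (\<lambda>x. tlift Y Z ((X \<otimes> Y) \<otimes> Z) (\<lambda>y z. tens (X \<otimes> Y) Z (tens X Y x y) z))"
    by (intro bilin_tlift linI 1)
      (simp_all add: tens_scl_left tens_scl_right vs_carr)
qed

lemma lin_assocL [simp]: "lin (X \<otimes> (Y \<otimes> Z)) ((X \<otimes> Y) \<otimes> Z) (assocL X Y Z)"
  unfolding assocL_def by (intro lin_tlift bilin_assocL) simp

lemma assocL_tens [simp]:
  "x \<in> carr X \<Longrightarrow> y \<in> carr Y \<Longrightarrow> z \<in> carr Z \<Longrightarrow>
   assocL X Y Z (tens X (Y \<otimes> Z) x (tens Y Z y z)) = tens (X \<otimes> Y) Z (tens X Y x y) z"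
  unfolding assocL_def by (simp add: tlift_tens bilin_assocL)

lemmas assocR_carr [simp] = lin_carr[OF lin_assocR] and assocR_add [simp] = lin_add[OF lin_assocR]
lemmas assocL_carr [simp] = lin_carr[OF lin_assocL] and assocL_add [simp] = lin_add[OF lin_assocL]

lemma assocR_assocL [simp]:
  assumes "t \<in> carr (X \<otimes> (Y \<otimes> Z))"
  shows "assocR X Y Z (assocL X Y Z t) = t"
  using assms vs by (induction rule: tensor3_induct) simp_all

lemma assocL_assocR [simp]:
  assumes "t \<in> carr ((X \<otimes> Y) \<otimes> Z)"
  shows "assocL X Y Z (assocR X Y Z t) = t"
  using assms vs by (induction rule: tensor3_inductL) simp_all

end

section \<open>Contractions and the flip\<close>

text \<open>Applying a functional to one factor of a tensor product. The defining formulas are those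
  of the counit axioms and of the compatibility with a counit.\<close>

definition cL :: "('k::field, 'a::ab_group_add) vecsp \<Rightarrow> ('k, 'b::ab_group_add) vecsp \<Rightarrow>
    ('a \<Rightarrow> 'k) \<Rightarrow> ('a, 'b, 'k) tens \<Rightarrow> 'b" where
  "cL X Y \<phi> = tlift X Y Y (\<lambda>x y. scl Y (\<phi> x) y)"

definition cR :: "('k::field, 'a::ab_group_add) vecsp \<Rightarrow> ('k, 'b::ab_group_add) vecsp \<Rightarrow>
    ('b \<Rightarrow> 'k) \<Rightarrow> ('a, 'b, 'k) tens \<Rightarrow> 'a" where
  "cR X Y \<phi> = tlift X Y X (\<lambda>x y. scl X (\<phi> y) x)"

definition flip :: "('k::field, 'a::ab_group_add) vecsp \<Rightarrow> ('k, 'b::ab_group_add) vecsp \<Rightarrow>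
    ('a, 'b, 'k) tens \<Rightarrow> ('b, 'a, 'k) tens" where
  "flip X Y = tlift X Y (Y \<otimes> X) (\<lambda>x y. tens Y X y x)"

lemma bilin_flip: "bilin X Y (Y \<otimes> X) (\<lambda>x y. tens Y X y x)"
  using bilin_tens[of Y X] by (simp add: bilin_def)

lemma lin_flip [simp]: "lin (X \<otimes> Y) (Y \<otimes> X) (flip X Y)"
  unfolding flip_def by (intro lin_tlift bilin_flip) simp

lemma flip_tens [simp]:
  "x \<in> carr X \<Longrightarrow> y \<in> carr Y \<Longrightarrow> flip X Y (tens X Y x y) = tens Y X y x"
  unfolding flip_def by (simp add: tlift_tens bilin_flip)

lemmas flip_carr [simp] = lin_carr[OF lin_flip] and flip_add [simp] = lin_add[OF lin_flip]

lemma flip_flip [simp]: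
  assumes "vs X" "vs Y" "t \<in> carr (X \<otimes> Y)"
  shows "flip Y X (flip X Y t) = t"
  using assms(3,1,2) by (induction rule: tensor_induct) simp_all

context
  fixes X :: "('k::field, 'a::ab_group_add) vecsp" and Y :: "('k, 'b::ab_group_add) vecsp"
  assumes vs [simp]: "vs X" "vs Y"
begin

lemma lin_cL [simp]: "lin X Kvec \<phi> \<Longrightarrow> lin (X \<otimes> Y) Y (cL X Y \<phi>)"
  and cL_tens [simp]: "lin X Kvec \<phi> \<Longrightarrow> x \<in> carr X \<Longrightarrow> y \<in> carr Y \<Longrightarrow> cL X Y \<phi> (tens X Y x y) = scl Y (\<phi> x) y"
proof -
  assume "lin X Kvec \<phi>"
  then have b: "bilin X Y Y (\<lambda>x y. scl Y (\<phi> x) y)"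
    by (auto intro!: bilinI linI simp: vs_carr vs_scl lin_add lin_scl mult.commute)
  show "lin (X \<otimes> Y) Y (cL X Y \<phi>)"
    unfolding cL_def by (rule lin_tlift[OF _ b]) simp
  show "x \<in> carr X \<Longrightarrow> y \<in> carr Y \<Longrightarrow> cL X Y \<phi> (tens X Y x y) = scl Y (\<phi> x) y"
    unfolding cL_def by (simp add: tlift_tens[OF _ b])
qed

lemma lin_cR [simp]: "lin Y Kvec \<phi> \<Longrightarrow> lin (X \<otimes> Y) X (cR X Y \<phi>)"
  and cR_tens [simp]: "lin Y Kvec \<phi> \<Longrightarrow> x \<in> carr X \<Longrightarrow> y \<in> carr Y \<Longrightarrow> cR X Y \<phi> (tens X Y x y) = scl X (\<phi> y) x"
proof -
  assume "lin Y Kvec \<phi>"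
  then have b: "bilin X Y X (\<lambda>x y. scl X (\<phi> y) x)"
    by (auto intro!: bilinI linI simp: vs_carr vs_scl lin_add lin_scl mult.commute)
  show "lin (X \<otimes> Y) X (cR X Y \<phi>)"
    unfolding cR_def by (rule lin_tlift[OF _ b]) simp
  show "x \<in> carr X \<Longrightarrow> y \<in> carr Y \<Longrightarrow> cR X Y \<phi> (tens X Y x y) = scl X (\<phi> y) x"
    unfolding cR_def by (simp add: tlift_tens[OF _ b])
qed

lemmas cL_carr [simp] = lin_carr[OF lin_cL] and cL_add [simp] = lin_add[OF lin_cL]
  and cL_scl [simp] = lin_scl[OF lin_cL, unfolded scl_tensor]
lemmas cR_carr [simp] = lin_carr[OF lin_cR] and cR_add [simp] = lin_add[OF lin_cR]
  and cR_scl [simp] = lin_scl[OF lin_cR, unfolded scl_tensor]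

end

lemma cR_flip:
  assumes "vs X" "vs Y" "lin X Kvec \<phi>" "t \<in> carr (X \<otimes> Y)"
  shows "cR Y X \<phi> (flip X Y t) = cL X Y \<phi> t"
  using assms(4,1,2) by (induction rule: tensor_induct) (use assms in simp_all)

lemma cL_flip: "vs X \<Longrightarrow> vs Y \<Longrightarrow> lin Y Kvec \<phi> \<Longrightarrow> t \<in> carr (X \<otimes> Y) \<Longrightarrow> cL Y X \<phi> (flip X Y t) = cR X Y \<phi> t"
  using cR_flip[of Y X \<phi> "flip X Y t"] by simp

lemma cL_tmap:
  assumes "vs X" "vs Y" "vs X'" "vs Y'" "lin X X' f" "lin Y Y' g" "lin X' Kvec \<phi>" "t \<in> carr (X \<otimes> Y)"
  shows "cL X' Y' \<phi> (tmap X Y X' Y' f g t) = g (cL X Y (\<lambda>x. \<phi> (f x)) t)"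
proof -
  note [simp] = lin_comp[OF assms(5,7)] lin_carr[OF assms(5)] lin_carr[OF assms(6)] lin_scl[OF assms(6)]
  show ?thesis using assms(8,1,2)
    by (induction rule: tensor_induct) (use assms in \<open>simp_all add: lin_add[OF assms(6)]\<close>)
qed

lemma cR_tmap:
  assumes "vs X" "vs Y" "vs X'" "vs Y'" "lin X X' f" "lin Y Y' g" "lin Y' Kvec \<phi>" "t \<in> carr (X \<otimes> Y)"
  shows "cR X' Y' \<phi> (tmap X Y X' Y' f g t) = f (cR X Y (\<lambda>x. \<phi> (g x)) t)"
proof -
  note [simp] = lin_comp[OF assms(6,7)] lin_carr[OF assms(5)] lin_carr[OF assms(6)] lin_scl[OF assms(5)]
  show ?thesis using assms(8,1,2)
    by (induction rule: tensor_induct) (use assms in \<open>simp_all add: lin_add[OF assms(5)]\<close>)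
qed

lemma cL_cong:
  assumes "\<And>x. x \<in> carr X \<Longrightarrow> \<phi> x = \<phi>' x" "vs X" "vs Y" "lin X Kvec \<phi>" "t \<in> carr (X \<otimes> Y)"
  shows "cL X Y \<phi> t = cL X Y \<phi>' t"
proof -
  have "lin X Kvec \<phi>'" using assms by (auto simp: lin_def vs_carr)
  note [simp] = this
  show ?thesis using assms(5,2,3)
    by (induction rule: tensor_induct) (use assms in simp_all)
qed

lemma cR_cong:
  assumes "\<And>y. y \<in> carr Y \<Longrightarrow> \<phi> y = \<phi>' y" "vs X" "vs Y" "lin Y Kvec \<phi>" "t \<in> carr (X \<otimes> Y)"
  shows "cR X Y \<phi> t = cR X Y \<phi>' t"
proof -
  have "lin Y Kvec \<phi>'" using assms by (auto simp: lin_def vs_carr)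
  note [simp] = this
  show ?thesis using assms(5,2,3)
    by (induction rule: tensor_induct) (use assms in simp_all)
qed

lemma contractions_commute:
  assumes "vs X" "vs Y" "lin X Kvec \<phi>" "lin Y Kvec \<psi>" "t \<in> carr (X \<otimes> Y)"
  shows "\<psi> (cL X Y \<phi> t) = \<phi> (cR X Y \<psi> t)"
  using assms(5,1,2)
proof (induction rule: tensor_induct)
  case (add s t)
  then show ?case
    using assms by (simp add: lin_add[OF assms(3)] lin_add[OF assms(4)])
qed (use assms in \<open>simp add: lin_scl[OF assms(3)] lin_scl[OF assms(4)] mult.commute\<close>)

text \<open>Expand the left factor in a basis: \<open>t\<close> is the sum of the tensors of \<open>b\<close> and
  \<open>cL X Y (b\<^sup>*) t\<close> over the basis vectors \<open>b\<close>, with \<open>b\<^sup>*\<close> the coordinate functionals. As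
  contractions of different factors commute, the separating functionals annihilate all these
  right factors.\<close>

lemma tensor_zeroI:
  fixes X :: "('k::field, 'a::ab_group_add) vecsp" and Y :: "('k, 'b::ab_group_add) vecsp"
  assumes X [simp]: "vs X" and Y [simp]: "vs Y"
    and lin [simp]: "\<And>h. h \<in> A \<Longrightarrow> lin Y Kvec (\<phi> h)"
    and sep: "\<And>y. y \<in> carr Y \<Longrightarrow> (\<And>h. h \<in> A \<Longrightarrow> \<phi> h y = 0) \<Longrightarrow> y = 0"
    and t: "t \<in> carr (X \<otimes> Y)" and zero: "\<And>h. h \<in> A \<Longrightarrow> cR X Y (\<phi> h) t = 0"
  shows "t = 0"
proof -
  interpret X: vector_space "scl X" using X by (simp add: vs_def)
  have sub: "X.subspace (carr X)" using X by (simp add: vs_def)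
  obtain B where B: "B \<subseteq> carr X" "X.independent B" "carr X \<subseteq> X.span B"
    by (rule X.basis_exists[of "carr X"]) (use that in simp)
  \<comment> \<open>the coordinate functionals\<close>
  define c where "c b x = X.representation B x b" for b x
  have c [simp]: "lin X Kvec (c b)" for b
  proof -
    have B': "x \<in> X.span B" if "x \<in> carr X" for x using that B by blast
    show ?thesis
      by (rule linI) (simp_all add: c_def X.representation_add[OF B(2) B' B'] X.representation_scale[OF B(2) B'])
  qed
  \<comment> \<open>The expansion is claimed for all large finite sets of basis vectors, so that a common one
    serves both summands in the inductive step.\<close>
  have "\<exists>S. finite S \<and> S \<subseteq> B \<and> (\<forall>S'. finite S' \<and> S \<subseteq> S' \<and> S' \<subseteq> B \<longrightarrow> t = (\<Sum>b\<in>S'. tens X Y b (cL X Y (c b) t)))"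
    using t X Y
  proof (induction rule: tensor_induct)
    case (tens x y)
    define S where "S = {b. c b x \<noteq> 0}"
    have S: "finite S" "S \<subseteq> B"
      using X.finite_representation[of B x] X.representation_ne_zero[of B x] by (auto simp: S_def c_def)
    moreover have "tens X Y x y = (\<Sum>b\<in>S'. tens X Y b (cL X Y (c b) (tens X Y x y)))"
      if S': "finite S'" "S \<subseteq> S'" "S' \<subseteq> B" for S'
    proof -
      have *: "tens X Y (\<Sum>b\<in>S''. scl X (c b x) b) y = (\<Sum>b\<in>S''. tens X Y b (scl Y (c b x) y))
          \<and> (\<Sum>b\<in>S''. scl X (c b x) b) \<in> carr X" if "S'' \<subseteq> B" "finite S''" for S''
        using that(2,1)
      proof (induction S'' rule: finite_induct)
        case empty
        have "lin X (X \<otimes> Y) (\<lambda>x. tens X Y x y)" using tens bilinD(2)[OF bilin_tens] by blast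
        from lin_zero[OF _ _ this] show ?case by (simp add: vs_carr)
      next
        case (insert b F)
        moreover have "b \<in> carr X" using insert B by auto
        ultimately show ?case using tens by (simp add: vs_carr tens_scl_left tens_scl_right)
      qed
      have "(\<Sum>b\<in>S'. scl X (c b x) b) = (\<Sum>b\<in>S. scl X (c b x) b)"
        using S' by (intro sum.mono_neutral_right) (auto simp: S_def)
      also have "\<dots> = x"
        using X.sum_nonzero_representation_eq[OF B(2), of x] tens(1) B(3) by (auto simp: S_def c_def)
      finally have "tens X Y x y = (\<Sum>b\<in>S'. tens X Y b (scl Y (c b x) y))"
        using *[OF S'(3,1)] by simp
      also have "\<dots> = (\<Sum>b\<in>S'. tens X Y b (cL X Y (c b) (tens X Y x y)))"
        using tens S' B(1) by (intro sum.cong) auto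
      finally show ?thesis .
    qed
    ultimately show ?case by blast
  next
    case (add s t)
    obtain S where
      S: "finite S" "S \<subseteq> B" "\<And>S'. finite S' \<Longrightarrow> S \<subseteq> S' \<Longrightarrow> S' \<subseteq> B \<Longrightarrow> s = (\<Sum>b\<in>S'. tens X Y b (cL X Y (c b) s))"
      using add.IH(1) by (elim exE conjE) blast
    obtain T where
      T: "finite T" "T \<subseteq> B" "\<And>S'. finite S' \<Longrightarrow> T \<subseteq> S' \<Longrightarrow> S' \<subseteq> B \<Longrightarrow> t = (\<Sum>b\<in>S'. tens X Y b (cL X Y (c b) t))"
      using add.IH(2) by (elim exE conjE) blast
    have "s + t = (\<Sum>b\<in>S'. tens X Y b (cL X Y (c b) (s + t)))" if S': "finite S'" "S \<union> T \<subseteq> S'" "S' \<subseteq> B" for S'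
    proof -
      have "s + t = (\<Sum>b\<in>S'. tens X Y b (cL X Y (c b) s)) + (\<Sum>b\<in>S'. tens X Y b (cL X Y (c b) t))"
        by (rule arg_cong2[where f = "(+)"]; rule S(3) T(3)) (use S' in auto)
      also have "\<dots> = (\<Sum>b\<in>S'. tens X Y b (cL X Y (c b) (s + t)))"
        unfolding sum.distrib[symmetric] using S' B(1) add.hyps by (intro sum.cong) auto
      finally show ?thesis .
    qed
    then show ?case using S(1,2) T(1,2) by (intro exI[of _ "S \<union> T"]) auto
  qed
  then obtain S where S: "S \<subseteq> B" "t = (\<Sum>b\<in>S. tens X Y b (cL X Y (c b) t))" by blast
  have "cL X Y (c b) t = 0" for b
  proof (rule sep)
    show "\<phi> h (cL X Y (c b) t) = 0" if "h \<in> A" for h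
      using contractions_commute[OF X Y c lin[OF that] t] zero[OF that] lin_zero[OF X vs_Kvec c] by simp
  qed (use t in simp)
  moreover have "tens X Y b 0 = 0" if "b \<in> carr X" for b
    using lin_zero[OF Y _ bilinD(1)[OF bilin_tens that]] by simp
  ultimately have "(\<Sum>b\<in>S. tens X Y b (cL X Y (c b) t)) = 0"
    using S(1) B(1) by (intro sum.neutral) auto
  with S(2) show ?thesis by (rule trans)
qed

lemma tensor_eqI:
  assumes "vs X" "vs Y" "\<And>h. h \<in> A \<Longrightarrow> lin Y Kvec (\<phi> h)"
    and sep: "\<And>y. y \<in> carr Y \<Longrightarrow> (\<And>h. h \<in> A \<Longrightarrow> \<phi> h y = 0) \<Longrightarrow> y = 0"
    and "s \<in> carr (X \<otimes> Y)" "t \<in> carr (X \<otimes> Y)" "\<And>h. h \<in> A \<Longrightarrow> cR X Y (\<phi> h) s = cR X Y (\<phi> h) t"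
  shows "s = t"
proof -
  have "s - t = 0"
    using assms by (intro tensor_zeroI[where A=A and \<phi>=\<phi> and X=X and Y=Y])
      (auto simp: vs_diff lin_diff[OF vs_tensor lin_cR])
  then show ?thesis by simp
qed

section \<open>Braiding past a tensor square\<close>

context
  fixes X :: "('k::field, 'a::ab_group_add) vecsp" and Y :: "('k, 'b::ab_group_add) vecsp"
    and Z :: "('k, 'c::ab_group_add) vecsp" and \<Psi>
  assumes vs [simp]: "vs X" "vs Y" "vs Z" and \<Psi> [simp]: "lin (X \<otimes> Y) (Y \<otimes> X) \<Psi>"
begin

lemma lin_fstT [simp]: "lin (X \<otimes> (Y \<otimes> Z)) (Y \<otimes> (X \<otimes> Z)) (fstT X Y Z \<Psi>)"
proof -
  have "lin (X \<otimes> (Y \<otimes> Z)) (Y \<otimes> (X \<otimes> Z))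
      (\<lambda>t. assocR Y X Z (tmap (X \<otimes> Y) Z (Y \<otimes> X) Z \<Psi> id (assocL X Y Z t)))"
    by (rule lin_comp[OF lin_comp[OF lin_assocL lin_tmap] lin_assocR]) simp_all
  then show ?thesis unfolding fstT_def[abs_def] .
qed

lemma fstT_tens [simp]:
  "x \<in> carr X \<Longrightarrow> y \<in> carr Y \<Longrightarrow> z \<in> carr Z \<Longrightarrow>
   fstT X Y Z \<Psi> (tens X (Y \<otimes> Z) x (tens Y Z y z)) = assocR Y X Z (tens (Y \<otimes> X) Z (\<Psi> (tens X Y x y)) z)"
  by (simp add: fstT_def)

lemma lin_sndT [simp]: "lin (Z \<otimes> (X \<otimes> Y)) (Z \<otimes> (Y \<otimes> X)) (sndT Z X Y \<Psi>)"
  unfolding sndT_def[abs_def] by simp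

lemma sndT_tens [simp]:
  "t \<in> carr (X \<otimes> Y) \<Longrightarrow> z \<in> carr Z \<Longrightarrow>
   sndT Z X Y \<Psi> (tens Z (X \<otimes> Y) z t) = tens Z (Y \<otimes> X) z (\<Psi> t)"
  by (simp add: sndT_def)

lemmas fstT_carr [simp] = lin_carr[OF lin_fstT] and fstT_add [simp] = lin_add[OF lin_fstT]
lemmas sndT_carr [simp] = lin_carr[OF lin_sndT] and sndT_add [simp] = lin_add[OF lin_sndT]

end

text \<open>Moving \<open>W\<close> past \<open>V \<otimes> V\<close>, and \<open>V\<close> past \<open>W \<otimes> W\<close>. With the square as one bracketed factor,
  the hexagons and the compatibilities with products and coproducts all become naturality
  squares, for a map into or out of the tensor square.\<close>

definition extL :: "('k::field, 'v::ab_group_add) vecsp \<Rightarrow> ('k, 'w::ab_group_add) vecsp \<Rightarrow>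
    (('v, 'w, 'k) tens \<Rightarrow> ('w, 'v, 'k) tens) \<Rightarrow>
    (('v, 'v, 'k) tens, 'w, 'k) tens \<Rightarrow> ('w, ('v, 'v, 'k) tens, 'k) tens" where
  "extL V W \<Psi> t = fstT V W V \<Psi> (sndT V V W \<Psi> (assocR V V W t))"

definition extR :: "('k::field, 'v::ab_group_add) vecsp \<Rightarrow> ('k, 'w::ab_group_add) vecsp \<Rightarrow>
    (('v, 'w, 'k) tens \<Rightarrow> ('w, 'v, 'k) tens) \<Rightarrow>
    ('v, ('w, 'w, 'k) tens, 'k) tens \<Rightarrow> (('w, 'w, 'k) tens, 'v, 'k) tens" where
  "extR V W \<Psi> t = assocL W W V (sndT W V W \<Psi> (fstT V W W \<Psi> t))"

definition hexL :: "('k::field, 'v::ab_group_add) vecsp \<Rightarrow> (('v, 'v, 'k) tens \<Rightarrow> ('v, 'v, 'k) tens) \<Rightarrow>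
    ('k, 'w::ab_group_add) vecsp \<Rightarrow> (('v, 'w, 'k) tens \<Rightarrow> ('w, 'v, 'k) tens) \<Rightarrow> bool" where
  "hexL V B W \<Psi> \<longleftrightarrow> (\<forall>t\<in>carr ((V \<otimes> V) \<otimes> W).
     extL V W \<Psi> (tmap (V \<otimes> V) W (V \<otimes> V) W B id t) = tmap W (V \<otimes> V) W (V \<otimes> V) id B (extL V W \<Psi> t))"

definition hexR :: "('k::field, 'w::ab_group_add) vecsp \<Rightarrow> (('w, 'w, 'k) tens \<Rightarrow> ('w, 'w, 'k) tens) \<Rightarrow>
    ('k, 'v::ab_group_add) vecsp \<Rightarrow> (('v, 'w, 'k) tens \<Rightarrow> ('w, 'v, 'k) tens) \<Rightarrow> bool" where
  "hexR W B V \<Psi> \<longleftrightarrow> (\<forall>t\<in>carr (V \<otimes> (W \<otimes> W)).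
     extR V W \<Psi> (tmap V (W \<otimes> W) V (W \<otimes> W) id B t) = tmap (W \<otimes> W) V (W \<otimes> W) V B id (extR V W \<Psi> t))"

context
  fixes V :: "('k::field, 'v::ab_group_add) vecsp" and W :: "('k, 'w::ab_group_add) vecsp" and \<Psi>
  assumes vs [simp]: "vs V" "vs W" and \<Psi> [simp]: "lin (V \<otimes> W) (W \<otimes> V) \<Psi>"
begin

lemma lin_extL [simp]: "lin ((V \<otimes> V) \<otimes> W) (W \<otimes> (V \<otimes> V)) (extL V W \<Psi>)"
  unfolding extL_def[abs_def]
  by (rule lin_comp[OF lin_comp[OF lin_assocR lin_sndT] lin_fstT]) simp_all

lemma lin_extR [simp]: "lin (V \<otimes> (W \<otimes> W)) ((W \<otimes> W) \<otimes> V) (extR V W \<Psi>)"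
  unfolding extR_def[abs_def]
  by (rule lin_comp[OF lin_comp[OF lin_fstT lin_sndT] lin_assocL]) simp_all

private lemmas \<Psi>_carr = lin_carr[OF \<Psi>]
lemmas extL_carr [simp] = lin_carr[OF lin_extL] and extL_add [simp] = lin_add[OF lin_extL]
lemmas extR_carr [simp] = lin_carr[OF lin_extR] and extR_add [simp] = lin_add[OF lin_extR]

lemma extL_tens:
  "x \<in> carr V \<Longrightarrow> y \<in> carr V \<Longrightarrow> w \<in> carr W \<Longrightarrow>
   extL V W \<Psi> (tens (V \<otimes> V) W (tens V V x y) w) = fstT V W V \<Psi> (tens V (W \<otimes> V) x (\<Psi> (tens V W y w)))"
  by (simp add: extL_def)

lemma extR_tens:
  "v \<in> carr V \<Longrightarrow> x \<in> carr W \<Longrightarrow> y \<in> carr W \<Longrightarrow>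
   extR V W \<Psi> (tens V (W \<otimes> W) v (tens W W x y)) =
   assocL W W V (sndT W V W \<Psi> (assocR W V W (tens (W \<otimes> V) W (\<Psi> (tens V W v x)) y)))"
  by (simp add: extR_def)

lemma all_assocL:
  assumes "vs X" "vs Y" "vs Z"
  shows "(\<forall>t\<in>carr (X \<otimes> (Y \<otimes> Z)). P (assocL X Y Z t)) \<longleftrightarrow> (\<forall>t\<in>carr ((X \<otimes> Y) \<otimes> Z). P t)"
  by (metis assms assocL_assocR assocL_carr assocR_carr)

lemma left_hexagon_iff:
  assumes [simp]: "lin (V \<otimes> V) (V \<otimes> V) B"
  shows "(\<forall>t\<in>carr (V \<otimes> V \<otimes> W).
        fstT V W V \<Psi> (sndT V V W \<Psi> (fstT V V W B t)) =
        sndT W V V B (fstT V W V \<Psi> (sndT V V W \<Psi> t))) \<longleftrightarrow> hexL V B W \<Psi>"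
  unfolding hexL_def
  by (subst all_assocL[OF vs(1,1,2), symmetric]) (simp add: extL_def sndT_def fstT_def[of V V W B])

lemma right_hexagon_iff:
  assumes [simp]: "lin (W \<otimes> W) (W \<otimes> W) B"
  shows "(\<forall>t\<in>carr (V \<otimes> W \<otimes> W).
        sndT W V W \<Psi> (fstT V W W \<Psi> (sndT V W W B t)) =
        fstT W W V B (sndT W V W \<Psi> (fstT V W W \<Psi> t))) \<longleftrightarrow> hexR W B V \<Psi>"
proof -
  have "assocR W W V x = assocR W W V y \<longleftrightarrow> x = y"
    if "x \<in> carr ((W \<otimes> W) \<otimes> V)" "y \<in> carr ((W \<otimes> W) \<otimes> V)" for x y
    using that by (metis assocL_assocR vs)
  moreover have "assocL W W V x = y \<longleftrightarrow> x = assocR W W V y"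
    if "x \<in> carr (W \<otimes> (W \<otimes> V))" "y \<in> carr ((W \<otimes> W) \<otimes> V)" for x y
    using that by (metis assocL_assocR assocR_assocL vs)
  ultimately show ?thesis
    unfolding hexR_def by (simp add: extR_def sndT_def[of V W W B] fstT_def[of W W V B])
qed

lemma mult_compatL_iff:
  "mult_compatL V W m \<Psi> \<longleftrightarrow>
     (\<forall>t\<in>carr ((V \<otimes> V) \<otimes> W).
        \<Psi> (tmap (V \<otimes> V) W V W m id t) = tmap W (V \<otimes> V) W V id m (extL V W \<Psi> t)) \<and>
     (\<forall>u. is_unit_of V m u \<longrightarrow> (\<forall>w\<in>carr W. \<Psi> (tens V W u w) = tens W V w u))"
  unfolding mult_compatL_def by (subst all_assocL[OF vs(1,1,2), symmetric]) (simp add: extL_def)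

lemma mult_compatR_iff:
  "mult_compatR V W m \<Psi> \<longleftrightarrow>
     (\<forall>t\<in>carr (V \<otimes> (W \<otimes> W)).
        \<Psi> (tmap V (W \<otimes> W) V W id m t) = tmap (W \<otimes> W) V W V m id (extR V W \<Psi> t)) \<and>
     (\<forall>u. is_unit_of W m u \<longrightarrow> (\<forall>v\<in>carr V. \<Psi> (tens V W v u) = tens W V u v))"
  unfolding mult_compatR_def by (simp add: extR_def)

lemma comult_compatL_iff:
  "comult_compatL V W \<Delta> \<epsilon> \<Psi> \<longleftrightarrow>
     (\<forall>t\<in>carr (V \<otimes> W).
        tmap W V W (V \<otimes> V) id \<Delta> (\<Psi> t) = extL V W \<Psi> (tmap V W (V \<otimes> V) W \<Delta> id t)) \<and>
     (\<forall>t\<in>carr (V \<otimes> W). cR W V \<epsilon> (\<Psi> t) = cL V W \<epsilon> t)"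
  unfolding comult_compatL_def by (simp add: extL_def cR_def cL_def)

lemma comult_compatR_iff:
  assumes [simp]: "lin W (W \<otimes> W) \<Delta>"
  shows "comult_compatR V W \<Delta> \<epsilon> \<Psi> \<longleftrightarrow>
     (\<forall>t\<in>carr (V \<otimes> W).
        tmap W V (W \<otimes> W) V \<Delta> id (\<Psi> t) = extR V W \<Psi> (tmap V W V (W \<otimes> W) id \<Delta> t)) \<and>
     (\<forall>t\<in>carr (V \<otimes> W). cL W V \<epsilon> (\<Psi> t) = cR V W \<epsilon> t)"
proof -
  have "x = assocL W W V y \<longleftrightarrow> assocR W W V x = y"
    if "x \<in> carr ((W \<otimes> W) \<otimes> V)" "y \<in> carr (W \<otimes> (W \<otimes> V))" for x y
    using that by (metis assocL_assocR assocR_assocL vs)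
  then show ?thesis
    unfolding comult_compatR_def by (simp add: extR_def cR_def cL_def \<Psi>_carr)
qed

end

lemma braided_iff_hexL: "braided V B \<longleftrightarrow> vs V \<and> lin_bij (V \<otimes> V) (V \<otimes> V) B \<and> hexL V B V B"
  using left_hexagon_iff[of V V B B] by (auto simp: braided_def lin_bij_def)

lemma left_braided_iff:
  "left_braided V B W \<Psi> \<longleftrightarrow> braided V B \<and> vs W \<and> lin_bij (V \<otimes> W) (W \<otimes> V) \<Psi> \<and> hexL V B W \<Psi>"
  using left_hexagon_iff[of V W \<Psi> B] by (auto simp: left_braided_def lin_bij_def braided_def)

lemma right_braided_iff:
  "right_braided W B V \<Psi> \<longleftrightarrow> braided W B \<and> vs V \<and> lin_bij (V \<otimes> W) (W \<otimes> V) \<Psi> \<and> hexR W B V \<Psi>"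
  using right_hexagon_iff[of V W \<Psi> B] by (auto simp: right_braided_def lin_bij_def braided_def)

section \<open>Inverse braidings\<close>

text \<open>Moving \<open>W \<otimes> W\<close> back past \<open>V\<close> with the inverse \<open>\<Phi>\<close> inverts moving \<open>V\<close> past \<open>W \<otimes> W\<close> with \<open>\<Psi>\<close>
  (\<open>extL_extR\<close>). Hence each naturality square for \<open>\<Psi>\<close> is one for \<open>\<Phi>\<close>, read backwards, and a condition
  on the right factor becomes one on the left factor.\<close>

definition inverse_maps :: "'a set \<Rightarrow> 'b set \<Rightarrow> ('a \<Rightarrow> 'b) \<Rightarrow> ('b \<Rightarrow> 'a) \<Rightarrow> bool" where
  "inverse_maps A B f g \<longleftrightarrow> (\<forall>x\<in>A. f x \<in> B \<and> g (f x) = x) \<and> (\<forall>y\<in>B. g y \<in> A \<and> f (g y) = y)"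

lemma lin_bij_inv_on:
  assumes "vs X" "lin_bij X Y f"
  shows "lin_bij Y X (inv_on X f)" "inverse_maps (carr X) (carr Y) f (inv_on X f)"
proof -
  have b: "bij_betw f (carr X) (carr Y)" and l: "lin X Y f" using assms by (auto simp: lin_bij_def)
  let ?g = "inv_into (carr X) f"
  have g: "bij_betw ?g (carr Y) (carr X)" using b by (rule bij_betw_inv_into)
  have fg: "f (?g y) = y" "?g y \<in> carr X" if "y \<in> carr Y" for y
    using that b g by (auto simp: bij_betw_inv_into_right bij_betw_def)
  have gf: "?g (f x) = x" "f x \<in> carr Y" if "x \<in> carr X" for x
    using that b by (auto simp: bij_betw_inv_into_left bij_betw_def)
  have "lin Y X ?g"
  proof (intro linI)
    fix x y c assume x: "x \<in> carr Y" then show "?g x \<in> carr X" by (rule fg)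
    show "?g (scl Y c x) = scl X c (?g x)"
      using gf(1)[of "scl X c (?g x)"] fg[OF x] assms(1) lin_scl[OF l, of "?g x"] by (simp add: vs_carr)
    assume y: "y \<in> carr Y"
    show "?g (x + y) = ?g x + ?g y"
      using gf(1)[of "?g x + ?g y"] fg[OF x] fg[OF y] assms(1) lin_add[OF l, of "?g x" "?g y"] by (simp add: vs_carr)
  qed
  with g show "lin_bij Y X (inv_on X f)" by (simp add: lin_bij_def inv_on_def)
  show "inverse_maps (carr X) (carr Y) f (inv_on X f)"
    using fg gf by (simp add: inverse_maps_def inv_on_def)
qed

locale inverse_braidings =
  fixes V :: "('k::field, 'v::ab_group_add) vecsp" and W :: "('k, 'w::ab_group_add) vecsp" and \<Psi> \<Phi>
  assumes vs [simp]: "vs V" "vs W"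
    and \<Psi> [simp]: "lin (V \<otimes> W) (W \<otimes> V) \<Psi>" and \<Phi> [simp]: "lin (W \<otimes> V) (V \<otimes> W) \<Phi>"
    and inverse: "inverse_maps (carr (V \<otimes> W)) (carr (W \<otimes> V)) \<Psi> \<Phi>"
begin

lemma inv [simp]: "t \<in> carr (V \<otimes> W) \<Longrightarrow> \<Phi> (\<Psi> t) = t" "s \<in> carr (W \<otimes> V) \<Longrightarrow> \<Psi> (\<Phi> s) = s"
  "t \<in> carr (V \<otimes> W) \<Longrightarrow> \<Psi> t \<in> carr (W \<otimes> V)" "s \<in> carr (W \<otimes> V) \<Longrightarrow> \<Phi> s \<in> carr (V \<otimes> W)"
  using inverse by (auto simp: inverse_maps_def)

lemma swap: "inverse_braidings W V \<Phi> \<Psi>"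
  using inverse by unfold_locales (auto simp: inverse_maps_def)

lemma sndT_inverse: "vs Z \<Longrightarrow> t \<in> carr (Z \<otimes> (V \<otimes> W)) \<Longrightarrow> sndT Z W V \<Phi> (sndT Z V W \<Psi> t) = t"
  by (simp add: sndT_def tmap_tmap[of Z "V \<otimes> W"] tmap_ident)

lemma fstT_inverse: "vs Z \<Longrightarrow> t \<in> carr (V \<otimes> (W \<otimes> Z)) \<Longrightarrow> fstT W V Z \<Phi> (fstT V W Z \<Psi> t) = t"
  by (simp add: fstT_def tmap_tmap[of "V \<otimes> W" Z] tmap_ident)

lemma extL_extR: "t \<in> carr (V \<otimes> (W \<otimes> W)) \<Longrightarrow> extL W V \<Phi> (extR V W \<Psi> t) = t"
  by (simp add: extL_def extR_def sndT_inverse fstT_inverse)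

lemma extR_extL: "t \<in> carr ((V \<otimes> V) \<otimes> W) \<Longrightarrow> extR W V \<Phi> (extL V W \<Psi> t) = t"
  by (simp add: extL_def extR_def sndT_inverse fstT_inverse)

lemmas extL_extR' = inverse_braidings.extL_extR[OF swap]
lemmas extR_extL' = inverse_braidings.extR_extL[OF swap]

lemma hexL_inverse: assumes [simp]: "lin (W \<otimes> W) (W \<otimes> W) B" and "hexR W B V \<Psi>" shows "hexL W B V \<Phi>"
  unfolding hexL_def
proof
  fix s assume s [simp]: "s \<in> carr ((W \<otimes> W) \<otimes> V)"
  have "extL W V \<Phi> (tmap (W \<otimes> W) V (W \<otimes> W) V B id (extR V W \<Psi> (extL W V \<Phi> s)))
      = extL W V \<Phi> (extR V W \<Psi> (tmap V (W \<otimes> W) V (W \<otimes> W) id B (extL W V \<Phi> s)))"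
    using assms by (simp add: hexR_def)
  then show "extL W V \<Phi> (tmap (W \<otimes> W) V (W \<otimes> W) V B id s) = tmap V (W \<otimes> W) V (W \<otimes> W) id B (extL W V \<Phi> s)"
    by (simp add: extR_extL' extL_extR)
qed

lemma hexR_inverse: assumes [simp]: "lin (V \<otimes> V) (V \<otimes> V) B" and "hexL V B W \<Psi>" shows "hexR V B W \<Phi>"
  unfolding hexR_def
proof
  fix s assume s [simp]: "s \<in> carr (W \<otimes> (V \<otimes> V))"
  have "extR W V \<Phi> (tmap W (V \<otimes> V) W (V \<otimes> V) id B (extL V W \<Psi> (extR W V \<Phi> s)))
      = extR W V \<Phi> (extL V W \<Psi> (tmap (V \<otimes> V) W (V \<otimes> V) W B id (extR W V \<Phi> s)))"
    using assms by (simp add: hexL_def)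
  then show "extR W V \<Phi> (tmap W (V \<otimes> V) W (V \<otimes> V) id B s) = tmap (V \<otimes> V) W (V \<otimes> V) W B id (extR W V \<Phi> s)"
    by (simp add: extR_extL extL_extR')
qed

lemma mult_compatL_inverse:
  assumes m [simp]: "lin (W \<otimes> W) W m" and c: "mult_compatR V W m \<Psi>" shows "mult_compatL W V m \<Phi>"
  unfolding mult_compatL_iff[OF vs(2,1) \<Phi>]
proof (intro conjI ballI allI impI)
  fix s assume s [simp]: "s \<in> carr ((W \<otimes> W) \<otimes> V)"
  have "\<Phi> (tmap (W \<otimes> W) V W V m id (extR V W \<Psi> (extL W V \<Phi> s)))
      = \<Phi> (\<Psi> (tmap V (W \<otimes> W) V W id m (extL W V \<Phi> s)))"
    using c by (simp add: mult_compatR_iff)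
  then show "\<Phi> (tmap (W \<otimes> W) V W V m id s) = tmap V (W \<otimes> W) V W id m (extL W V \<Phi> s)"
    by (simp add: extR_extL' del: inv(2))
next
  fix u v assume "is_unit_of W m u" "v \<in> carr V"
  then show "\<Phi> (tens W V u v) = tens V W v u"
    using c inv(1)[of "tens V W v u"] by (simp add: mult_compatR_iff is_unit_of_def)
qed

lemma mult_compatR_inverse:
  assumes m [simp]: "lin (V \<otimes> V) V m" and c: "mult_compatL V W m \<Psi>" shows "mult_compatR W V m \<Phi>"
  unfolding mult_compatR_iff[OF vs(2,1) \<Phi>]
proof (intro conjI ballI allI impI)
  fix s assume s [simp]: "s \<in> carr (W \<otimes> (V \<otimes> V))"
  have "\<Phi> (tmap W (V \<otimes> V) W V id m (extL V W \<Psi> (extR W V \<Phi> s)))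
      = \<Phi> (\<Psi> (tmap (V \<otimes> V) W V W m id (extR W V \<Phi> s)))"
    using c by (simp add: mult_compatL_iff)
  then show "\<Phi> (tmap W (V \<otimes> V) W V id m s) = tmap (V \<otimes> V) W V W m id (extR W V \<Phi> s)"
    by (simp add: extL_extR' del: inv(2))
next
  fix u v assume "is_unit_of V m u" "v \<in> carr W"
  then show "\<Phi> (tens W V v u) = tens V W u v"
    using c inv(1)[of "tens V W u v"] by (simp add: mult_compatL_iff is_unit_of_def)
qed

lemma comult_compatL_inverse:
  assumes d [simp]: "lin W (W \<otimes> W) \<Delta>" and c: "comult_compatR V W \<Delta> \<epsilon> \<Psi>" shows "comult_compatL W V \<Delta> \<epsilon> \<Phi>"
  unfolding comult_compatL_iff[OF vs(2,1) \<Phi>]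
proof (intro conjI ballI)
  fix s assume s [simp]: "s \<in> carr (W \<otimes> V)"
  have "extL W V \<Phi> (tmap W V (W \<otimes> W) V \<Delta> id (\<Psi> (\<Phi> s))) = extL W V \<Phi> (extR V W \<Psi> (tmap V W V (W \<otimes> W) id \<Delta> (\<Phi> s)))"
    using c by (simp add: comult_compatR_iff del: inv(2))
  then show "tmap V W V (W \<otimes> W) id \<Delta> (\<Phi> s) = extL W V \<Phi> (tmap W V (W \<otimes> W) V \<Delta> id s)"
    by (simp add: extL_extR)
  have "cL W V \<epsilon> (\<Psi> (\<Phi> s)) = cR V W \<epsilon> (\<Phi> s)"
    using c by (simp add: comult_compatR_iff del: inv(2))
  then show "cR V W \<epsilon> (\<Phi> s) = cL W V \<epsilon> s" by simp
qed

lemma comult_compatR_inverse: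
  assumes d [simp]: "lin V (V \<otimes> V) \<Delta>" and c: "comult_compatL V W \<Delta> \<epsilon> \<Psi>" shows "comult_compatR W V \<Delta> \<epsilon> \<Phi>"
  unfolding comult_compatR_iff[OF vs(2,1) \<Phi> d]
proof (intro conjI ballI)
  fix s assume s [simp]: "s \<in> carr (W \<otimes> V)"
  have "extR W V \<Phi> (tmap W V W (V \<otimes> V) id \<Delta> (\<Psi> (\<Phi> s))) = extR W V \<Phi> (extL V W \<Psi> (tmap V W (V \<otimes> V) W \<Delta> id (\<Phi> s)))"
    using c by (simp add: comult_compatL_iff del: inv(2))
  then show "tmap V W (V \<otimes> V) W \<Delta> id (\<Phi> s) = extR W V \<Phi> (tmap W V W (V \<otimes> V) id \<Delta> s)"
    by (simp add: extR_extL)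
  have "cR W V \<epsilon> (\<Psi> (\<Phi> s)) = cL V W \<epsilon> (\<Phi> s)"
    using c by (simp add: comult_compatL_iff del: inv(2))
  then show "cL V W \<epsilon> (\<Phi> s) = cR W V \<epsilon> s" by simp
qed

end

section \<open>Mirror images\<close>

text \<open>Conjugating all maps by the flips exchanges the left and right factors everywhere, also inside
  the tensor squares; a product or coproduct is replaced by its opposite. This exchanges the left
  with the right variant of each notion. The maps \<open>revL\<close> and \<open>revR\<close> reverse the order of three
  factors.\<close>

definition revL :: "('k::field, 'v::ab_group_add) vecsp \<Rightarrow> ('k, 'w::ab_group_add) vecsp \<Rightarrow>
    (('v, 'v, 'k) tens, 'w, 'k) tens \<Rightarrow> ('w, ('v, 'v, 'k) tens, 'k) tens" where
  "revL V W t = tmap W (V \<otimes> V) W (V \<otimes> V) id (flip V V) (flip (V \<otimes> V) W t)"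

definition revR :: "('k::field, 'v::ab_group_add) vecsp \<Rightarrow> ('k, 'w::ab_group_add) vecsp \<Rightarrow>
    ('w, ('v, 'v, 'k) tens, 'k) tens \<Rightarrow> (('v, 'v, 'k) tens, 'w, 'k) tens" where
  "revR V W t = tmap (V \<otimes> V) W (V \<otimes> V) W (flip V V) id (flip W (V \<otimes> V) t)"

lemma lin_revL [simp]: "lin ((V \<otimes> V) \<otimes> W) (W \<otimes> (V \<otimes> V)) (revL V W)"
  unfolding revL_def[abs_def] by (rule lin_comp[OF lin_flip lin_tmap]) simp_all

lemma lin_revR [simp]: "lin (W \<otimes> (V \<otimes> V)) ((V \<otimes> V) \<otimes> W) (revR V W)"
  unfolding revR_def[abs_def] by (rule lin_comp[OF lin_flip lin_tmap]) simp_all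

lemmas revL_carr [simp] = lin_carr[OF lin_revL] and revL_add [simp] = lin_add[OF lin_revL]
lemmas revR_carr [simp] = lin_carr[OF lin_revR] and revR_add [simp] = lin_add[OF lin_revR]

lemma revL_tens [simp]: "t \<in> carr (V \<otimes> V) \<Longrightarrow> w \<in> carr W \<Longrightarrow>
    revL V W (tens (V \<otimes> V) W t w) = tens W (V \<otimes> V) w (flip V V t)"
  by (simp add: revL_def)

lemma revR_tens [simp]: "t \<in> carr (V \<otimes> V) \<Longrightarrow> w \<in> carr W \<Longrightarrow>
    revR V W (tens W (V \<otimes> V) w t) = tens (V \<otimes> V) W (flip V V t) w"
  by (simp add: revR_def)

context
  fixes V :: "('k::field, 'v::ab_group_add) vecsp" and W :: "('k, 'w::ab_group_add) vecsp"
  assumes vs [simp]: "vs V" "vs W"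
begin

lemma revL_revR [simp]:
  assumes "t \<in> carr (W \<otimes> (V \<otimes> V))"
  shows "revL V W (revR V W t) = t"
  using assms vs(2) vs_tensor[of V V] by (induction rule: tensor_induct) simp_all

lemma revR_revL [simp]:
  assumes "t \<in> carr ((V \<otimes> V) \<otimes> W)"
  shows "revR V W (revL V W t) = t"
  using assms vs_tensor[of V V] vs(2) by (induction rule: tensor_induct) simp_all

lemma ball_onto: "(\<And>t. t \<in> B \<Longrightarrow> f t \<in> A) \<Longrightarrow> (\<And>s. s \<in> A \<Longrightarrow> g s \<in> B \<and> f (g s) = s) \<Longrightarrow>
    (\<forall>s\<in>A. P s) \<longleftrightarrow> (\<forall>t\<in>B. P (f t))"
  by metis

lemma ball_revL: "(\<forall>s\<in>carr (W \<otimes> (V \<otimes> V)). P s) \<longleftrightarrow> (\<forall>t\<in>carr ((V \<otimes> V) \<otimes> W). P (revL V W t))"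
  by (rule ball_onto[where g = "revR V W"]) simp_all

lemma ball_revR: "(\<forall>t\<in>carr ((V \<otimes> V) \<otimes> W). P t) \<longleftrightarrow> (\<forall>s\<in>carr (W \<otimes> (V \<otimes> V)). P (revR V W s))"
  by (rule ball_onto[where g = "revL V W"]) simp_all

lemma ball_flip: "(\<forall>s\<in>carr (W \<otimes> V). P s) \<longleftrightarrow> (\<forall>t\<in>carr (V \<otimes> W). P (flip V W t))"
  by (rule ball_onto[where g = "flip W V"]) simp_all

context
  fixes f f' X
  assumes X: "vs X" and f: "lin (V \<otimes> V) X f" "lin (V \<otimes> V) X f'"
    and ff: "\<And>t. t \<in> carr (V \<otimes> V) \<Longrightarrow> f' (flip V V t) = f t"
begin

lemma tmap_revL:
  assumes "t \<in> carr ((V \<otimes> V) \<otimes> W)"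
  shows "tmap W (V \<otimes> V) W X id f' (revL V W t) = flip X W (tmap (V \<otimes> V) W X W f id t)"
  using assms vs_tensor[of V V] vs(2)
  by (induction rule: tensor_induct) (simp_all add: f ff lin_carr[OF f(1)])

lemma tmap_revR:
  assumes "t \<in> carr (W \<otimes> (V \<otimes> V))"
  shows "tmap (V \<otimes> V) W X W f' id (revR V W t) = flip W X (tmap W (V \<otimes> V) W X id f t)"
  using assms vs(2) vs_tensor[of V V]
  by (induction rule: tensor_induct) (simp_all add: f ff lin_carr[OF f(1)])

end

end

lemma is_unit_of_mirror:
  assumes "\<And>t. t \<in> carr (V \<otimes> V) \<Longrightarrow> m' (flip V V t) = m t"
  shows "is_unit_of V m' u \<longleftrightarrow> is_unit_of V m u"
proof -
  have "m' (tens V V x y) = m (tens V V y x)" if "x \<in> carr V" "y \<in> carr V" for x y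
    using assms[of "tens V V y x"] that by simp
  then show ?thesis by (auto simp: is_unit_of_def)
qed

locale mirror_braidings =
  fixes V :: "('k::field, 'v::ab_group_add) vecsp" and W :: "('k, 'w::ab_group_add) vecsp" and \<Psi> \<Psi>'
  assumes vs [simp]: "vs V" "vs W"
    and \<Psi> [simp]: "lin (V \<otimes> W) (W \<otimes> V) \<Psi>" and \<Psi>' [simp]: "lin (W \<otimes> V) (V \<otimes> W) \<Psi>'"
    and mirror [simp]: "\<And>t. t \<in> carr (V \<otimes> W) \<Longrightarrow> \<Psi>' (flip V W t) = flip W V (\<Psi> t)"
begin

lemmas \<Psi>_carr [simp] = lin_carr[OF \<Psi>] and \<Psi>_add [simp] = lin_add[OF \<Psi>]
lemmas \<Psi>'_carr [simp] = lin_carr[OF \<Psi>']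

lemma mirror_tens [simp]: "v \<in> carr V \<Longrightarrow> w \<in> carr W \<Longrightarrow> \<Psi>' (tens W V w v) = flip W V (\<Psi> (tens V W v w))"
  using mirror[of "tens V W v w"] by simp

lemma mirror' : "t \<in> carr (W \<otimes> V) \<Longrightarrow> \<Psi> (flip W V t) = flip V W (\<Psi>' t)"
  using mirror[of "flip W V t"] by (simp del: mirror)

lemma swap: "mirror_braidings W V \<Psi>' \<Psi>"
  by unfold_locales (simp_all add: mirror')

lemma extR_revL:
  assumes "t \<in> carr ((V \<otimes> V) \<otimes> W)"
  shows "extR W V \<Psi>' (revL V W t) = revR V W (extL V W \<Psi> t)"
  using assms vs(1,1,2)
proof (induction rule: tensor3_inductL)
  case (tens x y w)
  have 1: "assocL V V W (tens V (V \<otimes> W) y (flip W V r)) = revR V W (assocR W V V (tens (W \<otimes> V) V r y))"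
    if "r \<in> carr (W \<otimes> V)" "y \<in> carr V" for r y
    using that(1) vs(2,1) by (induction rule: tensor_induct) (simp_all add: that)
  have 2: "assocL V V W (sndT V W V \<Psi>' (assocR V W V (tens (V \<otimes> W) V (flip W V s) x)))
      = revR V W (fstT V W V \<Psi> (tens V (W \<otimes> V) x s))" if "s \<in> carr (W \<otimes> V)" for s
    using that vs(2,1) by (induction rule: tensor_induct) (simp_all add: 1 tens)
  show ?case using tens 2 by (simp add: extR_tens extL_tens)
qed simp_all

lemma extL_revR:
  assumes t: "t \<in> carr (V \<otimes> (W \<otimes> W))"
  shows "extL W V \<Psi>' (revR W V t) = revL W V (extR V W \<Psi> t)"
  using mirror_braidings.extR_revL[OF swap, of "revR W V t"] t by simp

lemma hexR_mirror:
  assumes B [simp]: "lin (V \<otimes> V) (V \<otimes> V) B" "lin (V \<otimes> V) (V \<otimes> V) B'"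
    and BB: "\<And>t. t \<in> carr (V \<otimes> V) \<Longrightarrow> B' (flip V V t) = flip V V (B t)"
    and h: "hexL V B W \<Psi>"
  shows "hexR V B' W \<Psi>'"
proof -
  have 1: "tmap W (V \<otimes> V) W (V \<otimes> V) id B' (revL V W t) = revL V W (tmap (V \<otimes> V) W (V \<otimes> V) W B id t)"
    if "t \<in> carr ((V \<otimes> V) \<otimes> W)" for t
    using that vs_tensor[of V V] vs(2)
    by (induction rule: tensor_induct) (simp_all add: BB lin_carr[OF B(1)])
  have 2: "tmap (V \<otimes> V) W (V \<otimes> V) W B' id (revR V W t) = revR V W (tmap W (V \<otimes> V) W (V \<otimes> V) id B t)"
    if "t \<in> carr (W \<otimes> (V \<otimes> V))" for t
    using that vs(2) vs_tensor[of V V]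
    by (induction rule: tensor_induct) (simp_all add: BB lin_carr[OF B(1)])
  show ?thesis
    unfolding hexR_def ball_revL[OF vs] using h by (simp add: 1 2 extR_revL hexL_def)
qed

lemma mult_compatR_mirror:
  assumes m [simp]: "lin (V \<otimes> V) V m" "lin (V \<otimes> V) V m'"
    and mm: "\<And>t. t \<in> carr (V \<otimes> V) \<Longrightarrow> m' (flip V V t) = m t"
    and c: "mult_compatL V W m \<Psi>"
  shows "mult_compatR W V m' \<Psi>'"
  unfolding mult_compatR_iff[OF vs(2,1) \<Psi>'] ball_revL[OF vs]
proof (intro conjI ballI allI impI)
  fix t assume [simp]: "t \<in> carr ((V \<otimes> V) \<otimes> W)"
  have "\<Psi> (tmap (V \<otimes> V) W V W m id t) = tmap W (V \<otimes> V) W V id m (extL V W \<Psi> t)"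
    using c by (simp add: mult_compatL_iff)
  then show "\<Psi>' (tmap W (V \<otimes> V) W V id m' (revL V W t)) = tmap (V \<otimes> V) W V W m' id (extR W V \<Psi>' (revL V W t))"
    by (simp add: extR_revL tmap_revL[OF vs vs(1) m mm] tmap_revR[OF vs vs(1) m mm])
next
  fix u w assume u: "is_unit_of V m' u" "w \<in> carr W"
  then have "is_unit_of V m u" using mm is_unit_of_mirror by blast
  with u have "u \<in> carr V" "\<Psi> (tens V W u w) = tens W V w u"
    using c by (simp_all add: mult_compatL_iff is_unit_of_def[of V m u])
  with u show "\<Psi>' (tens W V w u) = tens V W u w" by simp
qed

lemma mult_compatL_mirror:
  assumes m [simp]: "lin (W \<otimes> W) W m" "lin (W \<otimes> W) W m'"
    and mm: "\<And>t. t \<in> carr (W \<otimes> W) \<Longrightarrow> m' (flip W W t) = m t"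
    and c: "mult_compatR V W m \<Psi>"
  shows "mult_compatL W V m' \<Psi>'"
  unfolding mult_compatL_iff[OF vs(2,1) \<Psi>'] ball_revR[OF vs(2,1)]
proof (intro conjI ballI allI impI)
  fix t assume [simp]: "t \<in> carr (V \<otimes> (W \<otimes> W))"
  have "\<Psi> (tmap V (W \<otimes> W) V W id m t) = tmap (W \<otimes> W) V W V m id (extR V W \<Psi> t)"
    using c by (simp add: mult_compatR_iff)
  then show "\<Psi>' (tmap (W \<otimes> W) V W V m' id (revR W V t)) = tmap V (W \<otimes> W) V W id m' (extL W V \<Psi>' (revR W V t))"
    by (simp add: extL_revR tmap_revL[OF vs(2,1) vs(2) m mm] tmap_revR[OF vs(2,1) vs(2) m mm])
next
  fix u v assume u: "is_unit_of W m' u" "v \<in> carr V"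
  then have "is_unit_of W m u" using mm is_unit_of_mirror by blast
  with u have "u \<in> carr W" "\<Psi> (tens V W v u) = tens W V u v"
    using c by (simp_all add: mult_compatR_iff is_unit_of_def[of W m u])
  with u show "\<Psi>' (tens W V u v) = tens V W v u" by simp
qed

lemma comult_compatR_mirror:
  assumes d [simp]: "lin V (V \<otimes> V) \<Delta>" "lin V (V \<otimes> V) \<Delta>'" and e [simp]: "lin V Kvec \<epsilon>"
    and dd [simp]: "\<And>x. x \<in> carr V \<Longrightarrow> \<Delta>' x = flip V V (\<Delta> x)"
    and c: "comult_compatL V W \<Delta> \<epsilon> \<Psi>"
  shows "comult_compatR W V \<Delta>' \<epsilon> \<Psi>'"
proof -
  note [simp] = lin_carr[OF d(1)]
  have 1: "tmap W V W (V \<otimes> V) id \<Delta>' (flip V W t) = revL V W (tmap V W (V \<otimes> V) W \<Delta> id t)"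
    if "t \<in> carr (V \<otimes> W)" for t
    using that vs by (induction rule: tensor_induct) simp_all
  have 2: "tmap V W (V \<otimes> V) W \<Delta>' id (flip W V t) = revR V W (tmap W V W (V \<otimes> V) id \<Delta> t)"
    if "t \<in> carr (W \<otimes> V)" for t
    using that vs(2,1) by (induction rule: tensor_induct) simp_all
  show ?thesis
    unfolding comult_compatR_iff[OF vs(2,1) \<Psi>' d(2)] ball_flip[OF vs]
    using c by (simp add: 1 2 comult_compatL_iff extR_revL cL_flip cR_flip)
qed

lemma comult_compatL_mirror:
  assumes d [simp]: "lin W (W \<otimes> W) \<Delta>" "lin W (W \<otimes> W) \<Delta>'" and e [simp]: "lin W Kvec \<epsilon>"
    and dd [simp]: "\<And>x. x \<in> carr W \<Longrightarrow> \<Delta>' x = flip W W (\<Delta> x)"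
    and c: "comult_compatR V W \<Delta> \<epsilon> \<Psi>"
  shows "comult_compatL W V \<Delta>' \<epsilon> \<Psi>'"
proof -
  note [simp] = lin_carr[OF d(1)]
  have 1: "tmap V W V (W \<otimes> W) id \<Delta>' (flip W V t) = revL W V (tmap W V (W \<otimes> W) V \<Delta> id t)"
    if "t \<in> carr (W \<otimes> V)" for t
    using that vs(2,1) by (induction rule: tensor_induct) simp_all
  have 2: "tmap W V (W \<otimes> W) V \<Delta>' id (flip V W t) = revR W V (tmap V W V (W \<otimes> W) id \<Delta> t)"
    if "t \<in> carr (V \<otimes> W)" for t
    using that vs by (induction rule: tensor_induct) simp_all
  show ?thesis
    unfolding comult_compatL_iff[OF vs(2,1) \<Psi>'] ball_flip[OF vs]
    using c by (simp add: 1 2 comult_compatR_iff extL_revR cL_flip cR_flip)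
qed

end

section \<open>Nested pairings of tensor products\<close>

text \<open>For pairings \<open>p\<close> of \<open>A\<close> with \<open>X\<close> and \<open>q\<close> of \<open>B\<close> with \<open>Y\<close>, the pairing of \<open>A \<otimes> B\<close> with
  \<open>Y \<otimes> X\<close> that contracts the inner factors first. For two evaluation pairings it is the
  double-bracket pairing.\<close>

definition pten :: "('k::field, 'a::ab_group_add) vecsp \<Rightarrow> ('k, 'b::ab_group_add) vecsp \<Rightarrow>
    ('k, 'y::ab_group_add) vecsp \<Rightarrow> ('k, 'x::ab_group_add) vecsp \<Rightarrow>
    ('a \<Rightarrow> 'x \<Rightarrow> 'k) \<Rightarrow> ('b \<Rightarrow> 'y \<Rightarrow> 'k) \<Rightarrow> ('a, 'b, 'k) tens \<Rightarrow> ('y, 'x, 'k) tens \<Rightarrow> 'k" where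
  "pten A B Y X p q t w = tlift A B Kvec (\<lambda>a b. tlift Y X Kvec (\<lambda>y x. p a x * q b y) w) t"

definition separated :: "('k::field, 'a::ab_group_add) vecsp \<Rightarrow> ('k, 'x::ab_group_add) vecsp \<Rightarrow> ('a \<Rightarrow> 'x \<Rightarrow> 'k) \<Rightarrow> bool" where
  "separated A X p \<longleftrightarrow> (\<forall>a\<in>carr A. (\<forall>x\<in>carr X. p a x = 0) \<longrightarrow> a = 0)"

locale two_pairings =
  fixes A :: "('k::field, 'a::ab_group_add) vecsp" and B :: "('k, 'b::ab_group_add) vecsp"
    and Y :: "('k, 'y::ab_group_add) vecsp" and X :: "('k, 'x::ab_group_add) vecsp" and p q
  assumes vs [simp]: "vs A" "vs B" "vs Y" "vs X"
    and p: "bilin A X Kvec p" and q: "bilin B Y Kvec q"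
begin

lemma lin_p [simp]: "a \<in> carr A \<Longrightarrow> lin X Kvec (p a)" "x \<in> carr X \<Longrightarrow> lin A Kvec (\<lambda>a. p a x)"
  using p by (auto simp: bilin_def)

lemma lin_q [simp]: "b \<in> carr B \<Longrightarrow> lin Y Kvec (q b)" "y \<in> carr Y \<Longrightarrow> lin B Kvec (\<lambda>b. q b y)"
  using q by (auto simp: bilin_def)

lemmas p_simps = bilin_add_left[OF p] bilin_add_right[OF p] bilin_scl_left[OF p, simplified] bilin_scl_right[OF p, simplified]
lemmas q_simps = bilin_add_left[OF q] bilin_add_right[OF q] bilin_scl_left[OF q, simplified] bilin_scl_right[OF q, simplified]

lemma bilin_inner: "a \<in> carr A \<Longrightarrow> b \<in> carr B \<Longrightarrow> bilin Y X Kvec (\<lambda>y x. p a x * q b y)"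
  by (intro bilinI linI) (simp_all add: p_simps q_simps algebra_simps)

lemma bilin_outer:
  assumes w: "w \<in> carr (Y \<otimes> X)"
  shows "bilin A B Kvec (\<lambda>a b. tlift Y X Kvec (\<lambda>y x. p a x * q b y) w)"
proof (rule bilinI)
  fix a assume a: "a \<in> carr A"
  have "bilin B (Y \<otimes> X) Kvec (\<lambda>b. tlift Y X Kvec (\<lambda>y x. p a x * q b y))"
    by (rule bilin_tlift(2); (intro linI bilin_inner)?; (use a in \<open>simp add: q_simps algebra_simps\<close>)?)
  then show "lin B Kvec (\<lambda>b. tlift Y X Kvec (\<lambda>y x. p a x * q b y) w)" using w by (rule bilinD)
next
  fix b assume b: "b \<in> carr B"
  have "bilin A (Y \<otimes> X) Kvec (\<lambda>a. tlift Y X Kvec (\<lambda>y x. p a x * q b y))"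
    by (rule bilin_tlift(2); (intro linI bilin_inner)?; (use b in \<open>simp add: p_simps algebra_simps\<close>)?)
  then show "lin A Kvec (\<lambda>a. tlift Y X Kvec (\<lambda>y x. p a x * q b y) w)" using w by (rule bilinD)
qed

lemma bilin_pten: "bilin (A \<otimes> B) (Y \<otimes> X) Kvec (pten A B Y X p q)"
  unfolding pten_def[abs_def]
  by (rule bilin_tlift) (auto intro!: lin_tlift bilin_inner bilin_outer)

lemma pten_tens [simp]:
  "a \<in> carr A \<Longrightarrow> b \<in> carr B \<Longrightarrow> x \<in> carr X \<Longrightarrow> y \<in> carr Y \<Longrightarrow>
   pten A B Y X p q (tens A B a b) (tens Y X y x) = p a x * q b y"
  by (simp add: pten_def tlift_tens[OF vs_Kvec bilin_outer] tlift_tens[OF vs_Kvec bilin_inner])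

lemmas lin_pten [simp] = bilinD[OF bilin_pten]
lemmas pten_add_left [simp] = bilin_add_left[OF bilin_pten]
  and pten_add_right [simp] = bilin_add_right[OF bilin_pten]

lemma pten_cR:
  assumes "t \<in> carr (A \<otimes> B)" "x \<in> carr X" "y \<in> carr Y"
  shows "p (cR A B (\<lambda>b. q b y) t) x = pten A B Y X p q t (tens Y X y x)"
  using assms(1) vs(1,2) by (induction rule: tensor_induct) (use assms in \<open>simp_all add: p_simps\<close>)

lemma separated_pten:
  assumes "separated A X p" "separated B Y q"
  shows "separated (A \<otimes> B) (Y \<otimes> X) (pten A B Y X p q)"
  unfolding separated_def
proof (intro ballI impI)
  fix t assume t: "t \<in> carr (A \<otimes> B)" and z: "\<forall>w\<in>carr (Y \<otimes> X). pten A B Y X p q t w = 0"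
  have "cR A B (\<lambda>b. q b y) t = 0" if "y \<in> carr Y" for y
    using assms(1) t z that unfolding separated_def by (simp add: pten_cR)
  then show "t = 0"
    using assms(2) t by (intro tensor_zeroI[where A = "carr Y" and \<phi> = "\<lambda>y b. q b y" and X = A and Y = B])
      (auto simp: separated_def)
qed

end

lemma separated_eqI:
  assumes "vs A" "bilin A X Kvec p" "separated A X p" "a \<in> carr A" "b \<in> carr A"
    and "\<And>x. x \<in> carr X \<Longrightarrow> p a x = p b x"
  shows "a = b"
proof -
  have "p (a - b) x = 0" if "x \<in> carr X" for x
    using lin_diff[OF assms(1) bilinD(2)[OF assms(2) that] assms(4,5)] assms(6)[OF that] by simp
  moreover have "a - b \<in> carr A" using assms by (simp add: vs_diff)
  ultimately have "a - b = 0" using assms(3) by (auto simp: separated_def)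
  then show ?thesis by simp
qed

lemma pten_tmap:
  assumes 1: "two_pairings A B Y X p q" and 2: "two_pairings A' B' Y' X' p' q'"
    and f: "lin A A' f" and f': "lin X' X f'" and g: "lin B B' g" and g': "lin Y' Y g'"
    and adj: "\<And>a x. a \<in> carr A \<Longrightarrow> x \<in> carr X' \<Longrightarrow> p' (f a) x = p a (f' x)"
      "\<And>b y. b \<in> carr B \<Longrightarrow> y \<in> carr Y' \<Longrightarrow> q' (g b) y = q b (g' y)"
    and t: "t \<in> carr (A \<otimes> B)" and w: "w \<in> carr (Y' \<otimes> X')"
  shows "pten A' B' Y' X' p' q' (tmap A B A' B' f g t) w = pten A B Y X p q t (tmap Y' X' Y X g' f' w)"
proof -
  interpret P: two_pairings A B Y X p q by fact
  interpret Q: two_pairings A' B' Y' X' p' q' by fact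
  note [simp] = f f' g g' lin_carr[OF f] lin_carr[OF f'] lin_carr[OF g] lin_carr[OF g'] adj
  show ?thesis using t P.vs(1,2)
  proof (induction rule: tensor_induct)
    case (tens a b)
    show ?case using w Q.vs(3,4)
      by (induction rule: tensor_induct) (use tens in simp_all)
  qed (use w in simp_all)
qed

section \<open>Dual families of maps\<close>

text \<open>In string diagrams: a strand \<open>V\<close> crossing one leg of the pairing of \<open>U\<close> with \<open>H\<close> can be
  slid across the other leg. The strand \<open>V\<close> itself is not dualized, and both sides are vectors
  of \<open>V\<close>.\<close>

definition transposed :: "('u \<Rightarrow> 'h \<Rightarrow> 'k::field) \<Rightarrow> ('k, 'u::ab_group_add) vecsp \<Rightarrow> ('k, 'h::ab_group_add) vecsp \<Rightarrow>
    ('k, 'v::ab_group_add) vecsp \<Rightarrow> (('u, 'v, 'k) tens \<Rightarrow> ('v, 'u, 'k) tens) \<Rightarrow>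
    (('v, 'h, 'k) tens \<Rightarrow> ('h, 'v, 'k) tens) \<Rightarrow> bool" where
  "transposed p U H V \<psi> \<Psi> \<longleftrightarrow> (\<forall>u\<in>carr U. \<forall>v\<in>carr V. \<forall>h\<in>carr H.
     cR V U (\<lambda>u. p u h) (\<psi> (tens U V u v)) = cL H V (p u) (\<Psi> (tens V H v h)))"

locale dual_maps =
  fixes U :: "('k::field, 'u::ab_group_add) vecsp" and H :: "('k, 'h::ab_group_add) vecsp"
    and V :: "('k, 'v::ab_group_add) vecsp" and p \<psi> \<Psi>
  assumes vs [simp]: "vs U" "vs H" "vs V"
    and p: "bilin U H Kvec p" and sep: "separated U H p"
    and \<psi> [simp]: "lin (U \<otimes> V) (V \<otimes> U) \<psi>" and \<Psi> [simp]: "lin (V \<otimes> H) (H \<otimes> V) \<Psi>"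
    and dual: "transposed p U H V \<psi> \<Psi>"
begin

lemma lin_p [simp]: "u \<in> carr U \<Longrightarrow> lin H Kvec (p u)" "h \<in> carr H \<Longrightarrow> lin U Kvec (\<lambda>u. p u h)"
  using p by (auto simp: bilin_def)

lemmas \<psi>_carr [simp] = lin_carr[OF \<psi>] and \<psi>_add [simp] = lin_add[OF \<psi>]
lemmas \<Psi>_carr [simp] = lin_carr[OF \<Psi>] and \<Psi>_add [simp] = lin_add[OF \<Psi>]
  and \<Psi>_scl = lin_scl[OF \<Psi>, unfolded scl_tensor]

lemma dualD: "u \<in> carr U \<Longrightarrow> v \<in> carr V \<Longrightarrow> h \<in> carr H \<Longrightarrow>
    cR V U (\<lambda>u. p u h) (\<psi> (tens U V u v)) = cL H V (p u) (\<Psi> (tens V H v h))"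
  using dual by (simp add: transposed_def)

lemma eqI:
  assumes "s \<in> carr (X \<otimes> U)" "t \<in> carr (X \<otimes> U)" "vs X"
    and "\<And>h. h \<in> carr H \<Longrightarrow> cR X U (\<lambda>u. p u h) s = cR X U (\<lambda>u. p u h) t"
  shows "s = t"
  using assms sep by (intro tensor_eqI[where A = "carr H" and \<phi> = "\<lambda>h u. p u h" and X=X and Y=U])
    (auto simp: separated_def)

end

text \<open>Naturality with respect to \<open>\<beta>\<close> gives naturality with respect to its transpose \<open>\<alpha>\<close>: after
  contraction with \<open>h\<close> in \<open>H2\<close>, both sides are the contraction of \<open>\<Psi>1 (v \<otimes> \<beta> h)\<close> with \<open>u\<close>.\<close>

lemma dual_maps_natural:
  assumes 1: "dual_maps U1 H1 V p1 \<psi>1 \<Psi>1" and 2: "dual_maps U2 H2 V p2 \<psi>2 \<Psi>2"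
    and \<alpha> [simp]: "lin U1 U2 \<alpha>" and \<beta> [simp]: "lin H2 H1 \<beta>"
    and adj: "\<And>u h. u \<in> carr U1 \<Longrightarrow> h \<in> carr H2 \<Longrightarrow> p2 (\<alpha> u) h = p1 u (\<beta> h)"
    and comm: "\<And>t. t \<in> carr (V \<otimes> H2) \<Longrightarrow> tmap H2 V H1 V \<beta> id (\<Psi>2 t) = \<Psi>1 (tmap V H2 V H1 id \<beta> t)"
    and t: "t \<in> carr (U1 \<otimes> V)"
  shows "\<psi>2 (tmap U1 V U2 V \<alpha> id t) = tmap V U1 V U2 id \<alpha> (\<psi>1 t)"
proof -
  interpret P: dual_maps U1 H1 V p1 \<psi>1 \<Psi>1 by fact
  interpret Q: dual_maps U2 H2 V p2 \<psi>2 \<Psi>2 by fact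
  note [simp] = lin_carr[OF \<alpha>] lin_carr[OF \<beta>]
  show ?thesis using t P.vs(1,3)
  proof (induction rule: tensor_induct)
    case [simp]: (tens u v)
    have "\<psi>2 (tens U2 V (\<alpha> u) v) = tmap V U1 V U2 id \<alpha> (\<psi>1 (tens U1 V u v))"
    proof (rule Q.eqI)
      fix h assume h [simp]: "h \<in> carr H2"
      have "cR V U2 (\<lambda>u. p2 u h) (\<psi>2 (tens U2 V (\<alpha> u) v)) = cL H2 V (p2 (\<alpha> u)) (\<Psi>2 (tens V H2 v h))"
        by (simp add: Q.dualD)
      also have "\<dots> = cL H2 V (\<lambda>h. p1 u (\<beta> h)) (\<Psi>2 (tens V H2 v h))"
        by (rule cL_cong) (simp_all add: adj)
      also have "\<dots> = cL H1 V (p1 u) (tmap H2 V H1 V \<beta> id (\<Psi>2 (tens V H2 v h)))"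
        by (simp add: cL_tmap)
      also have "\<dots> = cL H1 V (p1 u) (\<Psi>1 (tens V H1 v (\<beta> h)))"
        by (simp add: comm)
      also have "\<dots> = cR V U1 (\<lambda>u. p1 u (\<beta> h)) (\<psi>1 (tens U1 V u v))"
        by (simp add: P.dualD)
      also have "\<dots> = cR V U1 (\<lambda>u. p2 (\<alpha> u) h) (\<psi>1 (tens U1 V u v))"
        by (rule cR_cong) (simp_all add: adj)
      also have "\<dots> = cR V U2 (\<lambda>u. p2 u h) (tmap V U1 V U2 id \<alpha> (\<psi>1 (tens U1 V u v)))"
        by (simp add: cR_tmap)
      finally show "cR V U2 (\<lambda>u. p2 u h) (\<psi>2 (tens U2 V (\<alpha> u) v))
        = cR V U2 (\<lambda>u. p2 u h) (tmap V U1 V U2 id \<alpha> (\<psi>1 (tens U1 V u v)))" .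
    qed simp_all
    moreover have "tmap U1 V U2 V \<alpha> id (tens U1 V u v) = tens U2 V (\<alpha> u) v" by simp
    ultimately show ?case by (simp only:)
  qed simp_all
qed

text \<open>Contractions in the dualized factor commute with \<open>\<gamma>\<close>, which acts on the other one.\<close>

lemma dual_maps_natural_undualized:
  assumes 1: "dual_maps U H V1 p \<psi>1 \<Psi>1" and 2: "dual_maps U H V2 p \<psi>2 \<Psi>2"
    and \<gamma> [simp]: "lin V1 V2 \<gamma>"
    and comm: "\<And>t. t \<in> carr (V1 \<otimes> H) \<Longrightarrow> \<Psi>2 (tmap V1 H V2 H \<gamma> id t) = tmap H V1 H V2 id \<gamma> (\<Psi>1 t)"
    and t: "t \<in> carr (U \<otimes> V1)"
  shows "\<psi>2 (tmap U V1 U V2 id \<gamma> t) = tmap V1 U V2 U \<gamma> id (\<psi>1 t)"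
proof -
  interpret P: dual_maps U H V1 p \<psi>1 \<Psi>1 by fact
  interpret Q: dual_maps U H V2 p \<psi>2 \<Psi>2 by fact
  note [simp] = lin_carr[OF \<gamma>]
  show ?thesis using t P.vs(1,3)
  proof (induction rule: tensor_induct)
    case [simp]: (tens u v)
    have "\<psi>2 (tens U V2 u (\<gamma> v)) = tmap V1 U V2 U \<gamma> id (\<psi>1 (tens U V1 u v))"
    proof (rule Q.eqI)
      fix h assume h [simp]: "h \<in> carr H"
      have "\<Psi>2 (tens V2 H (\<gamma> v) h) = tmap H V1 H V2 id \<gamma> (\<Psi>1 (tens V1 H v h))"
        using comm[of "tens V1 H v h"] by simp
      then show "cR V2 U (\<lambda>u. p u h) (\<psi>2 (tens U V2 u (\<gamma> v)))
        = cR V2 U (\<lambda>u. p u h) (tmap V1 U V2 U \<gamma> id (\<psi>1 (tens U V1 u v)))"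
        by (simp add: Q.dualD cL_tmap cR_tmap flip: P.dualD)
    qed simp_all
    moreover have "tmap U V1 U V2 id \<gamma> (tens U V1 u v) = tens U V2 u (\<gamma> v)" by simp
    ultimately show ?case by (simp only:)
  qed simp_all
qed

lemma cL_functional_add:
  assumes "vs X" "vs Y" "lin X Kvec \<phi>" "lin X Kvec \<phi>'" "lin X Kvec \<chi>" "t \<in> carr (X \<otimes> Y)"
    and "\<And>x. x \<in> carr X \<Longrightarrow> \<chi> x = \<phi> x + \<phi>' x"
  shows "cL X Y \<chi> t = cL X Y \<phi> t + cL X Y \<phi>' t"
  using assms(6,1,2) by (induction rule: tensor_induct) (use assms in \<open>simp_all add: vs_scl\<close>)

lemma cR_functional_add:
  assumes "vs X" "vs Y" "lin Y Kvec \<phi>" "lin Y Kvec \<phi>'" "lin Y Kvec \<chi>" "t \<in> carr (X \<otimes> Y)"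
    and "\<And>y. y \<in> carr Y \<Longrightarrow> \<chi> y = \<phi> y + \<phi>' y"
  shows "cR X Y \<chi> t = cR X Y \<phi> t + cR X Y \<phi>' t"
  using assms(6,1,2) by (induction rule: tensor_induct) (use assms in \<open>simp_all add: vs_scl\<close>)

context dual_maps
begin

sublocale pp: two_pairings U U H H p p
  by unfold_locales (simp_all add: p)

abbreviation pair where "pair \<equiv> pten U U H H p p"

text \<open>With \<open>T u h\<close> the operator on \<open>V\<close> that both sides of \<open>transposed\<close> define, each side here applies
  first \<open>T g a\<close> and then \<open>T f b\<close> to \<open>v\<close>, if \<open>u = f \<otimes> g\<close> and \<open>w = a \<otimes> b\<close>: on the left, \<open>g\<close> is adjacent
  to \<open>V\<close> and passes first, on the right \<open>a\<close> is. So the inner factors \<open>g\<close> and \<open>a\<close> are paired with each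
  other, which is what the nested pairing does.\<close>

lemma dual_maps_square: "dual_maps (U \<otimes> U) (H \<otimes> H) V pair (extL U V \<psi>) (extR V H \<Psi>)"
proof
  show "separated (U \<otimes> U) (H \<otimes> H) pair" by (intro pp.separated_pten sep)
  show "bilin (U \<otimes> U) (H \<otimes> H) Kvec pair" by (rule pp.bilin_pten)
  have cR2: "cR V (U \<otimes> U) (\<lambda>t. pair t (tens H H a b)) (fstT U V U \<psi> (tens U (V \<otimes> U) f s))
      = cL H V (p f) (\<Psi> (tens V H (cR V U (\<lambda>u. p u a) s) b))"
    if [simp]: "f \<in> carr U" "a \<in> carr H" "b \<in> carr H" and s: "s \<in> carr (V \<otimes> U)" for f a b s
    using s vs(3,1)
  proof (induction rule: tensor_induct)
    case [simp]: (tens v g)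
    have 1: "cR V (U \<otimes> U) (\<lambda>t. pair t (tens H H a b)) (assocR V U U (tens (V \<otimes> U) U z g))
        = scl V (p g a) (cR V U (\<lambda>u. p u b) z)" if "z \<in> carr (V \<otimes> U)" for z
      using that vs(3,1)
      by (induction rule: tensor_induct) (simp_all add: vs_scl mult.commute)
    have "tens V H (scl V (p g a) v) b = pw (p g a) (tens V H v b)" by (simp add: tens_scl_left)
    then show ?case by (simp add: 1 dualD \<Psi>_scl)
  qed simp_all
  have cL2: "cL (H \<otimes> H) V (pair (tens U U f g)) (assocL H H V (sndT H V H \<Psi> (assocR H V H (tens (H \<otimes> V) H s b))))
      = cL H V (p f) (\<Psi> (tens V H (cL H V (p g) s) b))"
    if [simp]: "f \<in> carr U" "g \<in> carr U" "b \<in> carr H" and s: "s \<in> carr (H \<otimes> V)" for f g b s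
    using s vs(2,3)
  proof (induction rule: tensor_induct)
    case [simp]: (tens a v)
    have 1: "cL (H \<otimes> H) V (pair (tens U U f g)) (assocL H H V (tens H (H \<otimes> V) a z))
        = scl V (p g a) (cL H V (p f) z)" if "z \<in> carr (H \<otimes> V)" for z
      using that vs(2,3)
      by (induction rule: tensor_induct) (simp_all add: vs_scl mult.commute)
    have "tens V H (scl V (p g a) v) b = pw (p g a) (tens V H v b)" by (simp add: tens_scl_left)
    then show ?case by (simp add: 1 \<Psi>_scl)
  qed simp_all
  show "transposed pair (U \<otimes> U) (H \<otimes> H) V (extL U V \<psi>) (extR V H \<Psi>)"
    unfolding transposed_def
  proof (intro ballI)
    fix u v w assume u: "u \<in> carr (U \<otimes> U)" and v [simp]: "v \<in> carr V" and w: "w \<in> carr (H \<otimes> H)"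
    show "cR V (U \<otimes> U) (\<lambda>u. pair u w) (extL U V \<psi> (tens (U \<otimes> U) V u v))
        = cL (H \<otimes> H) V (pair u) (extR V H \<Psi> (tens V (H \<otimes> H) v w))"
      using u vs(1,1)
    proof (induction rule: tensor_induct)
      case [simp]: (tens f g)
      show ?case using w vs(2,2)
      proof (induction rule: tensor_induct)
        case [simp]: (tens a b)
        show ?case by (simp add: extL_tens extR_tens cR2 cL2 dualD)
      next
        case (add s t)
        then have "cR V (U \<otimes> U) (\<lambda>u. pair u (s + t)) z
            = cR V (U \<otimes> U) (\<lambda>u. pair u s) z + cR V (U \<otimes> U) (\<lambda>u. pair u t) z" if "z \<in> carr (V \<otimes> (U \<otimes> U))" for z
          using that by (intro cR_functional_add) simp_all
        with add show ?case by simp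
      qed
    next
      case (add s t)
      then have "cL (H \<otimes> H) V (pair (s + t)) z = cL (H \<otimes> H) V (pair s) z + cL (H \<otimes> H) V (pair t) z"
        if "z \<in> carr ((H \<otimes> H) \<otimes> V)" for z
        using that by (intro cL_functional_add) simp_all
      with add w show ?case by simp
    qed
  qed
qed simp_all

text \<open>Both sides contract the factor \<open>U\<close> of \<open>\<psi> (u \<otimes> v)\<close> with the factor \<open>H\<close> of \<open>\<Psi> (w \<otimes> a)\<close>. Using
  \<open>transposed\<close> for the second factor of \<open>V \<otimes> V\<close> brings the left side into this form, using it for
  the first factor the right side.\<close>

lemma dual_maps_undualized_square: "dual_maps U H (V \<otimes> V) p (extR U V \<psi>) (extL V H \<Psi>)"
proof
  \<comment> \<open>\<open>c r s\<close> contracts the factor \<open>U\<close> of \<open>s\<close> with the factor \<open>H\<close> of \<open>r\<close>.\<close>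
  define c where "c r s = tlift V U (V \<otimes> V) (\<lambda>v u. tens V V v (cL H V (p u) r)) s" for r s
  have bil: "bilin V U (V \<otimes> V) (\<lambda>v u. tens V V v (cL H V (p u) r))" if r: "r \<in> carr (H \<otimes> V)" for r
  proof (intro bilinI linI)
    fix v u u' k assume [simp]: "v \<in> carr V" "u \<in> carr U"
    have "cL H V (p (scl U k u)) r = scl V k (cL H V (p u) r)"
      using r vs(2,3) by (induction rule: tensor_induct)
        (simp_all add: vs_carr vs_scl bilin_scl_left[OF p])
    then show "tens V V v (cL H V (p (scl U k u)) r) = scl (V \<otimes> V) k (tens V V v (cL H V (p u) r))"
      using r by (simp add: tens_scl_right)
    assume [simp]: "u' \<in> carr U"
    have "cL H V (p (u + u')) r = cL H V (p u) r + cL H V (p u') r"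
      using r by (intro cL_functional_add) (simp_all add: vs_carr bilin_add_left[OF p])
    then show "tens V V v (cL H V (p (u + u')) r) = tens V V v (cL H V (p u) r) + tens V V v (cL H V (p u') r)"
      using r by simp
  qed (use r in \<open>simp_all add: tens_scl_left\<close>)
  note c_tens = tlift_tens[OF vs_tensor bil, folded c_def] and c_add = tlift_add[OF vs_tensor bil, folded c_def]
  have c1: "cR (V \<otimes> V) U (\<lambda>u. p u a) (assocL V V U (sndT V U V \<psi> (assocR V U V (tens (V \<otimes> U) V s w))))
      = c (\<Psi> (tens V H w a)) s"
    if [simp]: "a \<in> carr H" "w \<in> carr V" and s: "s \<in> carr (V \<otimes> U)" for a w s
    using s vs(3,1)
  proof (induction rule: tensor_induct)
    case [simp]: (tens v u)
    have "cR (V \<otimes> V) U (\<lambda>u. p u a) (assocL V V U (tens V (V \<otimes> U) v z)) = tens V V v (cR V U (\<lambda>u. p u a) z)"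
      if "z \<in> carr (V \<otimes> U)" for z
      using that vs(3,1)
      by (induction rule: tensor_induct) (simp_all add: tens_scl_right)
    then show ?case by (simp add: c_tens dualD)
  qed (simp_all add: c_add)
  have c2: "c r (\<psi> (tens U V u v)) = cL H (V \<otimes> V) (p u) (fstT V H V \<Psi> (tens V (H \<otimes> V) v r))"
    if [simp]: "u \<in> carr U" "v \<in> carr V" and r: "r \<in> carr (H \<otimes> V)" for u v r
    using r vs(2,3)
  proof (induction rule: tensor_induct)
    case [simp]: (tens a w)
    have "c (tens H V a w) s = tens V V (cR V U (\<lambda>u. p u a) s) w" if "s \<in> carr (V \<otimes> U)" for s
      using that vs(3,1)
      by (induction rule: tensor_induct) (simp_all add: c_tens c_add tens_scl_left tens_scl_right)
    moreover have "cL H (V \<otimes> V) (p u) (assocR H V V (tens (H \<otimes> V) V z w)) = tens V V (cL H V (p u) z) w"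
      if "z \<in> carr (H \<otimes> V)" for z
      using that vs(2,3)
      by (induction rule: tensor_induct) (simp_all add: tens_scl_left)
    ultimately show ?case by (simp add: dualD)
  next
    case (add r r')
    have "c (r + r') s = c r s + c r' s" if "s \<in> carr (V \<otimes> U)" for s
      using that vs(3,1)
      by (induction rule: tensor_induct) (use add.hyps in \<open>simp_all add: c_tens c_add\<close>)
    with add show ?case by simp
  qed
  show "transposed p U H (V \<otimes> V) (extR U V \<psi>) (extL V H \<Psi>)"
    unfolding transposed_def
  proof (intro ballI)
    fix u t a assume [simp]: "u \<in> carr U" "a \<in> carr H" and t: "t \<in> carr (V \<otimes> V)"
    show "cR (V \<otimes> V) U (\<lambda>u. p u a) (extR U V \<psi> (tens U (V \<otimes> V) u t))
        = cL H (V \<otimes> V) (p u) (extL V H \<Psi> (tens (V \<otimes> V) H t a))"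
      using t vs(3,3)
      by (induction rule: tensor_induct) (simp_all add: extR_tens extL_tens c1 c2)
  qed
qed (simp_all add: p sep)

end

section \<open>Structures transported by duality\<close>

text \<open>The transpose of a braiding is a braiding. For nested pairings of threefold tensor products
  the transpose of \<open>id \<otimes> b\<close> is \<open>B \<otimes> id\<close> and vice versa, so the two sides of the hexagon for \<open>b\<close>
  are the transposes of those for \<open>B\<close>.\<close>

lemma hexL_transpose:
  fixes U :: "('k::field, 'u::ab_group_add) vecsp" and H :: "('k, 'h::ab_group_add) vecsp"
  assumes vs [simp]: "vs U" "vs H" and p: "bilin U H Kvec p" and sep: "separated U H p"
    and b [simp]: "lin (U \<otimes> U) (U \<otimes> U) b" and B [simp]: "lin (H \<otimes> H) (H \<otimes> H) B"
    and tr: "\<And>t w. t \<in> carr (U \<otimes> U) \<Longrightarrow> w \<in> carr (H \<otimes> H) \<Longrightarrow>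
      pten U U H H p p (b t) w = pten U U H H p p t (B w)"
    and hex: "hexL H B H B"
  shows "hexL U b U b"
proof -
  define pair where "pair = pten U U H H p p"
  define T1 where "T1 = pten U (U \<otimes> U) (H \<otimes> H) H p pair"
  define T2 where "T2 = pten (U \<otimes> U) U H (H \<otimes> H) pair p"
  interpret P: two_pairings U U H H p p by unfold_locales (simp_all add: p)
  interpret T1: two_pairings U "U \<otimes> U" "H \<otimes> H" H p pair
    by unfold_locales (simp_all add: p pair_def P.bilin_pten)
  interpret T2: two_pairings "U \<otimes> U" U H "H \<otimes> H" pair p
    by unfold_locales (simp_all add: p pair_def P.bilin_pten)
  have pair_tens [simp]: "pair (tens U U f g) (tens H H a b) = p f b * p g a"
    if "f \<in> carr U" "g \<in> carr U" "a \<in> carr H" "b \<in> carr H" for f g a b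
    using that by (simp add: pair_def)
  have sepT: "separated (U \<otimes> (U \<otimes> U)) ((H \<otimes> H) \<otimes> H) T1"
    unfolding T1_def by (rule T1.separated_pten[OF sep]) (simp add: pair_def P.separated_pten sep)
  have assoc: "T1 (assocR U U U t) w = T2 t (assocR H H H w)"
    if t: "t \<in> carr ((U \<otimes> U) \<otimes> U)" and w: "w \<in> carr ((H \<otimes> H) \<otimes> H)" for t w
    using t vs(1,1,1)
  proof (induction rule: tensor3_inductL)
    case (tens x y z)
    show ?case using w vs(2,2,2)
      by (induction rule: tensor3_inductL) (use tens in \<open>simp_all add: T1_def T2_def mult.assoc mult.commute\<close>)
  qed (use w in \<open>simp_all add: T1_def T2_def\<close>)
  have assoc': "T2 (assocL U U U t) w = T1 t (assocL H H H w)"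
    if "t \<in> carr (U \<otimes> (U \<otimes> U))" and "w \<in> carr (H \<otimes> (H \<otimes> H))" for t w
    using assoc[of "assocL U U U t" "assocL H H H w"] that by simp
  have snd: "T1 (tmap U (U \<otimes> U) U (U \<otimes> U) id b t) w = T1 t (tmap (H \<otimes> H) H (H \<otimes> H) H B id w)"
    if "t \<in> carr (U \<otimes> (U \<otimes> U))" "w \<in> carr ((H \<otimes> H) \<otimes> H)" for t w
    unfolding T1_def
    by (rule pten_tmap[OF T1.two_pairings_axioms T1.two_pairings_axioms]) (use that tr in \<open>simp_all add: pair_def\<close>)
  have fst: "T2 (tmap (U \<otimes> U) U (U \<otimes> U) U b id t) w = T2 t (tmap H (H \<otimes> H) H (H \<otimes> H) id B w)"
    if "t \<in> carr ((U \<otimes> U) \<otimes> U)" "w \<in> carr (H \<otimes> (H \<otimes> H))" for t w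
    unfolding T2_def
    by (rule pten_tmap[OF T2.two_pairings_axioms T2.two_pairings_axioms]) (use that tr in \<open>simp_all add: pair_def\<close>)
  have ext: "T1 (extL U U b t) w = T2 t (extL H H B w)"
    if "t \<in> carr ((U \<otimes> U) \<otimes> U)" "w \<in> carr ((H \<otimes> H) \<otimes> H)" for t w
    using that by (simp add: extL_def fstT_def sndT_def assoc assoc' snd fst)
  show ?thesis
    unfolding hexL_def
  proof
    fix t assume t [simp]: "t \<in> carr ((U \<otimes> U) \<otimes> U)"
    show "extL U U b (tmap (U \<otimes> U) U (U \<otimes> U) U b id t) = tmap U (U \<otimes> U) U (U \<otimes> U) id b (extL U U b t)"
    proof (rule separated_eqI[OF vs_tensor _ sepT])
      show "bilin (U \<otimes> (U \<otimes> U)) ((H \<otimes> H) \<otimes> H) Kvec T1" unfolding T1_def by (rule T1.bilin_pten)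
      fix w assume w [simp]: "w \<in> carr ((H \<otimes> H) \<otimes> H)"
      show "T1 (extL U U b (tmap (U \<otimes> U) U (U \<otimes> U) U b id t)) w
          = T1 (tmap U (U \<otimes> U) U (U \<otimes> U) id b (extL U U b t)) w"
        using hex by (simp add: ext snd fst hexL_def)
    qed simp_all
  qed
qed

locale dual_braiding = dual_maps +
  fixes B b
  assumes B [simp]: "lin (H \<otimes> H) (H \<otimes> H) B" and b [simp]: "lin (U \<otimes> U) (U \<otimes> U) b"
    and transpose: "\<And>t w. t \<in> carr (U \<otimes> U) \<Longrightarrow> w \<in> carr (H \<otimes> H) \<Longrightarrow> pair (b t) w = pair t (B w)"
    and hex: "hexR H B V \<Psi>"
begin

lemma hexR_id: "t \<in> carr (V \<otimes> (H \<otimes> H)) \<Longrightarrow>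
    extR V H \<Psi> (tmap V (H \<otimes> H) V (H \<otimes> H) id B t) = tmap (H \<otimes> H) V (H \<otimes> H) V B id (extR V H \<Psi> t)"
  using hex by (simp add: hexR_def)

lemma hexL_dual: "hexL U b V \<psi>"
  unfolding hexL_def
proof
  fix t assume "t \<in> carr ((U \<otimes> U) \<otimes> V)"
  then show "extL U V \<psi> (tmap (U \<otimes> U) V (U \<otimes> U) V b id t) = tmap V (U \<otimes> U) V (U \<otimes> U) id b (extL U V \<psi> t)"
    by (intro dual_maps_natural[OF dual_maps_square dual_maps_square b B]) (simp_all add: transpose hexR_id)
qed

text \<open>The product \<open>\<mu>\<close> is the transpose of \<open>\<beta> = B \<Delta>\<close>, and the hexagon extends naturality from \<open>\<Delta>\<close>
  to \<open>\<beta>\<close>. A unit \<open>u\<close> of \<open>\<mu>\<close> acts as \<open>\<epsilon>\<close>: multiplication by \<open>u\<close> from the left is the transpose of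
  \<open>a \<mapsto> (id \<otimes> u) (\<beta> a)\<close>, which is the identity because \<open>U\<close> separates the points of \<open>H\<close>; applying \<open>\<epsilon>\<close>
  to it gives \<open>\<epsilon> a = u ((\<epsilon> \<otimes> id) (\<beta> a)) = u a\<close>.\<close>

lemma mult_compatL_dual:
  assumes \<Delta> [simp]: "lin H (H \<otimes> H) \<Delta>" and \<epsilon> [simp]: "lin H Kvec \<epsilon>"
    and comult: "comult_compatR V H \<Delta> \<epsilon> \<Psi>"
    and \<mu> [simp]: "lin (U \<otimes> U) U \<mu>"
    and mult: "\<And>t a. t \<in> carr (U \<otimes> U) \<Longrightarrow> a \<in> carr H \<Longrightarrow> p (\<mu> t) a = pair t (B (\<Delta> a))"
    and counit: "\<And>a. a \<in> carr H \<Longrightarrow> cL H H \<epsilon> (B (\<Delta> a)) = a"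
    and nondeg: "\<And>a a'. a \<in> carr H \<Longrightarrow> a' \<in> carr H \<Longrightarrow> (\<And>u. u \<in> carr U \<Longrightarrow> p u a = p u a') \<Longrightarrow> a = a'"
  shows "mult_compatL U V \<mu> \<psi>"
  unfolding mult_compatL_iff[OF vs(1,3) \<psi>]
proof (intro conjI ballI allI impI)
  note [simp] = lin_carr[OF \<Delta>] lin_carr[OF B]
  have B\<Delta> [simp]: "lin H (H \<otimes> H) (\<lambda>a. B (\<Delta> a))" by (rule lin_comp[OF \<Delta> B])
  fix t assume t: "t \<in> carr ((U \<otimes> U) \<otimes> V)"
  show "\<psi> (tmap (U \<otimes> U) V U V \<mu> id t) = tmap V (U \<otimes> U) V U id \<mu> (extL U V \<psi> t)"
  proof (rule dual_maps_natural[OF dual_maps_square dual_maps_axioms \<mu> B\<Delta> _ _ t])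
    show "p (\<mu> f) a = pair f (B (\<Delta> a))" if "f \<in> carr (U \<otimes> U)" "a \<in> carr H" for f a
      using that by (rule mult)
    fix s assume s [simp]: "s \<in> carr (V \<otimes> H)"
    have "tmap H V (H \<otimes> H) V (\<lambda>a. B (\<Delta> a)) id (\<Psi> s) = tmap (H \<otimes> H) V (H \<otimes> H) V B id (tmap H V (H \<otimes> H) V \<Delta> id (\<Psi> s))"
      by (simp add: tmap_tmap id_def)
    also have "\<dots> = extR V H \<Psi> (tmap V (H \<otimes> H) V (H \<otimes> H) id B (tmap V H V (H \<otimes> H) id \<Delta> s))"
      using comult by (simp add: comult_compatR_iff hexR_id)
    also have "tmap V (H \<otimes> H) V (H \<otimes> H) id B (tmap V H V (H \<otimes> H) id \<Delta> s) = tmap V H V (H \<otimes> H) id (\<lambda>a. B (\<Delta> a)) s"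
      by (simp add: tmap_tmap id_def)
    finally show "tmap H V (H \<otimes> H) V (\<lambda>a. B (\<Delta> a)) id (\<Psi> s) = extR V H \<Psi> (tmap V H V (H \<otimes> H) id (\<lambda>a. B (\<Delta> a)) s)" .
  qed
next
  note [simp] = lin_carr[OF \<Delta>] lin_carr[OF B]
  fix u v assume "is_unit_of U \<mu> u" and v [simp]: "v \<in> carr V"
  then have u [simp]: "u \<in> carr U" and unit: "\<And>f. f \<in> carr U \<Longrightarrow> \<mu> (tens U U u f) = f"
    by (auto simp: is_unit_of_def)
  have pu: "p u a = \<epsilon> a" if a [simp]: "a \<in> carr H" for a
  proof -
    have pair: "pair (tens U U u f) w = p f (cR H H (p u) w)" if f: "f \<in> carr U" and w: "w \<in> carr (H \<otimes> H)" for f w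
      using w vs(2,2)
      by (induction rule: tensor_induct) (use f in \<open>simp_all add: bilin_add_right[OF p] bilin_scl_right[OF p]\<close>)
    have "cR H H (p u) (B (\<Delta> a)) = a"
    proof (rule nondeg)
      fix f assume f: "f \<in> carr U"
      then have "p f a = pair (tens U U u f) (B (\<Delta> a))"
        using mult[of "tens U U u f" a] by (simp add: unit)
      then show "p f (cR H H (p u) (B (\<Delta> a))) = p f a" using f by (simp add: pair)
    qed simp_all
    then have "\<epsilon> a = \<epsilon> (cR H H (p u) (B (\<Delta> a)))" by simp
    also have "\<dots> = p u (cL H H \<epsilon> (B (\<Delta> a)))" by (simp add: contractions_commute)
    finally show ?thesis by (simp add: counit)
  qed
  show "\<psi> (tens U V u v) = tens V U v u"
  proof (rule eqI)
    fix a assume a [simp]: "a \<in> carr H"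
    have "cL H V (p u) (\<Psi> (tens V H v a)) = cL H V \<epsilon> (\<Psi> (tens V H v a))"
      by (rule cL_cong) (simp_all add: pu)
    also have "\<dots> = cR V H \<epsilon> (tens V H v a)"
      using comult by (simp add: comult_compatR_iff)
    finally show "cR V U (\<lambda>u. p u a) (\<psi> (tens U V u v)) = cR V U (\<lambda>u. p u a) (tens V U v u)"
      by (simp add: dualD pu)
  qed simp_all
qed

text \<open>The coproduct \<open>\<delta>\<close> is the transpose of \<open>m B\<close>; as before, the hexagon extends naturality from \<open>m\<close>
  to \<open>m B\<close>.\<close>

lemma comult_compatL_dual:
  assumes m [simp]: "lin (H \<otimes> H) H m" and unit: "is_unit_of H m e"
    and mult: "mult_compatR V H m \<Psi>"
    and \<delta> [simp]: "lin U (U \<otimes> U) \<delta>"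
    and comult: "\<And>u w. u \<in> carr U \<Longrightarrow> w \<in> carr (H \<otimes> H) \<Longrightarrow> pair (\<delta> u) w = p u (m (B w))"
  shows "comult_compatL U V \<delta> (\<lambda>u. p u e) \<psi>"
  unfolding comult_compatL_iff[OF vs(1,3) \<psi>]
proof (intro conjI ballI)
  note [simp] = lin_carr[OF m] lin_carr[OF B]
  have mB [simp]: "lin (H \<otimes> H) H (\<lambda>w. m (B w))" by (rule lin_comp[OF B m])
  have e [simp]: "e \<in> carr H" using unit by (simp add: is_unit_of_def)
  fix t assume t: "t \<in> carr (U \<otimes> V)"
  show "tmap V U V (U \<otimes> U) id \<delta> (\<psi> t) = extL U V \<psi> (tmap U V (U \<otimes> U) V \<delta> id t)"
  proof (rule dual_maps_natural[OF dual_maps_axioms dual_maps_square \<delta> mB _ _ t, symmetric])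
    show "pair (\<delta> f) w = p f (m (B w))" if "f \<in> carr U" "w \<in> carr (H \<otimes> H)" for f w
      using that by (rule comult)
    fix s assume s [simp]: "s \<in> carr (V \<otimes> (H \<otimes> H))"
    have "tmap (H \<otimes> H) V H V (\<lambda>w. m (B w)) id (extR V H \<Psi> s)
        = tmap (H \<otimes> H) V H V m id (tmap (H \<otimes> H) V (H \<otimes> H) V B id (extR V H \<Psi> s))"
      by (simp add: tmap_tmap id_def)
    also have "\<dots> = \<Psi> (tmap V (H \<otimes> H) V H id m (tmap V (H \<otimes> H) V (H \<otimes> H) id B s))"
      using mult by (simp add: mult_compatR_iff hexR_id)
    also have "tmap V (H \<otimes> H) V H id m (tmap V (H \<otimes> H) V (H \<otimes> H) id B s) = tmap V (H \<otimes> H) V H id (\<lambda>w. m (B w)) s"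
      by (simp add: tmap_tmap id_def)
    finally show "tmap (H \<otimes> H) V H V (\<lambda>w. m (B w)) id (extR V H \<Psi> s) = \<Psi> (tmap V (H \<otimes> H) V H id (\<lambda>w. m (B w)) s)" .
  qed
  show "cR V U (\<lambda>u. p u e) (\<psi> t) = cL U V (\<lambda>u. p u e) t"
    using t vs(1,3)
  proof (induction rule: tensor_induct)
    case (tens f v)
    have "\<Psi> (tens V H v e) = tens H V e v" using mult unit tens by (simp add: mult_compatR_iff)
    with tens show ?case by (simp add: dualD)
  qed simp_all
qed

end

text \<open>The product and the coproduct of \<open>V\<close> are maps out of and into the undualized square, so naturality
  in \<open>V\<close> applies to them. The counit is compared after pairing with \<open>a\<close> in \<open>H\<close>, as contractions of
  different factors commute.\<close>

context dual_maps
begin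

lemma mult_compatR_dual:
  assumes m [simp]: "lin (V \<otimes> V) V m" and mult: "mult_compatL V H m \<Psi>"
  shows "mult_compatR U V m \<psi>"
  unfolding mult_compatR_iff[OF vs(1,3) \<psi>]
proof (intro conjI ballI allI impI)
  fix t assume t: "t \<in> carr (U \<otimes> (V \<otimes> V))"
  show "\<psi> (tmap U (V \<otimes> V) U V id m t) = tmap (V \<otimes> V) U V U m id (extR U V \<psi> t)"
    by (rule dual_maps_natural_undualized[OF dual_maps_undualized_square dual_maps_axioms m _ t])
      (use mult in \<open>simp add: mult_compatL_iff\<close>)
next
  fix e f assume e: "is_unit_of V m e" and f [simp]: "f \<in> carr U"
  then have [simp]: "e \<in> carr V" by (simp add: is_unit_of_def)
  show "\<psi> (tens U V f e) = tens V U e f"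
  proof (rule eqI)
    fix a assume [simp]: "a \<in> carr H"
    have "\<Psi> (tens V H e a) = tens H V a e" using mult e by (simp add: mult_compatL_iff)
    then show "cR V U (\<lambda>u. p u a) (\<psi> (tens U V f e)) = cR V U (\<lambda>u. p u a) (tens V U e f)"
      by (simp add: dualD)
  qed simp_all
qed

lemma comult_compatR_dual:
  assumes \<Delta> [simp]: "lin V (V \<otimes> V) \<Delta>" and \<epsilon> [simp]: "lin V Kvec \<epsilon>" and comult: "comult_compatL V H \<Delta> \<epsilon> \<Psi>"
  shows "comult_compatR U V \<Delta> \<epsilon> \<psi>"
  unfolding comult_compatR_iff[OF vs(1,3) \<psi> \<Delta>]
proof (intro conjI ballI)
  fix t assume t: "t \<in> carr (U \<otimes> V)"
  show "tmap V U (V \<otimes> V) U \<Delta> id (\<psi> t) = extR U V \<psi> (tmap U V U (V \<otimes> V) id \<Delta> t)"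
    by (rule dual_maps_natural_undualized[OF dual_maps_axioms dual_maps_undualized_square \<Delta> _ t, symmetric])
      (use comult in \<open>simp add: comult_compatL_iff\<close>)
  show "cL V U \<epsilon> (\<psi> t) = cR U V \<epsilon> t"
    using t vs(1,3)
  proof (induction rule: tensor_induct)
    case [simp]: (tens f v)
    show ?case
    proof (rule separated_eqI[OF vs(1) p sep])
      fix a assume [simp]: "a \<in> carr H"
      have "p (cL V U \<epsilon> (\<psi> (tens U V f v))) a = \<epsilon> (cR V U (\<lambda>u. p u a) (\<psi> (tens U V f v)))"
        using contractions_commute[of V U \<epsilon> "\<lambda>u. p u a" "\<psi> (tens U V f v)"] by simp
      also have "\<dots> = p f (cR H V \<epsilon> (\<Psi> (tens V H v a)))"
        by (simp add: dualD contractions_commute)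
      also have "cR H V \<epsilon> (\<Psi> (tens V H v a)) = cL V H \<epsilon> (tens V H v a)"
        using comult by (simp add: comult_compatL_iff)
      finally show "p (cL V U \<epsilon> (\<psi> (tens U V f v))) a = p (cR U V \<epsilon> (tens U V f v)) a"
        by (simp add: bilin_scl_left[OF p] bilin_scl_right[OF p])
    qed (simp_all add: vs_carr)
  qed simp_all
qed

end

section \<open>Maps with values in a dual space\<close>

lemma pw_apply: "pw c f x = c * f x"
  by (simp add: pw_def)

lemma scl_dual [simp]: "scl (dual X) = pw"
  by (simp add: dual_def)

lemmas tens_pw_dual [simp] = tens_scl_left[where X = "dual X" for X, unfolded scl_dual]
  tens_scl_right[where Y = "dual X" for X, unfolded scl_dual]

lemma dualD: "e \<in> carr (dual X) \<Longrightarrow> lin X Kvec e"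
  by (simp add: dual_def)

lemma bilin_eval: "bilin (dual X) X Kvec (\<lambda>e x. e x)"
  by (intro bilinI linI) (simp_all add: dual_def lin_def pw_def plus_fun_apply)

lemma dual_zeroI:
  fixes X :: "('k::field, 'a::ab_group_add) vecsp"
  assumes X: "vs X" and x: "x \<in> carr X" and zero: "\<And>e. e \<in> carr (dual X) \<Longrightarrow> e x = 0"
  shows "x = 0"
proof (rule ccontr)
  assume "x \<noteq> 0"
  then obtain \<phi> where \<phi>: "Vector_Spaces.linear (scl X) (*) \<phi>" "\<phi> x \<noteq> 0"
    using functionals_separate[of "scl X" x] X by (auto simp: vs_def)
  interpret \<phi>: Vector_Spaces.linear "scl X" "(*)" \<phi> by fact
  have "(\<lambda>y. if y \<in> carr X then \<phi> y else 0) \<in> carr (dual X)"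
    using X by (auto simp: dual_def lin_def vs_carr \<phi>.add \<phi>.scale)
  from zero[OF this] \<phi>(2) x show False by simp
qed

lemma dual_eqI:
  assumes "vs X" "x \<in> carr X" "y \<in> carr X" "\<And>e. e \<in> carr (dual X) \<Longrightarrow> e x = e y"
  shows "x = y"
proof -
  have "x - y = 0"
    using assms by (intro dual_zeroI[of X]) (auto simp: vs_diff lin_diff[OF _ dualD])
  then show ?thesis by simp
qed

lemma tlift_outside: "vs Z \<Longrightarrow> bilin X Y Z b \<Longrightarrow> t \<notin> carr (X \<otimes> Y) \<Longrightarrow> tlift X Y Z b t = 0"
  using theI'[OF tensor_universal[of Z X Y b]] unfolding tlift_def by blast

lemma tlift_cong:
  assumes "\<And>x y. x \<in> carr X \<Longrightarrow> y \<in> carr Y \<Longrightarrow> b x y = b' x y"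
  shows "tlift X Y Z b = tlift X Y Z b'"
proof -
  have "(\<forall>x\<in>carr X. \<forall>y\<in>carr Y. F (tens X Y x y) = b x y) \<longleftrightarrow> (\<forall>x\<in>carr X. \<forall>y\<in>carr Y. F (tens X Y x y) = b' x y)" for F
    using assms by auto
  then show ?thesis by (simp add: tlift_def)
qed

text \<open>A four-fold linear form, curried in pairs. The embeddings of tensor products into duals and
  the dual-valued braidings are all of this form.\<close>

locale quadrilinear =
  fixes A :: "('k::field, 'a::ab_group_add) vecsp" and B :: "('k, 'b::ab_group_add) vecsp"
    and X :: "('k, 'x::ab_group_add) vecsp" and Y :: "('k, 'y::ab_group_add) vecsp" and \<beta>
  assumes vs [simp]: "vs A" "vs B" "vs X" "vs Y"
    and left: "\<And>x y. x \<in> carr X \<Longrightarrow> y \<in> carr Y \<Longrightarrow> bilin A B Kvec (\<lambda>a b. \<beta> a b x y)"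
    and right: "\<And>a b. a \<in> carr A \<Longrightarrow> b \<in> carr B \<Longrightarrow> bilin X Y Kvec (\<beta> a b)"
begin

definition "form = tlift A B (dual (X \<otimes> Y)) (\<lambda>a b. tlift X Y Kvec (\<beta> a b))"

lemma bilin_form: "bilin A B (dual (X \<otimes> Y)) (\<lambda>a b. tlift X Y Kvec (\<beta> a b))"
proof -
  have 1: "tlift X Y Kvec (\<beta> a b) \<in> carr (dual (X \<otimes> Y))" if "a \<in> carr A" "b \<in> carr B" for a b
    using that by (simp add: dual_def lin_tlift tlift_outside right)
  have 2: "tlift X Y Kvec \<gamma> = (\<lambda>t. tlift X Y Kvec \<gamma>' t + tlift X Y Kvec \<gamma>'' t)"
    if g: "bilin X Y Kvec \<gamma>" "bilin X Y Kvec \<gamma>'" "bilin X Y Kvec \<gamma>''"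
      "\<And>x y. x \<in> carr X \<Longrightarrow> y \<in> carr Y \<Longrightarrow> \<gamma> x y = \<gamma>' x y + \<gamma>'' x y" for \<gamma> \<gamma>' \<gamma>''
  proof
    fix t
    show "tlift X Y Kvec \<gamma> t = tlift X Y Kvec \<gamma>' t + tlift X Y Kvec \<gamma>'' t"
    proof (cases "t \<in> carr (X \<otimes> Y)")
      case True
      then show ?thesis using vs(3,4)
        by (induction rule: tensor_induct) (simp_all add: tlift_tens tlift_add g)
    qed (simp add: tlift_outside g)
  qed
  have 3: "tlift X Y Kvec \<gamma> = (\<lambda>t. c * tlift X Y Kvec \<gamma>' t)"
    if g: "bilin X Y Kvec \<gamma>" "bilin X Y Kvec \<gamma>'"
      "\<And>x y. x \<in> carr X \<Longrightarrow> y \<in> carr Y \<Longrightarrow> \<gamma> x y = c * \<gamma>' x y" for \<gamma> \<gamma>' c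
  proof
    fix t
    show "tlift X Y Kvec \<gamma> t = c * tlift X Y Kvec \<gamma>' t"
    proof (cases "t \<in> carr (X \<otimes> Y)")
      case True
      then show ?thesis using vs(3,4)
        by (induction rule: tensor_induct) (simp_all add: tlift_tens tlift_add g algebra_simps)
    qed (simp add: tlift_outside g)
  qed
  show ?thesis
  proof (intro bilinI linI)
    fix a b b' c assume [simp]: "a \<in> carr A" "b \<in> carr B"
    show "tlift X Y Kvec (\<beta> a b) \<in> carr (dual (X \<otimes> Y))" by (simp add: 1)
    show "tlift X Y Kvec (\<beta> a (scl B c b)) = scl (dual (X \<otimes> Y)) c (tlift X Y Kvec (\<beta> a b))"
      unfolding scl_dual pw_def
      by (rule 3) (simp_all add: right vs_carr bilin_scl_right[OF left])
    assume [simp]: "b' \<in> carr B"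
    show "tlift X Y Kvec (\<beta> a (b + b')) = tlift X Y Kvec (\<beta> a b) + tlift X Y Kvec (\<beta> a b')"
      unfolding plus_fun_def
      by (rule 2) (simp_all add: right vs_carr bilin_add_right[OF left])
  next
    fix a b a' c assume [simp]: "a \<in> carr A" "b \<in> carr B"
    show "tlift X Y Kvec (\<beta> a b) \<in> carr (dual (X \<otimes> Y))" by (simp add: 1)
    show "tlift X Y Kvec (\<beta> (scl A c a) b) = scl (dual (X \<otimes> Y)) c (tlift X Y Kvec (\<beta> a b))"
      unfolding scl_dual pw_def
      by (rule 3) (simp_all add: right vs_carr bilin_scl_left[OF left])
    assume [simp]: "a' \<in> carr A"
    show "tlift X Y Kvec (\<beta> (a + a') b) = tlift X Y Kvec (\<beta> a b) + tlift X Y Kvec (\<beta> a' b)"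
      unfolding plus_fun_def
      by (rule 2) (simp_all add: right vs_carr bilin_add_left[OF left])
  qed
qed

lemma lin_form: "lin (A \<otimes> B) (dual (X \<otimes> Y)) form"
  unfolding form_def by (intro lin_tlift bilin_form vs_dual) simp

lemma form_tens: "a \<in> carr A \<Longrightarrow> b \<in> carr B \<Longrightarrow> x \<in> carr X \<Longrightarrow> y \<in> carr Y \<Longrightarrow>
    form (tens A B a b) (tens X Y x y) = \<beta> a b x y"
  unfolding form_def by (simp add: tlift_tens[OF vs_dual bilin_form] tlift_tens[OF vs_Kvec right])

lemma form_add: "s \<in> carr (A \<otimes> B) \<Longrightarrow> t \<in> carr (A \<otimes> B) \<Longrightarrow> form (s + t) w = form s w + form t w"
  by (simp add: lin_add[OF lin_form] plus_fun_apply)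

end

text \<open>The passage from a dual-valued braiding \<open>G\<close> to a map into the tensor product itself.\<close>

lemma lin_bij_inv_embedding:
  assumes X: "vs X" and Y: "vs Y" and E: "lin Y Z E" "inj_on E (carr Y)" and G: "lin X Z G"
    and bij: "bij_betw G (carr X) (E ` carr Y)"
  shows "lin_bij X Y (\<lambda>t. inv_into (carr Y) E (G t))"
    and "\<And>t. t \<in> carr X \<Longrightarrow> E (inv_into (carr Y) E (G t)) = G t"
proof -
  let ?F = "\<lambda>t. inv_into (carr Y) E (G t)"
  have im: "G t \<in> E ` carr Y" if "t \<in> carr X" for t using that bij by (auto simp: bij_betw_def)
  show EF: "E (?F t) = G t" if "t \<in> carr X" for t using im[OF that] by (rule f_inv_into_f)
  have F: "?F t \<in> carr Y" if "t \<in> carr X" for t using im[OF that] by (rule inv_into_into)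
  have eq: "?F t = y" if "y \<in> carr Y" "G t = E y" for t y using that E(2) by simp
  have "lin X Y ?F"
  proof (intro linI F)
    fix s t c assume s: "s \<in> carr X"
    show "?F (scl X c s) = scl Y c (?F s)"
      using s F[OF s] by (intro eq) (simp_all add: vs_carr Y lin_scl[OF G] lin_scl[OF E(1)] EF)
    assume t: "t \<in> carr X"
    show "?F (s + t) = ?F s + ?F t"
      using s t F[OF s] F[OF t] by (intro eq) (simp_all add: vs_carr Y lin_add[OF G] lin_add[OF E(1)] EF)
  qed
  moreover have "bij_betw ?F (carr X) (carr Y)"
    using bij_betw_trans[OF bij bij_betw_inv_into[OF inj_on_imp_bij_betw[OF E(2)]]] by (simp add: comp_def)
  ultimately show "lin_bij X Y ?F" by (simp add: lin_bij_def)
qed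

text \<open>This makes the double-bracket pairing bilinear in the pair of functionals as well.\<close>

lemma dpair_eq_pten:
  assumes "two_pairings A B X Y (\<lambda>f y. f y) (\<lambda>f x. f x)" "\<xi> \<in> carr A" "\<eta> \<in> carr B" "w \<in> carr (X \<otimes> Y)"
  shows "dpair X Y \<xi> \<eta> w = pten A B X Y (\<lambda>f y. f y) (\<lambda>f x. f x) (tens A B \<xi> \<eta>) w"
proof -
  interpret two_pairings A B X Y "\<lambda>f y. f y" "\<lambda>f x. f x" by fact
  have b: "bilin X Y Kvec (\<lambda>x y. \<xi> y * \<eta> x)" using bilin_inner assms by blast
  show ?thesis using assms(4) vs(3,4)
    by (induction rule: tensor_induct)
      (use assms in \<open>simp_all add: dpair_def tlift_tens[OF vs_Kvec b] tlift_add[OF vs_Kvec b]\<close>)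
qed

section \<open>The dual braidings\<close>

locale dual_subspace =
  fixes H :: "('k::field, 'h::ab_group_add) vecsp" and U :: "('k, 'h \<Rightarrow> 'k) vecsp"
  assumes vsH [simp]: "vs H" and sub: "subsp U (dual H)"
begin

abbreviation (input) ev :: "('h \<Rightarrow> 'k) \<Rightarrow> 'h \<Rightarrow> 'k" where "ev \<equiv> \<lambda>f a. f a"

lemma scl_U [simp]: "scl U = pw" using sub by (simp add: subsp_def)

lemmas tens_pw_U [simp] = tens_scl_left[where X = U, unfolded scl_U] tens_scl_right[where Y = U, unfolded scl_U]

lemma U_dual: "f \<in> carr U \<Longrightarrow> f \<in> carr (dual H)"
  using sub unfolding subsp_def by blast

lemma vsU [simp]: "vs U"
  using sub by (simp add: subsp_def vs_def vector_space_pw)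

lemma bilin_ev: "bilin U H Kvec ev"
  using bilin_eval[of H] U_dual by (auto simp: bilin_def lin_def)

sublocale ev: two_pairings U U H H ev ev
  by unfold_locales (simp_all add: bilin_ev)

abbreviation (input) pair where "pair \<equiv> pten U U H H ev ev"

lemma separated_ev: "separated U H ev"
  unfolding separated_def
proof (intro ballI impI)
  fix f assume f: "f \<in> carr U" and z: "\<forall>a\<in>carr H. f a = 0"
  show "f = 0"
  proof
    fix a show "f a = 0 a" using z U_dual[OF f] by (cases "a \<in> carr H") (auto simp: dual_def zero_fun_apply)
  qed
qed

lemma pair_flip:
  assumes t: "t \<in> carr (U \<otimes> U)" and w: "w \<in> carr (H \<otimes> H)"
  shows "pair (flip U U t) w = pair t (flip H H w)"
  using t vsU vsU
proof (induction rule: tensor_induct)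
  case (tens f g)
  show ?case using w vsH vsH
    by (induction rule: tensor_induct) (use tens in simp_all)
qed (use w in simp_all)

lemma dpair_pair: "f \<in> carr U \<Longrightarrow> g \<in> carr U \<Longrightarrow> w \<in> carr (H \<otimes> H) \<Longrightarrow> dpair H H f g w = pair (tens U U f g) w"
  by (rule dpair_eq_pten[OF ev.two_pairings_axioms])

lemma quadrilinear_embUU: "quadrilinear U U H H (\<lambda>f g x y. f x * g y)"
  by unfold_locales (auto intro!: bilinI linI simp: algebra_simps plus_fun_apply pw_def
      bilin_add_right[OF bilin_ev] bilin_scl_right[OF bilin_ev])

interpretation embUU: quadrilinear U U H H "\<lambda>f g x y. f x * g y"
  by (rule quadrilinear_embUU)

lemma embUU_form: "embUU H U = embUU.form"
  by (simp add: embUU_def emb_def embUU.form_def fun_eq_iff)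

lemma embUU_lin: "lin (U \<otimes> U) (dual (H \<otimes> H)) (embUU H U)"
  unfolding embUU_form by (rule embUU.lin_form)

lemma embUU_pair:
  assumes t: "t \<in> carr (U \<otimes> U)" and w: "w \<in> carr (H \<otimes> H)"
  shows "embUU H U t (flip H H w) = pair t w"
  using t vsU vsU
proof (induction rule: tensor_induct)
  case (tens f g)
  then have "embUU H U (tens U U f g) \<in> carr (dual (H \<otimes> H))" using lin_carr[OF embUU_lin] by simp
  then have l: "lin (H \<otimes> H) Kvec (embUU H U (tens U U f g))" by (rule dualD)
  show ?case using w vsH vsH
    by (induction rule: tensor_induct) (use tens in \<open>simp_all add: lin_add[OF l[unfolded embUU_form]] embUU_form embUU.form_tens\<close>)
qed (use w in \<open>simp_all add: embUU_form embUU.form_add\<close>)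

lemma pair_eqI:
  assumes "s \<in> carr (U \<otimes> U)" "t \<in> carr (U \<otimes> U)" "\<And>w. w \<in> carr (H \<otimes> H) \<Longrightarrow> pair s w = pair t w"
  shows "s = t"
  by (rule separated_eqI[OF vs_tensor ev.bilin_pten ev.separated_pten[OF separated_ev separated_ev]]) (fact assms)+

lemma embUU_inj: "inj_on (embUU H U) (carr (U \<otimes> U))"
proof (rule inj_onI)
  fix s t assume st: "s \<in> carr (U \<otimes> U)" "t \<in> carr (U \<otimes> U)" and "embUU H U s = embUU H U t"
  then show "s = t" by (intro pair_eqI) (simp_all flip: embUU_pair)
qed

text \<open>The embedding \<open>embUU\<close> is the pairing that is not nested, so it differs from \<open>pair\<close> by the flip of
  \<open>H \<otimes> H\<close>. The interchanged arguments \<open>b\<close>, \<open>a\<close> of the dual-valued map contribute the same flip.\<close>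

lemma PsiUU_props:
  assumes B [simp]: "lin (H \<otimes> H) (H \<otimes> H) B" and bij: "PsiUU_bij H U B"
  shows "lin_bij (U \<otimes> U) (U \<otimes> U) (PsiUU H U B)"
    and "\<And>t w. t \<in> carr (U \<otimes> U) \<Longrightarrow> w \<in> carr (H \<otimes> H) \<Longrightarrow> pair (PsiUU H U B t) w = pair t (B w)"
proof -
  note [simp] = lin_carr[OF B] lin_add[OF B] lin_scl[OF B, unfolded scl_tensor]
  let ?\<beta> = "\<lambda>f g b a. pair (tens U U f g) (B (tens H H a b))"
  interpret G: quadrilinear U U H H ?\<beta>
    by unfold_locales (auto intro!: bilinI linI simp: vs_carr tens_scl_left tens_scl_right
        bilin_scl_left[OF ev.bilin_pten, simplified] bilin_scl_right[OF ev.bilin_pten, simplified])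
  have cong: "tlift H H Kvec (\<lambda>b a. dpair H H f g (B (tens H H a b))) = tlift H H Kvec (?\<beta> f g)"
    if "f \<in> carr U" "g \<in> carr U" for f g
    by (rule tlift_cong) (use that in \<open>simp add: dpair_pair\<close>)
  have eq: "PsiUU_dual H U B = G.form"
    unfolding PsiUU_dual_def G.form_def by (rule tlift_cong) (simp add: cong)
  have G_pair: "PsiUU_dual H U B t (flip H H w) = pair t (B w)"
    if t: "t \<in> carr (U \<otimes> U)" and w: "w \<in> carr (H \<otimes> H)" for t w
    unfolding eq using t vsU vsU
  proof (induction rule: tensor_induct)
    case (tens f g)
    then have l: "lin (H \<otimes> H) Kvec (G.form (tens U U f g))" by (intro dualD lin_carr[OF G.lin_form]) simp
    show ?case using w vsH vsH
      by (induction rule: tensor_induct) (use tens in \<open>simp_all add: lin_add[OF l] G.form_tens\<close>)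
  qed (use w in \<open>simp_all add: G.form_add\<close>)
  note * = lin_bij_inv_embedding[OF vs_tensor vs_tensor embUU_lin embUU_inj _ bij[unfolded PsiUU_bij_def],
      folded PsiUU_def[abs_def], unfolded eq, OF G.lin_form]
  have Psi: "PsiUU H U B = (\<lambda>t. inv_into (carr (U \<otimes> U)) (embUU H U) (G.form t))"
    by (simp add: PsiUU_def[abs_def] eq)
  show lb: "lin_bij (U \<otimes> U) (U \<otimes> U) (PsiUU H U B)" using * unfolding Psi by blast
  fix t w assume t: "t \<in> carr (U \<otimes> U)" and w: "w \<in> carr (H \<otimes> H)"
  have "PsiUU H U B t \<in> carr (U \<otimes> U)" using lb t by (auto simp: lin_bij_def lin_def)
  then have "pair (PsiUU H U B t) w = embUU H U (PsiUU H U B t) (flip H H w)" using w by (simp add: embUU_pair)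
  also have "\<dots> = PsiUU_dual H U B t (flip H H w)" using * t unfolding Psi eq by simp
  finally show "pair (PsiUU H U B t) w = pair t (B w)" using t w by (simp add: G_pair)
qed


text \<open>The definition determines \<open>\<Psi>\<^sub>U\<^sub>V(f \<otimes> v)\<close> by its values on \<open>e \<otimes> a\<close> for all functionals \<open>e\<close> on \<open>V\<close>. These
  separate the points of \<open>V\<close>, so \<open>e\<close> can be stripped off.\<close>

lemma PsiUV_props:
  fixes V :: "('k, 'v::ab_group_add) vecsp"
  assumes V [simp]: "vs V" and \<Psi> [simp]: "lin (V \<otimes> H) (H \<otimes> V) \<Psi>" and bij: "PsiUV_bij H U V \<Psi>"
  shows "lin_bij (U \<otimes> V) (V \<otimes> U) (PsiUV H U V \<Psi>)"
    and "transposed ev U H V (PsiUV H U V \<Psi>) \<Psi>"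
proof -
  note [simp] = lin_carr[OF \<Psi>] lin_add[OF \<Psi>] lin_scl[OF \<Psi>, unfolded scl_tensor] vs_dual
  interpret P: two_pairings "dual V" U H V "\<lambda>f y. f y" ev
    by unfold_locales (simp_all add: bilin_eval bilin_ev)
  note evsimps = plus_fun_apply pw_def P.q_simps P.p_simps algebra_simps
  interpret E: quadrilinear V U "dual V" H "\<lambda>v f e a. e v * f a"
    by unfold_locales (auto intro!: bilinI linI simp: evsimps)
  have E: "embVU H U V = E.form"
    by (simp add: embVU_def emb_def E.form_def fun_eq_iff)
  have E_eval: "E.form z (tens (dual V) H e a) = e (cR V U (\<lambda>f. f a) z)"
    if z: "z \<in> carr (V \<otimes> U)" and e: "e \<in> carr (dual V)" and a: "a \<in> carr H" for z e a
    using z V vsU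
    by (induction rule: tensor_induct)
      (use e a in \<open>simp_all add: E.form_tens E.form_add lin_add[OF dualD[OF e]] lin_scl[OF dualD[OF e]] mult.commute[of "e _"]\<close>)
  have inj: "inj_on E.form (carr (V \<otimes> U))"
  proof (rule inj_onI)
    fix s t assume st: "s \<in> carr (V \<otimes> U)" "t \<in> carr (V \<otimes> U)" and eq: "E.form s = E.form t"
    show "s = t"
    proof (rule tensor_eqI[where A = "carr H" and \<phi> = "\<lambda>a f. f a" and X = V and Y = U])
      fix a assume a: "a \<in> carr H"
      show "cR V U (\<lambda>f. f a) s = cR V U (\<lambda>f. f a) t"
        by (rule dual_eqI[OF V]) (use a st eq in \<open>simp_all flip: E_eval\<close>)
    qed (use st separated_ev in \<open>auto simp: separated_def\<close>)
  qed
  let ?\<beta> = "\<lambda>f v e a. pten (dual V) U H V (\<lambda>f y. f y) ev (tens (dual V) U e f) (\<Psi> (tens V H v a))"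
  interpret G: quadrilinear U V "dual V" H ?\<beta>
    by unfold_locales (auto intro!: bilinI linI simp: vs_carr tens_scl_left tens_scl_right
        bilin_scl_left[OF P.bilin_pten, simplified] bilin_scl_right[OF P.bilin_pten, simplified])
  have cong: "tlift (dual V) H Kvec (\<lambda>e a. dpair H V e f (\<Psi> (tens V H v a))) = tlift (dual V) H Kvec (?\<beta> f v)"
    if "f \<in> carr U" "v \<in> carr V" for f v
    by (rule tlift_cong) (use that in \<open>simp add: dpair_eq_pten[OF P.two_pairings_axioms]\<close>)
  have G: "PsiUV_dual H U V \<Psi> = G.form"
    unfolding PsiUV_dual_def G.form_def by (rule tlift_cong) (simp add: cong)
  have Psi: "PsiUV H U V \<Psi> = (\<lambda>t. inv_into (carr (V \<otimes> U)) E.form (G.form t))"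
    by (simp add: PsiUV_def[abs_def] E G)
  note * = lin_bij_inv_embedding[OF vs_tensor vs_tensor E.lin_form inj G.lin_form bij[unfolded PsiUV_bij_def G E]]
  show lb: "lin_bij (U \<otimes> V) (V \<otimes> U) (PsiUV H U V \<Psi>)" unfolding Psi by (rule *)
  show "transposed ev U H V (PsiUV H U V \<Psi>) \<Psi>"
    unfolding transposed_def
  proof (intro ballI)
    fix f v a assume [simp]: "f \<in> carr U" "v \<in> carr V" "a \<in> carr H"
    have mem [simp]: "PsiUV H U V \<Psi> (tens U V f v) \<in> carr (V \<otimes> U)"
      using lb by (auto simp: lin_bij_def lin_def)
    have contract: "pten (dual V) U H V (\<lambda>f y. f y) ev (tens (dual V) U e f) w = e (cL H V f w)"
      if e: "e \<in> carr (dual V)" and w: "w \<in> carr (H \<otimes> V)" for e w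
      using w vsH V
      by (induction rule: tensor_induct)
        (use e in \<open>simp_all add: lin_add[OF dualD[OF e]] lin_scl[OF dualD[OF e]] mult.commute\<close>)
    show "cR V U (\<lambda>f. f a) (PsiUV H U V \<Psi> (tens U V f v)) = cL H V f (\<Psi> (tens V H v a))"
    proof (rule dual_eqI[OF V])
      fix e assume e [simp]: "e \<in> carr (dual V)"
      have "e (cR V U (\<lambda>f. f a) (PsiUV H U V \<Psi> (tens U V f v))) = E.form (PsiUV H U V \<Psi> (tens U V f v)) (tens (dual V) H e a)"
        by (simp add: E_eval)
      also have "\<dots> = G.form (tens U V f v) (tens (dual V) H e a)"
        using *(2) by (simp add: Psi)
      also have "\<dots> = e (cL H V f (\<Psi> (tens V H v a)))"
        by (simp add: G.form_tens contract)
      finally show "e (cR V U (\<lambda>f. f a) (PsiUV H U V \<Psi> (tens U V f v))) = e (cL H V f (\<Psi> (tens V H v a)))" .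
    qed simp_all
  qed
qed

lemma PsiVU_props:
  fixes V :: "('k, 'v::ab_group_add) vecsp"
  assumes V [simp]: "vs V" and \<Psi> [simp]: "lin (H \<otimes> V) (V \<otimes> H) \<Psi>" and bij: "PsiVU_bij H U V \<Psi>"
  shows "lin_bij (V \<otimes> U) (U \<otimes> V) (PsiVU H U V \<Psi>)"
    and "\<And>f v a. f \<in> carr U \<Longrightarrow> v \<in> carr V \<Longrightarrow> a \<in> carr H \<Longrightarrow>
      cL U V (\<lambda>f. f a) (PsiVU H U V \<Psi> (tens V U v f)) = cR V H f (\<Psi> (tens H V a v))"
proof -
  note [simp] = lin_carr[OF \<Psi>] lin_add[OF \<Psi>] lin_scl[OF \<Psi>, unfolded scl_tensor] vs_dual
  interpret P: two_pairings U "dual V" V H ev "\<lambda>f y. f y"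
    by unfold_locales (simp_all add: bilin_eval bilin_ev)
  note evsimps = plus_fun_apply pw_def P.q_simps P.p_simps algebra_simps
  interpret E: quadrilinear U V H "dual V" "\<lambda>f v a e. f a * e v"
    by unfold_locales (auto intro!: bilinI linI simp: evsimps)
  have E: "embUV H U V = E.form"
    by (simp add: embUV_def emb_def E.form_def fun_eq_iff)
  have E_eval: "E.form z (tens H (dual V) a e) = e (cL U V (\<lambda>f. f a) z)"
    if z: "z \<in> carr (U \<otimes> V)" and e: "e \<in> carr (dual V)" and a: "a \<in> carr H" for z e a
    using z vsU V
    by (induction rule: tensor_induct)
      (use e a in \<open>simp_all add: E.form_tens E.form_add lin_add[OF dualD[OF e]] lin_scl[OF dualD[OF e]]\<close>)
  have inj: "inj_on E.form (carr (U \<otimes> V))"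
  proof (rule inj_onI)
    fix s t assume st [simp]: "s \<in> carr (U \<otimes> V)" "t \<in> carr (U \<otimes> V)" and eq: "E.form s = E.form t"
    have "flip U V s = flip U V t"
    proof (rule tensor_eqI[where A = "carr H" and \<phi> = "\<lambda>a f. f a" and X = V and Y = U])
      fix a assume a [simp]: "a \<in> carr H"
      have "cL U V (\<lambda>f. f a) s = cL U V (\<lambda>f. f a) t"
        by (rule dual_eqI[OF V]) (use eq in \<open>simp_all flip: E_eval\<close>)
      then show "cR V U (\<lambda>f. f a) (flip U V s) = cR V U (\<lambda>f. f a) (flip U V t)"
        by (simp add: cR_flip)
    qed (use separated_ev in \<open>auto simp: separated_def\<close>)
    then have "flip V U (flip U V s) = flip V U (flip U V t)" by simp
    then show "s = t" by simp
  qed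
  let ?\<beta> = "\<lambda>v f a e. pten U (dual V) V H ev (\<lambda>f y. f y) (tens U (dual V) f e) (\<Psi> (tens H V a v))"
  interpret G: quadrilinear V U H "dual V" ?\<beta>
    by unfold_locales (auto intro!: bilinI linI simp: vs_carr tens_scl_left tens_scl_right
        bilin_scl_left[OF P.bilin_pten, simplified] bilin_scl_right[OF P.bilin_pten, simplified])
  have cong: "tlift H (dual V) Kvec (\<lambda>a e. dpair V H f e (\<Psi> (tens H V a v))) = tlift H (dual V) Kvec (?\<beta> v f)"
    if "f \<in> carr U" "v \<in> carr V" for f v
    by (rule tlift_cong) (use that in \<open>simp add: dpair_eq_pten[OF P.two_pairings_axioms]\<close>)
  have G: "PsiVU_dual H U V \<Psi> = G.form"
    unfolding PsiVU_dual_def G.form_def by (rule tlift_cong) (simp add: cong)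
  have Psi: "PsiVU H U V \<Psi> = (\<lambda>t. inv_into (carr (U \<otimes> V)) E.form (G.form t))"
    by (simp add: PsiVU_def[abs_def] E G)
  note * = lin_bij_inv_embedding[OF vs_tensor vs_tensor E.lin_form inj G.lin_form bij[unfolded PsiVU_bij_def G E]]
  show lb: "lin_bij (V \<otimes> U) (U \<otimes> V) (PsiVU H U V \<Psi>)" unfolding Psi by (rule *)
  fix f v a assume [simp]: "f \<in> carr U" "v \<in> carr V" "a \<in> carr H"
  have mem [simp]: "PsiVU H U V \<Psi> (tens V U v f) \<in> carr (U \<otimes> V)"
    using lb by (auto simp: lin_bij_def lin_def)
  have contract: "pten U (dual V) V H ev (\<lambda>f y. f y) (tens U (dual V) f e) w = e (cR V H f w)"
    if e: "e \<in> carr (dual V)" and w: "w \<in> carr (V \<otimes> H)" for e w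
    using w V vsH
    by (induction rule: tensor_induct)
      (use e in \<open>simp_all add: lin_add[OF dualD[OF e]] lin_scl[OF dualD[OF e]] mult.commute\<close>)
  show "cL U V (\<lambda>f. f a) (PsiVU H U V \<Psi> (tens V U v f)) = cR V H f (\<Psi> (tens H V a v))"
  proof (rule dual_eqI[OF V])
    fix e assume e [simp]: "e \<in> carr (dual V)"
    have "e (cL U V (\<lambda>f. f a) (PsiVU H U V \<Psi> (tens V U v f))) = E.form (PsiVU H U V \<Psi> (tens V U v f)) (tens H (dual V) a e)"
      by (simp add: E_eval)
    also have "\<dots> = G.form (tens V U v f) (tens H (dual V) a e)"
      using *(2) by (simp add: Psi)
    also have "\<dots> = e (cR V H f (\<Psi> (tens H V a v)))"
      by (simp add: G.form_tens contract)
    finally show "e (cL U V (\<lambda>f. f a) (PsiVU H U V \<Psi> (tens V U v f))) = e (cR V H f (\<Psi> (tens H V a v)))" .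
  qed simp_all
qed

lemma conv_mult_props:
  assumes B [simp]: "lin (H \<otimes> H) (H \<otimes> H) B" and \<Delta> [simp]: "lin H (H \<otimes> H) \<Delta>" and closed: "conv_subalgebra H B \<Delta> U"
  shows "lin (U \<otimes> U) U (conv_mult H B \<Delta> U)"
    and "\<And>t a. t \<in> carr (U \<otimes> U) \<Longrightarrow> a \<in> carr H \<Longrightarrow> conv_mult H B \<Delta> U t a = pair t (B (\<Delta> a))"
proof -
  note [simp] = lin_carr[OF B] lin_carr[OF \<Delta>]
  have conv: "conv H B \<Delta> f g = (\<lambda>a. if a \<in> carr H then pair (tens U U f g) (B (\<Delta> a)) else 0)"
    if "f \<in> carr U" "g \<in> carr U" for f g
    using that by (auto simp: conv_def dpair_pair)
  have b: "bilin U U U (conv H B \<Delta>)"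
  proof (intro bilinI linI)
    fix f g assume [simp]: "f \<in> carr U" "g \<in> carr U"
    show "conv H B \<Delta> f g \<in> carr U" "conv H B \<Delta> f g \<in> carr U"
      using closed by (simp_all add: conv_subalgebra_def)
  qed (auto simp: conv vs_carr[OF vsU, simplified] fun_eq_iff pw_apply plus_fun_apply
      bilin_scl_left[OF ev.bilin_pten, simplified])
  show "lin (U \<otimes> U) U (conv_mult H B \<Delta> U)"
    unfolding conv_mult_def by (rule lin_tlift[OF vsU b])
  show "conv_mult H B \<Delta> U t a = pair t (B (\<Delta> a))" if t: "t \<in> carr (U \<otimes> U)" and a: "a \<in> carr H" for t a
    unfolding conv_mult_def using t vsU vsU
  proof (induction rule: tensor_induct)
    case (add s t)
    have "tlift U U U (conv H B \<Delta>) (s + t) a = tlift U U U (conv H B \<Delta>) s a + tlift U U U (conv H B \<Delta>) t a"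
      by (simp only: tlift_add[OF vsU b add(1,2)] plus_fun_apply)
    with add a show ?case by simp
  qed (use a in \<open>simp_all add: tlift_tens[OF vsU b] conv\<close>)
qed

lemma dcomult_props:
  assumes B [simp]: "lin (H \<otimes> H) (H \<otimes> H) B" and m [simp]: "lin (H \<otimes> H) H m" and closed: "dcop_closed H B m U"
  shows "lin U (U \<otimes> U) (dcomult H B m U)"
    and "\<And>f w. f \<in> carr U \<Longrightarrow> w \<in> carr (H \<otimes> H) \<Longrightarrow> pair (dcomult H B m U f) w = f (m (B w))"
proof -
  note [simp] = lin_carr[OF B] lin_carr[OF m]
  have im: "dcop H B m f \<in> embUU H U ` carr (U \<otimes> U)" if "f \<in> carr U" for f
    using that closed by (simp add: dcop_closed_def)
  have D [simp]: "dcomult H B m U f \<in> carr (U \<otimes> U)" if "f \<in> carr U" for f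
    unfolding dcomult_def using im[OF that] by (rule inv_into_into)
  have dcop: "dcop H B m f (flip H H w) = f (m (B w))" if f: "f \<in> carr U" and w: "w \<in> carr (H \<otimes> H)" for f w
  proof -
    have "lin (H \<otimes> H) Kvec (\<lambda>w. f (m (B w)))"
      using f by (intro lin_comp[OF lin_comp[OF B m]]) simp
    from bilin_post[OF bilin_flip this] have b: "bilin H H Kvec (\<lambda>b a. f (m (B (tens H H a b))))" .
    show ?thesis
      unfolding dcop_def using w vsH vsH
      by (induction rule: tensor_induct)
        (use f in \<open>simp_all add: tlift_tens[OF vs_Kvec b] tlift_add[OF vs_Kvec b] lin_add[OF B] lin_add[OF m] ev.p_simps\<close>)
  qed
  show pair: "pair (dcomult H B m U f) w = f (m (B w))" if f: "f \<in> carr U" and w: "w \<in> carr (H \<otimes> H)" for f w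
  proof -
    have "pair (dcomult H B m U f) w = embUU H U (dcomult H B m U f) (flip H H w)"
      using f w by (simp add: embUU_pair)
    also have "embUU H U (dcomult H B m U f) = dcop H B m f"
      unfolding dcomult_def using im[OF f] by (rule f_inv_into_f)
    finally show ?thesis using f w by (simp add: dcop)
  qed
  show "lin U (U \<otimes> U) (dcomult H B m U)"
  proof (intro linI)
    fix f g c assume f [simp]: "f \<in> carr U"
    show "dcomult H B m U f \<in> carr (U \<otimes> U)" by simp
    show "dcomult H B m U (scl U c f) = scl (U \<otimes> U) c (dcomult H B m U f)"
    proof (rule pair_eqI)
      have cf [simp]: "pw c f \<in> carr U" using vs_carr(3)[OF vsU f, of c] by simp
      show "dcomult H B m U (scl U c f) \<in> carr (U \<otimes> U)" by simp
      show "pair (dcomult H B m U (scl U c f)) w = pair (scl (U \<otimes> U) c (dcomult H B m U f)) w"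
        if "w \<in> carr (H \<otimes> H)" for w
        using that pair[OF cf] pw_apply[of c f]
        by (simp add: pair bilin_scl_left[OF ev.bilin_pten, simplified])
    qed simp
    assume g [simp]: "g \<in> carr U"
    have fg [simp]: "f + g \<in> carr U" using vs_carr(2)[OF vsU f g] .
    show "dcomult H B m U (f + g) = dcomult H B m U f + dcomult H B m U g"
      using pair[OF fg] plus_fun_apply[of f g] by (intro pair_eqI) (simp_all add: pair)
  qed
qed

end

section \<open>Duals of right and of left braided spaces\<close>

locale dual_of_braided = dual_subspace H U
  for H :: "('k::field, 'h::ab_group_add) vecsp" and U :: "('k, 'h \<Rightarrow> 'k) vecsp" +
  fixes B and V :: "('k, 'v::ab_group_add) vecsp"
  assumes braided: "braided H B" and vsV [simp]: "vs V"
    and nondegenerate: "separates_points U H" and bij: "PsiUU_bij H U B"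
begin

lemma lin_B [simp]: "lin (H \<otimes> H) (H \<otimes> H) B"
  using braided by (simp add: braided_def lin_bij_def)

lemmas PsiUU_bij = PsiUU_props(1)[OF lin_B bij] and PsiUU_pair = PsiUU_props(2)[OF lin_B bij]

lemma PsiUU_lin [simp]: "lin (U \<otimes> U) (U \<otimes> U) (PsiUU H U B)"
  using PsiUU_bij by (simp add: lin_bij_def)

lemma PsiUU_braided: "braided U (PsiUU H U B)"
  unfolding braided_iff_hexL
  using hexL_transpose[OF vsU vsH bilin_ev separated_ev PsiUU_lin lin_B PsiUU_pair] braided PsiUU_bij
  by (simp add: braided_iff_hexL)

lemma evaluations_separate:
  "a \<in> carr H \<Longrightarrow> a' \<in> carr H \<Longrightarrow> (\<And>f. f \<in> carr U \<Longrightarrow> f a = f a') \<Longrightarrow> a = a'"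
  using nondegenerate by (auto simp: separates_points_def)

end

text \<open>Compatibility of the braiding \<open>B\<close> with the counit: \<open>B \<Delta>\<close> has the same counit as \<open>\<Delta>\<close>.\<close>

lemma braided_coalgebraD:
  assumes "braided_coalgebra H B \<Delta> \<epsilon>"
  shows "lin H (H \<otimes> H) \<Delta>" "lin H Kvec \<epsilon>"
    and "\<And>a. a \<in> carr H \<Longrightarrow> cL H H \<epsilon> (B (\<Delta> a)) = a" "\<And>a. a \<in> carr H \<Longrightarrow> cR H H \<epsilon> (B (\<Delta> a)) = a"
proof -
  have c: "coalgebra H \<Delta> \<epsilon>" "comult_compatL H H \<Delta> \<epsilon> B" "comult_compatR H H \<Delta> \<epsilon> B"
    and B: "lin (H \<otimes> H) (H \<otimes> H) B" and H: "vs H"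
    using assms by (auto simp: braided_coalgebra_def braided_def lin_bij_def)
  show \<Delta>: "lin H (H \<otimes> H) \<Delta>" and "lin H Kvec \<epsilon>" using c(1) by (auto simp: coalgebra_def)
  fix a assume a: "a \<in> carr H"
  have counit: "cL H H \<epsilon> (\<Delta> a) = a" "cR H H \<epsilon> (\<Delta> a) = a"
    using c(1) a by (auto simp: coalgebra_def cL_def cR_def)
  show "cL H H \<epsilon> (B (\<Delta> a)) = a"
    using c(3) lin_carr[OF \<Delta> a] counit by (simp add: comult_compatR_iff[OF H H B \<Delta>])
  show "cR H H \<epsilon> (B (\<Delta> a)) = a"
    using c(2) lin_carr[OF \<Delta> a] counit by (simp add: comult_compatL_iff[OF H H B])
qed

lemma dcounit_eq: "dcounit e = (\<lambda>f. f e)"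
  by (simp add: dcounit_def fun_eq_iff)

locale dual_of_right_braided = dual_of_braided +
  fixes \<Psi>
  assumes right: "right_braided H B V \<Psi>" and bijV: "PsiUV_bij H U V \<Psi>"
begin

lemma lin_\<Psi> [simp]: "lin (V \<otimes> H) (H \<otimes> V) \<Psi>"
  using right by (simp add: right_braided_iff lin_bij_def)

abbreviation \<psi> where "\<psi> \<equiv> PsiUV H U V \<Psi>"

lemmas \<psi>_bij = PsiUV_props(1)[OF vsV lin_\<Psi> bijV]

lemma \<psi>_lin [simp]: "lin (U \<otimes> V) (V \<otimes> U) \<psi>"
  using \<psi>_bij by (simp add: lin_bij_def)

sublocale dual: dual_braiding U H V ev \<psi> \<Psi> B "PsiUU H U B"
  by unfold_locales
    (use right PsiUU_pair in \<open>simp_all add: bilin_ev separated_ev PsiUV_props(2)[OF vsV lin_\<Psi> bijV] right_braided_iff\<close>)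

lemma left_braided: "left_braided U (PsiUU H U B) V \<psi>"
  using PsiUU_braided \<psi>_bij dual.hexL_dual by (simp add: left_braided_iff)

lemma mult_compatL:
  assumes H: "braided_coalgebra H B \<Delta> \<epsilon>" and c: "comult_compatR V H \<Delta> \<epsilon> \<Psi>" and U: "conv_subalgebra H B \<Delta> U"
  shows "mult_compatL U V (conv_mult H B \<Delta> U) \<psi>"
proof -
  note d = braided_coalgebraD[OF H]
  note m = conv_mult_props[OF lin_B d(1) U]
  show ?thesis
    by (rule dual.mult_compatL_dual[OF d(1,2) c m(1)]) (use m(2) d(3) evaluations_separate in auto)
qed

lemma comult_compatL:
  assumes H: "braided_unital_algebra H B m e" and c: "mult_compatR V H m \<Psi>" and U: "subcoalgebra_Hcirc H B m e U"
  shows "comult_compatL U V (dcomult H B m U) (dcounit e) \<psi>"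
proof -
  have m: "lin (H \<otimes> H) H m" and e: "is_unit_of H m e"
    using H by (auto simp: braided_unital_algebra_def algebra_def)
  note d = dcomult_props[OF lin_B m]
  have U: "dcop_closed H B m U" using U by (simp add: subcoalgebra_Hcirc_def)
  show ?thesis
    unfolding dcounit_eq by (rule dual.comult_compatL_dual[OF m e c d(1)[OF U]]) (rule d(2)[OF U])
qed

lemma mult_compatR: "algebra V m \<Longrightarrow> mult_compatL V H m \<Psi> \<Longrightarrow> mult_compatR U V m \<psi>"
  using dual.mult_compatR_dual by (simp add: algebra_def)

lemma comult_compatR: "coalgebra V \<Delta> \<epsilon> \<Longrightarrow> comult_compatL V H \<Delta> \<epsilon> \<Psi> \<Longrightarrow> comult_compatR U V \<Delta> \<epsilon> \<psi>"
  using dual.comult_compatR_dual by (simp add: coalgebra_def)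

end

text \<open>The mirror image of the left braided space \<open>V\<close> is right braided over \<open>H\<close> with the mirror image \<open>B'\<close>
  of the braiding, and the mirror image of \<open>\<psi>\<close> is transposed to it. So the results on right braided
  spaces apply, and reflecting their conclusions once more gives those on \<open>\<psi>\<close>.\<close>

locale dual_of_left_braided = dual_of_braided +
  fixes \<Psi>
  assumes left: "left_braided H B V \<Psi>" and bijV: "PsiVU_bij H U V \<Psi>"
begin

lemma lin_\<Psi> [simp]: "lin (H \<otimes> V) (V \<otimes> H) \<Psi>"
  using left by (simp add: left_braided_iff lin_bij_def)

abbreviation \<psi> where "\<psi> \<equiv> PsiVU H U V \<Psi>"

lemmas \<psi>_bij = PsiVU_props(1)[OF vsV lin_\<Psi> bijV]

lemma \<psi>_lin [simp]: "lin (V \<otimes> U) (U \<otimes> V) \<psi>"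
  using \<psi>_bij by (simp add: lin_bij_def)

definition "\<Psi>' t = flip V H (\<Psi> (flip V H t))"
definition "\<psi>' t = flip U V (\<psi> (flip U V t))"
definition "B' t = flip H H (B (flip H H t))"
definition "b' t = flip U U (PsiUU H U B (flip U U t))"

lemma mirror_lin [simp]: "lin (V \<otimes> H) (H \<otimes> V) \<Psi>'" "lin (U \<otimes> V) (V \<otimes> U) \<psi>'"
  "lin (H \<otimes> H) (H \<otimes> H) B'" "lin (U \<otimes> U) (U \<otimes> U) b'"
  unfolding \<Psi>'_def[abs_def] \<psi>'_def[abs_def] B'_def[abs_def] b'_def[abs_def]
  by (rule lin_comp[OF lin_comp[OF lin_flip] lin_flip], simp)+

lemmas [simp] = lin_carr[OF lin_\<Psi>] lin_carr[OF \<psi>_lin] lin_carr[OF lin_B] lin_carr[OF PsiUU_lin]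

lemma transposed_mirror: "transposed ev U H V \<psi>' \<Psi>'"
  unfolding transposed_def
  by (simp add: \<psi>'_def \<Psi>'_def cR_flip cL_flip PsiVU_props(2)[OF vsV lin_\<Psi> bijV])

sublocale mirror_H: mirror_braidings H V \<Psi> \<Psi>'
  by unfold_locales (simp_all add: \<Psi>'_def)

sublocale mirror_U: mirror_braidings U V \<psi>' \<psi>
  by unfold_locales (simp_all add: \<psi>'_def)

sublocale dual: dual_braiding U H V ev \<psi>' \<Psi>' B' b'
proof unfold_locales
  show "transposed ev U H V \<psi>' \<Psi>'" by (rule transposed_mirror)
  show "pair (b' t) w = pair t (B' w)" if "t \<in> carr (U \<otimes> U)" "w \<in> carr (H \<otimes> H)" for t w
    using that by (simp add: b'_def B'_def pair_flip PsiUU_pair)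
  show "hexR H B' V \<Psi>'"
    by (rule mirror_H.hexR_mirror[of B B']) (use left in \<open>simp_all add: B'_def left_braided_iff\<close>)
qed (simp_all add: bilin_ev separated_ev)

lemma right_braided: "right_braided U (PsiUU H U B) V \<psi>"
  using PsiUU_braided \<psi>_bij mirror_U.hexR_mirror[of b' "PsiUU H U B", OF mirror_lin(4) PsiUU_lin _ dual.hexL_dual]
  by (simp add: right_braided_iff b'_def)

lemma mult_compatR:
  assumes H: "braided_coalgebra H B \<Delta> \<epsilon>" and c: "comult_compatL H V \<Delta> \<epsilon> \<Psi>" and U: "conv_subalgebra H B \<Delta> U"
  shows "mult_compatR V U (conv_mult H B \<Delta> U) \<psi>"
proof -
  note d [simp] = braided_coalgebraD[OF H]
  note m [simp] = conv_mult_props[OF lin_B d(1) U]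
  note [simp] = lin_carr[OF d(1)]
  let ?\<Delta> = "\<lambda>a. flip H H (\<Delta> a)" and ?m = "\<lambda>t. conv_mult H B \<Delta> U (flip U U t)"
  have \<Delta>: "lin H (H \<otimes> H) ?\<Delta>" by (rule lin_comp[OF d(1) lin_flip])
  have \<mu>: "lin (U \<otimes> U) U ?m" by (rule lin_comp[OF lin_flip m(1)])
  have c': "comult_compatR V H ?\<Delta> \<epsilon> \<Psi>'"
    by (rule mirror_H.comult_compatR_mirror[OF d(1) \<Delta> d(2) _ c]) simp
  have "mult_compatL U V ?m \<psi>'"
  proof (rule dual.mult_compatL_dual[OF \<Delta> d(2) c' \<mu>])
    show "cL H H \<epsilon> (B' (?\<Delta> a)) = a" if "a \<in> carr H" for a
      using that by (simp add: B'_def cL_flip)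
  qed (use evaluations_separate in \<open>auto simp: B'_def pair_flip\<close>)
  then show ?thesis
    by (intro mirror_U.mult_compatR_mirror[OF \<mu> m(1)]) simp_all
qed

lemma comult_compatR:
  assumes H: "braided_unital_algebra H B m e" and c: "mult_compatL H V m \<Psi>" and U: "subcoalgebra_Hcirc H B m e U"
  shows "comult_compatR V U (dcomult H B m U) (dcounit e) \<psi>"
proof -
  have m: "lin (H \<otimes> H) H m" and e: "is_unit_of H m e"
    using H by (auto simp: braided_unital_algebra_def algebra_def)
  let ?m = "\<lambda>t. m (flip H H t)" and ?\<delta> = "\<lambda>f. flip U U (dcomult H B m U f)"
  have m': "lin (H \<otimes> H) H ?m" by (rule lin_comp[OF lin_flip m])
  have U: "dcop_closed H B m U" using U by (simp add: subcoalgebra_Hcirc_def)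
  note d = dcomult_props[OF lin_B m U]
  note [simp] = lin_carr[OF d(1)]
  have \<delta>: "lin U (U \<otimes> U) ?\<delta>" by (rule lin_comp[OF d(1) lin_flip])
  have e': "is_unit_of H ?m e" using e by (subst is_unit_of_mirror[of H _ m]) simp_all
  have e_carr: "e \<in> carr H" using e by (simp add: is_unit_of_def)
  have c': "mult_compatR V H ?m \<Psi>'"
    by (rule mirror_H.mult_compatR_mirror[OF m m' _ c]) simp
  have "comult_compatL U V ?\<delta> (\<lambda>f. f e) \<psi>'"
    by (rule dual.comult_compatL_dual[OF m' e' c' \<delta>]) (simp add: pair_flip d(2) B'_def)
  then show ?thesis
    unfolding dcounit_eq by (intro mirror_U.comult_compatR_mirror[OF \<delta> d(1)]) (simp_all add: e_carr)
qed

lemma mult_compatL: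
  assumes A: "algebra V m" and c: "mult_compatR H V m \<Psi>"
  shows "mult_compatL V U m \<psi>"
proof -
  have m: "lin (V \<otimes> V) V m" using A by (simp add: algebra_def)
  let ?m = "\<lambda>t. m (flip V V t)"
  have m': "lin (V \<otimes> V) V ?m" by (rule lin_comp[OF lin_flip m])
  have "mult_compatL V H ?m \<Psi>'" by (rule mirror_H.mult_compatL_mirror[OF m m' _ c]) simp
  then have "mult_compatR U V ?m \<psi>'" by (rule dual.mult_compatR_dual[OF m'])
  then show ?thesis by (rule mirror_U.mult_compatL_mirror[OF m' m, rotated]) simp
qed

lemma comult_compatL:
  assumes C: "coalgebra V \<Delta> \<epsilon>" and c: "comult_compatR H V \<Delta> \<epsilon> \<Psi>"
  shows "comult_compatL V U \<Delta> \<epsilon> \<psi>"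
proof -
  have \<Delta>: "lin V (V \<otimes> V) \<Delta>" and \<epsilon>: "lin V Kvec \<epsilon>" using C by (simp_all add: coalgebra_def)
  note [simp] = lin_carr[OF \<Delta>]
  let ?\<Delta> = "\<lambda>v. flip V V (\<Delta> v)"
  have \<Delta>': "lin V (V \<otimes> V) ?\<Delta>" by (rule lin_comp[OF \<Delta> lin_flip])
  have "comult_compatL V H ?\<Delta> \<epsilon> \<Psi>'" by (rule mirror_H.comult_compatL_mirror[OF \<Delta> \<Delta>' \<epsilon> _ c]) simp
  then have "comult_compatR U V ?\<Delta> \<epsilon> \<psi>'" by (rule dual.comult_compatR_dual[OF \<Delta>' \<epsilon>])
  then show ?thesis by (rule mirror_U.comult_compatL_mirror[OF \<Delta>' \<Delta> \<epsilon>, rotated]) simp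
qed

end

locale dual_of_right_braided_inverse = dual_of_braided +
  fixes \<Psi>
  assumes right: "right_braided H B V \<Psi>" and bijV: "PsiVU_bij H U V (inv_on (V \<otimes> H) \<Psi>)"
begin

abbreviation \<Phi> where "\<Phi> \<equiv> inv_on (V \<otimes> H) \<Psi>"

lemma lin_bij_\<Psi>: "lin_bij (V \<otimes> H) (H \<otimes> V) \<Psi>"
  using right by (simp add: right_braided_iff)

lemmas \<Phi>_bij = lin_bij_inv_on[OF vs_tensor lin_bij_\<Psi>]

sublocale inverse_braidings V H \<Psi> \<Phi>
  by unfold_locales (use lin_bij_\<Psi> \<Phi>_bij in \<open>simp_all add: lin_bij_def\<close>)

sublocale dual: dual_of_left_braided H U B V \<Phi>
  by unfold_locales (use right \<Phi>_bij hexL_inverse bijV in \<open>simp_all add: left_braided_iff right_braided_iff\<close>)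

lemmas right_braided = dual.right_braided

lemma mult_compatR:
  "braided_coalgebra H B \<Delta> \<epsilon> \<Longrightarrow> comult_compatR V H \<Delta> \<epsilon> \<Psi> \<Longrightarrow> conv_subalgebra H B \<Delta> U \<Longrightarrow>
   mult_compatR V U (conv_mult H B \<Delta> U) (PsiVU H U V \<Phi>)"
  by (rule dual.mult_compatR) (auto intro: comult_compatL_inverse braided_coalgebraD)

lemma comult_compatR:
  "braided_unital_algebra H B m e \<Longrightarrow> mult_compatR V H m \<Psi> \<Longrightarrow> subcoalgebra_Hcirc H B m e U \<Longrightarrow>
   comult_compatR V U (dcomult H B m U) (dcounit e) (PsiVU H U V \<Phi>)"
  by (rule dual.comult_compatR)
    (auto intro: mult_compatL_inverse simp: braided_unital_algebra_def algebra_def)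

lemma mult_compatL: "algebra V m \<Longrightarrow> mult_compatL V H m \<Psi> \<Longrightarrow> mult_compatL V U m (PsiVU H U V \<Phi>)"
  by (rule dual.mult_compatL) (auto intro: mult_compatR_inverse simp: algebra_def)

lemma comult_compatL:
  "coalgebra V \<Delta> \<epsilon> \<Longrightarrow> comult_compatL V H \<Delta> \<epsilon> \<Psi> \<Longrightarrow> comult_compatL V U \<Delta> \<epsilon> (PsiVU H U V \<Phi>)"
  by (rule dual.comult_compatL) (auto intro: comult_compatR_inverse simp: coalgebra_def)

end

locale dual_of_left_braided_inverse = dual_of_braided +
  fixes \<Psi>
  assumes left: "left_braided H B V \<Psi>" and bijV: "PsiUV_bij H U V (inv_on (H \<otimes> V) \<Psi>)"
begin

abbreviation \<Phi> where "\<Phi> \<equiv> inv_on (H \<otimes> V) \<Psi>"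

lemma lin_bij_\<Psi>: "lin_bij (H \<otimes> V) (V \<otimes> H) \<Psi>"
  using left by (simp add: left_braided_iff)

lemmas \<Phi>_bij = lin_bij_inv_on[OF vs_tensor lin_bij_\<Psi>]

sublocale inverse_braidings H V \<Psi> \<Phi>
  by unfold_locales (use lin_bij_\<Psi> \<Phi>_bij in \<open>simp_all add: lin_bij_def\<close>)

sublocale dual: dual_of_right_braided H U B V \<Phi>
  by unfold_locales (use left \<Phi>_bij hexR_inverse bijV in \<open>simp_all add: left_braided_iff right_braided_iff\<close>)

lemmas left_braided = dual.left_braided

lemma mult_compatL:
  "braided_coalgebra H B \<Delta> \<epsilon> \<Longrightarrow> comult_compatL H V \<Delta> \<epsilon> \<Psi> \<Longrightarrow> conv_subalgebra H B \<Delta> U \<Longrightarrow>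
   mult_compatL U V (conv_mult H B \<Delta> U) (PsiUV H U V \<Phi>)"
  by (rule dual.mult_compatL) (auto intro: comult_compatR_inverse braided_coalgebraD)

lemma comult_compatL:
  "braided_unital_algebra H B m e \<Longrightarrow> mult_compatL H V m \<Psi> \<Longrightarrow> subcoalgebra_Hcirc H B m e U \<Longrightarrow>
   comult_compatL U V (dcomult H B m U) (dcounit e) (PsiUV H U V \<Phi>)"
  by (rule dual.comult_compatL)
    (auto intro: mult_compatR_inverse simp: braided_unital_algebra_def algebra_def)

lemma mult_compatR: "algebra V m \<Longrightarrow> mult_compatR H V m \<Psi> \<Longrightarrow> mult_compatR U V m (PsiUV H U V \<Phi>)"
  by (rule dual.mult_compatR) (auto intro: mult_compatL_inverse simp: algebra_def)

lemma comult_compatR: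
  "coalgebra V \<Delta> \<epsilon> \<Longrightarrow> comult_compatR H V \<Delta> \<epsilon> \<Psi> \<Longrightarrow> comult_compatR U V \<Delta> \<epsilon> (PsiUV H U V \<Phi>)"
  by (rule dual.comult_compatR) (auto intro: comult_compatL_inverse simp: coalgebra_def)

end

theorem lemma5p2:
  fixes H :: "('k::field, 'h::ab_group_add) vecsp"
    and V :: "('k, 'v::ab_group_add) vecsp"
    and U :: "('k, 'h \<Rightarrow> 'k) vecsp"
    and \<Psi>HH :: "('h, 'h, 'k) tens \<Rightarrow> ('h, 'h, 'k) tens"
  assumes "braided H \<Psi>HH"
    and "vs V"
    and "subsp U (dual H)"
    and "separates_points U H"
    and "PsiUU_bij H U \<Psi>HH"
  shows
    "(\<forall>\<Psi>VH. right_braided H \<Psi>HH V \<Psi>VH \<and> PsiUV_bij H U V \<Psi>VH \<longrightarrow>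
        left_braided U (PsiUU H U \<Psi>HH) V (PsiUV H U V \<Psi>VH) \<and>
        (\<forall>\<Delta> \<epsilon>. braided_coalgebra H \<Psi>HH \<Delta> \<epsilon> \<and> comult_compatR V H \<Delta> \<epsilon> \<Psi>VH \<and>
             conv_subalgebra H \<Psi>HH \<Delta> U \<longrightarrow>
             mult_compatL U V (conv_mult H \<Psi>HH \<Delta> U) (PsiUV H U V \<Psi>VH)) \<and>
        (\<forall>m u. braided_unital_algebra H \<Psi>HH m u \<and> mult_compatR V H m \<Psi>VH \<and>
             subcoalgebra_Hcirc H \<Psi>HH m u U \<longrightarrow>
             comult_compatL U V (dcomult H \<Psi>HH m U) (dcounit u) (PsiUV H U V \<Psi>VH)) \<and>
        (\<forall>m. algebra V m \<and> mult_compatL V H m \<Psi>VH \<longrightarrow>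
             mult_compatR U V m (PsiUV H U V \<Psi>VH)) \<and>
        (\<forall>\<Delta> \<epsilon>. coalgebra V \<Delta> \<epsilon> \<and> comult_compatL V H \<Delta> \<epsilon> \<Psi>VH \<longrightarrow>
             comult_compatR U V \<Delta> \<epsilon> (PsiUV H U V \<Psi>VH))) \<and>
     (\<forall>\<Psi>HV. left_braided H \<Psi>HH V \<Psi>HV \<and> PsiVU_bij H U V \<Psi>HV \<longrightarrow>
        right_braided U (PsiUU H U \<Psi>HH) V (PsiVU H U V \<Psi>HV) \<and>
        (\<forall>\<Delta> \<epsilon>. braided_coalgebra H \<Psi>HH \<Delta> \<epsilon> \<and> comult_compatL H V \<Delta> \<epsilon> \<Psi>HV \<and>
             conv_subalgebra H \<Psi>HH \<Delta> U \<longrightarrow>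
             mult_compatR V U (conv_mult H \<Psi>HH \<Delta> U) (PsiVU H U V \<Psi>HV)) \<and>
        (\<forall>m u. braided_unital_algebra H \<Psi>HH m u \<and> mult_compatL H V m \<Psi>HV \<and>
             subcoalgebra_Hcirc H \<Psi>HH m u U \<longrightarrow>
             comult_compatR V U (dcomult H \<Psi>HH m U) (dcounit u) (PsiVU H U V \<Psi>HV)) \<and>
        (\<forall>m. algebra V m \<and> mult_compatR H V m \<Psi>HV \<longrightarrow>
             mult_compatL V U m (PsiVU H U V \<Psi>HV)) \<and>
        (\<forall>\<Delta> \<epsilon>. coalgebra V \<Delta> \<epsilon> \<and> comult_compatR H V \<Delta> \<epsilon> \<Psi>HV \<longrightarrow>
             comult_compatL V U \<Delta> \<epsilon> (PsiVU H U V \<Psi>HV))) \<and>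
     (\<forall>\<Psi>VH. right_braided H \<Psi>HH V \<Psi>VH \<and> PsiVU_bij H U V (inv_on (V \<otimes> H) \<Psi>VH) \<longrightarrow>
        right_braided U (PsiUU H U \<Psi>HH) V (PsiVU H U V (inv_on (V \<otimes> H) \<Psi>VH)) \<and>
        (\<forall>\<Delta> \<epsilon>. braided_coalgebra H \<Psi>HH \<Delta> \<epsilon> \<and> comult_compatR V H \<Delta> \<epsilon> \<Psi>VH \<and>
             conv_subalgebra H \<Psi>HH \<Delta> U \<longrightarrow>
             mult_compatR V U (conv_mult H \<Psi>HH \<Delta> U) (PsiVU H U V (inv_on (V \<otimes> H) \<Psi>VH))) \<and>
        (\<forall>m u. braided_unital_algebra H \<Psi>HH m u \<and> mult_compatR V H m \<Psi>VH \<and>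
             subcoalgebra_Hcirc H \<Psi>HH m u U \<longrightarrow>
             comult_compatR V U (dcomult H \<Psi>HH m U) (dcounit u) (PsiVU H U V (inv_on (V \<otimes> H) \<Psi>VH))) \<and>
        (\<forall>m. algebra V m \<and> mult_compatL V H m \<Psi>VH \<longrightarrow>
             mult_compatL V U m (PsiVU H U V (inv_on (V \<otimes> H) \<Psi>VH))) \<and>
        (\<forall>\<Delta> \<epsilon>. coalgebra V \<Delta> \<epsilon> \<and> comult_compatL V H \<Delta> \<epsilon> \<Psi>VH \<longrightarrow>
             comult_compatL V U \<Delta> \<epsilon> (PsiVU H U V (inv_on (V \<otimes> H) \<Psi>VH)))) \<and>
     (\<forall>\<Psi>HV. left_braided H \<Psi>HH V \<Psi>HV \<and> PsiUV_bij H U V (inv_on (H \<otimes> V) \<Psi>HV) \<longrightarrow>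
        left_braided U (PsiUU H U \<Psi>HH) V (PsiUV H U V (inv_on (H \<otimes> V) \<Psi>HV)) \<and>
        (\<forall>\<Delta> \<epsilon>. braided_coalgebra H \<Psi>HH \<Delta> \<epsilon> \<and> comult_compatL H V \<Delta> \<epsilon> \<Psi>HV \<and>
             conv_subalgebra H \<Psi>HH \<Delta> U \<longrightarrow>
             mult_compatL U V (conv_mult H \<Psi>HH \<Delta> U) (PsiUV H U V (inv_on (H \<otimes> V) \<Psi>HV))) \<and>
        (\<forall>m u. braided_unital_algebra H \<Psi>HH m u \<and> mult_compatL H V m \<Psi>HV \<and>
             subcoalgebra_Hcirc H \<Psi>HH m u U \<longrightarrow>
             comult_compatL U V (dcomult H \<Psi>HH m U) (dcounit u) (PsiUV H U V (inv_on (H \<otimes> V) \<Psi>HV))) \<and>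
        (\<forall>m. algebra V m \<and> mult_compatR H V m \<Psi>HV \<longrightarrow>
             mult_compatR U V m (PsiUV H U V (inv_on (H \<otimes> V) \<Psi>HV))) \<and>
        (\<forall>\<Delta> \<epsilon>. coalgebra V \<Delta> \<epsilon> \<and> comult_compatR H V \<Delta> \<epsilon> \<Psi>HV \<longrightarrow>
             comult_compatR U V \<Delta> \<epsilon> (PsiUV H U V (inv_on (H \<otimes> V) \<Psi>HV))))"
proof -
  have "vs H" using assms(1) by (simp add: braided_def)
  then interpret dual_of_braided H U \<Psi>HH V
    using assms by unfold_locales
  have R: "dual_of_right_braided H U \<Psi>HH V \<Psi>"
    if "right_braided H \<Psi>HH V \<Psi>" "PsiUV_bij H U V \<Psi>" for \<Psi>
    using that by unfold_locales
  have L: "dual_of_left_braided H U \<Psi>HH V \<Psi>"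
    if "left_braided H \<Psi>HH V \<Psi>" "PsiVU_bij H U V \<Psi>" for \<Psi>
    using that by unfold_locales
  have RI: "dual_of_right_braided_inverse H U \<Psi>HH V \<Psi>"
    if "right_braided H \<Psi>HH V \<Psi>" "PsiVU_bij H U V (inv_on (V \<otimes> H) \<Psi>)" for \<Psi>
    using that by unfold_locales
  have LI: "dual_of_left_braided_inverse H U \<Psi>HH V \<Psi>"
    if "left_braided H \<Psi>HH V \<Psi>" "PsiUV_bij H U V (inv_on (H \<otimes> V) \<Psi>)" for \<Psi>
    using that by unfold_locales
  note 1 = dual_of_right_braided.left_braided[OF R] dual_of_right_braided.mult_compatL[OF R]
    dual_of_right_braided.comult_compatL[OF R] dual_of_right_braided.mult_compatR[OF R]
    dual_of_right_braided.comult_compatR[OF R]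
  note 2 = dual_of_left_braided.right_braided[OF L] dual_of_left_braided.mult_compatR[OF L]
    dual_of_left_braided.comult_compatR[OF L] dual_of_left_braided.mult_compatL[OF L]
    dual_of_left_braided.comult_compatL[OF L]
  note 3 = dual_of_right_braided_inverse.right_braided[OF RI] dual_of_right_braided_inverse.mult_compatR[OF RI]
    dual_of_right_braided_inverse.comult_compatR[OF RI] dual_of_right_braided_inverse.mult_compatL[OF RI]
    dual_of_right_braided_inverse.comult_compatL[OF RI]
  note 4 = dual_of_left_braided_inverse.left_braided[OF LI] dual_of_left_braided_inverse.mult_compatL[OF LI]
    dual_of_left_braided_inverse.comult_compatL[OF LI] dual_of_left_braided_inverse.mult_compatR[OF LI]
    dual_of_left_braided_inverse.comult_compatR[OF LI]
  show ?thesis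
    by (intro conjI allI impI; elim conjE; (rule 3 4 1 2; assumption))
qed

end
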